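(* Let $\lambda\in\mathbb{C}^\times$ and $\alpha,\beta,a,b\in\mathbb{C}$, and let $N_{\alpha,\beta}^{\lambda,a,b}$ be the $\mathfrak{g}$-module defined in the context. Then: (i) $N_{\alpha,\beta}^{\lambda,a,b}$ is a simple $\mathfrak{g}$-module if and only if either $\beta^2+a\neq0$, or $\beta^2+a=0$ and $(\alpha_k-2s)\beta+b\neq0$ for all $k\in\mathbb{Z}$ and $s\in\mathbb{N}$. (ii) If $N_{\alpha,\beta}^{\lambda,a,b}$ is not simple, then $N'_{k,s}:=U(\mathfrak{g})\eta_{\alpha_k,\beta}$ is the Verma module with the highest weight (vector) $\eta_{\alpha_k,\beta}$, where $k\in\mathbb{Z}$ is such that $(\alpha_k-2s)\beta+b=0$ with $s\in\mathbb{N}$. Moreover, $N_{\alpha,\beta}^{\lambda,a,b}/N'_{k,s}\cong V'_{k,s}$, where $V'_{k,s}$ is a generalized weight $U(\mathfrak{g})$-module with infinite dimensional weight spaces. (iii) For any $\alpha,\beta,a,b\in\mathbb{C}$ and $\lambda,\lambda'\in\mathbb{C}^\times$, we have $N_{\alpha,\beta}^{\lambda,a,b}\cong N_{\alpha,\beta}^{\lambda',a,b}$. (iv) For any $\alpha,\beta,\alpha',\beta',a,b,a',b'\in\mathbb{C}$ and $\lambda,\lambda'\in\mathbb{C}^\times$, we have $N_{\alpha,\beta}^{\lambda,a,b}\cong N_{\alpha',\beta'}^{\lambda',a',b'}$ if and only if $\alpha-\alpha'\in2\mathbb{Z}$, $\beta=\beta'$, $a=a'$ and $b=b'$.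
   Context: All vector spaces and algebras are over $\mathbb{C}$; $\mathbb{C}^\times=\mathbb{C}\setminus\{0\}$, $\mathbb{N}=\{1,2,\dots\}$. $\mathfrak{g}=\mathfrak{sl}_2\otimes_{\mathbb{C}}\mathbb{C}[t]/(t^2)$ is the Takiff Lie algebra for $\mathfrak{sl}_2$, with $[x\otimes t^i,y\otimes t^j]=[x,y]\otimes t^{i+j}$. With the standard basis $e,h,f$ of $\mathfrak{sl}_2$ ($[e,f]=h$, $[h,e]=2e$, $[h,f]=-2f$), identify $x$ with $x\otimes 1$ and put $\overline{x}=x\otimes t$ for $x\in\{e,h,f\}$. Triangular decomposition: $\overline{\mathfrak{n}}_+=\mathrm{span}(e,\overline{e})$, $\overline{\mathfrak{h}}=\mathrm{span}(h,\overline{h})$, $\overline{\mathfrak{n}}_-=\mathrm{span}(f,\overline{f})$. Write $\overline{\partial}=\partial/\partial\overline{h}$. $\Theta(\lambda,a,b)$ is the $\mathfrak{g}$-module with underlying space $\mathbb{C}[h,\overline{h}]$, with $h,\overline{h}$ acting by multiplication and, for $\gamma=\gamma(h,\overline{h})$, $f\cdot\gamma=2\lambda\,\overline{\partial}(\gamma(h+2,\overline{h}))$, $\overline{f}\cdot\gamma=\lambda\gamma(h+2,\overline{h})$, $\overline{e}\cdot\gamma=-\frac{1}{4\lambda}(\overline{h}^2+a)\gamma(h-2,\overline{h})$, $e\cdot\gamma=-\frac{1}{2\lambda}((h-2)\overline{h}+b)\gamma(h-2,\overline{h})+\frac{1}{2\lambda}(\overline{h}^2+a)\overline{\partial}(\gamma(h-2,\overline{h}))$.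 For a $\mathfrak{g}$-module $M$, the dual space $M^*$ is a $\mathfrak{g}$-module via $(y\cdot\varphi)(v)=-\varphi(y\cdot v)$ for $y\in\mathfrak{g}$. Put $\alpha_k=\alpha+2k$. For $k\in\mathbb{Z}$, $s\in\mathbb{N}$, $\eta_{\alpha_k,\beta^s}:\mathbb{C}[h,\overline{h}]\to\mathbb{C}$ is the linear functional with $\eta_{\alpha_k,\beta^s}\big((h-\alpha_k)^i(\overline{h}-\beta)^j\big)=\delta_{i,0}\delta_{j,s-1}(s-1)!$ for all $i,j\ge0$ (the superscript in $\beta^s$ is only an index); $\eta_{\alpha_k,\beta}$ denotes the case $s=1$. $N_{\alpha,\beta}^{\lambda,a,b}$ is the submodule of $\Theta(\lambda,a,b)^*$ with basis $\{\eta_{\alpha_k,\beta^s}:k\in\mathbb{Z},\,s\in\mathbb{N}\}$. A $\mathfrak{g}$-module $M$ is a generalized weight module if it is the sum of the generalized weight spaces $M^\mu=\{v\in M: (h-\mu(h))^kv=0,\ (\overline{h}-\mu(\overline{h}))^sv=0\text{ for some }k,s\in\mathbb{N}\}$, $\mu\in\overline{\mathfrak{h}}^*$. The Verma module with highest weight $\mu\in\overline{\mathfrak{h}}^*$ is $U(\mathfrak{g})\otimes_{U(\overline{\mathfrak{h}}\oplus\overline{\mathfrak{n}}_+)}\mathbb{C}_\mu$, where $\overline{\mathfrak{n}}_+$ acts on $\mathbb{C}_\mu$ by $0$ and $\overline{\mathfrak{h}}$ by $\mu$; its canonical generator is the highest weight vector.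
   Formalization: In (ii), for β≠0 and s≥2 the vector η_{α_k,β} is not a highest weight vector (e acts on it nontrivially), so there N'_{k,s} is stated to be the Verma module with highest weight vector η_{α_{k-s+1},β}; the claim is literal for s=1 or β=0. *)

theory Defs
  imports
    "HOL-Analysis.Determinants"
    "HOL-Computational_Algebra.Polynomial"
    "HOL-Algebra.QuotRing"
    "HOL-Algebra.Module"
begin

section \<open>Complex vector spaces, Lie algebras and their modules\<close>

text \<open>
  Vector spaces are HOL-Algebra modules over the field below. The \<open>module\<close> record extends
  \<open>ring\<close>; its fields \<open>mult\<close> and \<open>one\<close> play no role for a vector space and are left
  \<open>undefined\<close>.
\<close>

definition cplx :: "complex ring" where
  "cplx = \<lparr>carrier = UNIV, mult = (*), one = 1, zero = 0, add = (+)\<rparr>"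

definition lin_span :: "(complex, 'v, 'm) module_scheme \<Rightarrow> 'v set \<Rightarrow> 'v set" where
  "lin_span M S = \<Inter> {W. submodule W cplx M \<and> S \<subseteq> W}"

record 'g lie_algebra = "(complex, 'g) module" +
  bracket :: "'g \<Rightarrow> 'g \<Rightarrow> 'g"

record ('g, 'v) rep = "(complex, 'v) module" +
  act :: "'g \<Rightarrow> 'v \<Rightarrow> 'v"

definition lie_module :: "'g lie_algebra \<Rightarrow> ('g, 'v) rep \<Rightarrow> bool" where
  "lie_module L M \<longleftrightarrow> Module.module cplx M \<and>
     (\<forall>x\<in>carrier L. \<forall>v\<in>carrier M. act M x v \<in> carrier M) \<and>
     (\<forall>x\<in>carrier L. \<forall>v\<in>carrier M. \<forall>w\<in>carrier M.
        act M x (v \<oplus>\<^bsub>M\<^esub> w) = act M x v \<oplus>\<^bsub>M\<^esub> act M x w) \<and>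
     (\<forall>x\<in>carrier L. \<forall>c. \<forall>v\<in>carrier M. act M x (c \<odot>\<^bsub>M\<^esub> v) = c \<odot>\<^bsub>M\<^esub> act M x v) \<and>
     (\<forall>x\<in>carrier L. \<forall>y\<in>carrier L. \<forall>v\<in>carrier M.
        act M (x \<oplus>\<^bsub>L\<^esub> y) v = act M x v \<oplus>\<^bsub>M\<^esub> act M y v) \<and>
     (\<forall>c. \<forall>x\<in>carrier L. \<forall>v\<in>carrier M. act M (c \<odot>\<^bsub>L\<^esub> x) v = c \<odot>\<^bsub>M\<^esub> act M x v) \<and>
     (\<forall>x\<in>carrier L. \<forall>y\<in>carrier L. \<forall>v\<in>carrier M.
        act M (bracket L x y) v = act M x (act M y v) \<ominus>\<^bsub>M\<^esub> act M y (act M x v))"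

definition lie_submodule :: "'g lie_algebra \<Rightarrow> ('g, 'v) rep \<Rightarrow> 'v set \<Rightarrow> bool" where
  "lie_submodule L M W \<longleftrightarrow>
     submodule W cplx M \<and> (\<forall>x\<in>carrier L. \<forall>w\<in>W. act M x w \<in> W)"

definition simple_rep :: "'g lie_algebra \<Rightarrow> ('g, 'v) rep \<Rightarrow> bool" where
  "simple_rep L M \<longleftrightarrow> lie_module L M \<and> carrier M \<noteq> {\<zero>\<^bsub>M\<^esub>} \<and>
     (\<forall>W. lie_submodule L M W \<longrightarrow> W = {\<zero>\<^bsub>M\<^esub>} \<or> W = carrier M)"

definition rep_iso :: "'g lie_algebra \<Rightarrow> ('g, 'v) rep \<Rightarrow> ('g, 'w) rep \<Rightarrow> ('v \<Rightarrow> 'w) \<Rightarrow> bool" where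
  "rep_iso L M N f \<longleftrightarrow> bij_betw f (carrier M) (carrier N) \<and>
     (\<forall>v\<in>carrier M. \<forall>w\<in>carrier M. f (v \<oplus>\<^bsub>M\<^esub> w) = f v \<oplus>\<^bsub>N\<^esub> f w) \<and>
     (\<forall>c. \<forall>v\<in>carrier M. f (c \<odot>\<^bsub>M\<^esub> v) = c \<odot>\<^bsub>N\<^esub> f v) \<and>
     (\<forall>x\<in>carrier L. \<forall>v\<in>carrier M. f (act M x v) = act N x (f v))"

definition isomorphic_rep :: "'g lie_algebra \<Rightarrow> ('g, 'v) rep \<Rightarrow> ('g, 'w) rep \<Rightarrow> bool" where
  "isomorphic_rep L M N \<longleftrightarrow> (\<exists>f. rep_iso L M N f)"

text \<open>
  The quotient of \<open>M\<close> by a submodule \<open>W\<close>, with cosets as elements; the operations on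
  cosets are defined without choosing representatives, as in \<^const>\<open>rcoset_mult\<close>.
\<close>

definition quot_rep :: "('g, 'v) rep \<Rightarrow> 'v set \<Rightarrow> ('g, 'v set) rep" where
  "quot_rep M W =
     \<lparr>carrier = a_rcosets\<^bsub>M\<^esub> W, mult = undefined, one = undefined,
      zero = W, add = set_add M,
      smult = (\<lambda>c C. \<Union>v\<in>C. W +>\<^bsub>M\<^esub> (c \<odot>\<^bsub>M\<^esub> v)),
      act = (\<lambda>x C. \<Union>v\<in>C. W +>\<^bsub>M\<^esub> act M x v)\<rparr>"

text \<open>The dual space; functionals are normalised to be \<^const>\<open>undefined\<close> off the carrier.\<close>

definition dual_rep :: "('g, 'v) rep \<Rightarrow> ('g, 'v \<Rightarrow> complex) rep" where
  "dual_rep M =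
     \<lparr>carrier = {\<phi> \<in> extensional (carrier M).
         (\<forall>v\<in>carrier M. \<forall>w\<in>carrier M. \<phi> (v \<oplus>\<^bsub>M\<^esub> w) = \<phi> v + \<phi> w) \<and>
         (\<forall>c. \<forall>v\<in>carrier M. \<phi> (c \<odot>\<^bsub>M\<^esub> v) = c * \<phi> v)},
      mult = undefined, one = undefined,
      zero = (\<lambda>v\<in>carrier M. 0),
      add = (\<lambda>\<phi> \<psi>. \<lambda>v\<in>carrier M. \<phi> v + \<psi> v),
      smult = (\<lambda>c \<phi>. \<lambda>v\<in>carrier M. c * \<phi> v),
      act = (\<lambda>y \<phi>. \<lambda>v\<in>carrier M. - \<phi> (act M y v))\<rparr>"


section \<open>The universal enveloping algebra\<close>

text \<open>
  The free associative algebra on a set \<open>X\<close>: finitely supported functions on words, with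
  convolution as product. \<open>U(L)\<close> is the free algebra on the elements of \<open>L\<close> modulo the
  two-sided ideal which makes the map from \<open>L\<close> linear and turns brackets into commutators.
\<close>

definition word :: "complex \<Rightarrow> 'x list \<Rightarrow> 'x list \<Rightarrow> complex" where
  "word c w = (\<lambda>w'. if w' = w then c else 0)"

definition free_algebra :: "'x set \<Rightarrow> ('x list \<Rightarrow> complex) ring" where
  "free_algebra X =
     \<lparr>carrier = {p. finite {w. p w \<noteq> 0} \<and> (\<forall>w. p w \<noteq> 0 \<longrightarrow> set w \<subseteq> X)},
      mult = (\<lambda>p q w. \<Sum>i\<le>length w. p (take i w) * q (drop i w)),
      one = word 1 [], zero = (\<lambda>w. 0), add = (\<lambda>p q w. p w + q w)\<rparr>"

definition env_relations :: "'g lie_algebra \<Rightarrow> ('g list \<Rightarrow> complex) set" where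
  "env_relations L =
     {(\<lambda>w. word 1 [x \<oplus>\<^bsub>L\<^esub> y] w - word 1 [x] w - word 1 [y] w) | x y.
        x \<in> carrier L \<and> y \<in> carrier L} \<union>
     {(\<lambda>w. word 1 [c \<odot>\<^bsub>L\<^esub> x] w - word c [x] w) | c x. x \<in> carrier L} \<union>
     {(\<lambda>w. word 1 [x, y] w - word 1 [y, x] w - word 1 [bracket L x y] w) | x y.
        x \<in> carrier L \<and> y \<in> carrier L}"

definition env_ideal :: "'g lie_algebra \<Rightarrow> ('g list \<Rightarrow> complex) set" where
  "env_ideal L = Idl\<^bsub>free_algebra (carrier L)\<^esub> (env_relations L)"

definition env_algebra :: "'g lie_algebra \<Rightarrow> ('g list \<Rightarrow> complex) set ring" where
  "env_algebra L = free_algebra (carrier L) Quot env_ideal L"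

definition env_class :: "'g lie_algebra \<Rightarrow> ('g list \<Rightarrow> complex) \<Rightarrow> ('g list \<Rightarrow> complex) set" where
  "env_class L p = env_ideal L +>\<^bsub>free_algebra (carrier L)\<^esub> p"

text \<open>
  On an \<open>L\<close>-module the action of \<open>U(L)\<close> is the action of the free algebra on
  representatives: \<open>env_class L p\<close> sends \<open>v\<close> to \<open>free_act M p v\<close>.
\<close>

definition free_act :: "('g, 'v) rep \<Rightarrow> ('g list \<Rightarrow> complex) \<Rightarrow> 'v \<Rightarrow> 'v" where
  "free_act M p v = finsum M (\<lambda>w. p w \<odot>\<^bsub>M\<^esub> foldr (act M) w v) {w. p w \<noteq> 0}"

definition env_orbit :: "'g lie_algebra \<Rightarrow> ('g, 'v) rep \<Rightarrow> 'v \<Rightarrow> 'v set" where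
  "env_orbit L M v = (\<lambda>p. free_act M p v) ` carrier (free_algebra (carrier L))"


section \<open>Induced modules\<close>

text \<open>
  For a subalgebra \<open>B\<close> of \<open>L\<close> and a \<open>B\<close>-module \<open>M\<close>, the induced module is
  \<open>U(L) \<otimes>\<^bsub>U(B)\<^esub> M\<close>: the free vector space on \<open>U(L) \<times> M\<close> modulo bilinearity and
  \<open>u q \<otimes> m = u \<otimes> q m\<close> for \<open>q \<in> U(B)\<close>. An element \<open>q\<close> of \<open>U(B)\<close> is given by a representative
  in the free algebra on \<open>B\<close>; it acts on \<open>U(L)\<close> through the canonical map
  \<open>U(B) \<rightarrow> U(L)\<close> and on \<open>M\<close> by \<^const>\<open>free_act\<close>.
\<close>

definition delta :: "'a \<Rightarrow> 'a \<Rightarrow> complex" where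
  "delta a = (\<lambda>a'. if a' = a then 1 else 0)"

definition pre_tensor ::
    "'g lie_algebra \<Rightarrow> ('g, 'v) rep \<Rightarrow> ('g, (('g list \<Rightarrow> complex) set \<times> 'v) \<Rightarrow> complex) rep" where
  "pre_tensor L M =
     \<lparr>carrier = {\<phi>. finite {a. \<phi> a \<noteq> 0} \<and> {a. \<phi> a \<noteq> 0} \<subseteq> carrier (env_algebra L) \<times> carrier M},
      mult = undefined, one = undefined,
      zero = (\<lambda>a. 0), add = (\<lambda>\<phi> \<psi> a. \<phi> a + \<psi> a), smult = (\<lambda>c \<phi> a. c * \<phi> a),
      act = (\<lambda>x \<phi> (u', m).
        \<Sum>u | \<phi> (u, m) \<noteq> 0 \<and> env_class L (word 1 [x]) \<otimes>\<^bsub>env_algebra L\<^esub> u = u'. \<phi> (u, m))\<rparr>"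

definition tensor_relations ::
    "'g lie_algebra \<Rightarrow> 'g lie_algebra \<Rightarrow> ('g, 'v) rep
       \<Rightarrow> ((('g list \<Rightarrow> complex) set \<times> 'v) \<Rightarrow> complex) set" where
  "tensor_relations L B M =
     {(\<lambda>a. delta (u \<oplus>\<^bsub>env_algebra L\<^esub> u', m) a - delta (u, m) a - delta (u', m) a) | u u' m.
        u \<in> carrier (env_algebra L) \<and> u' \<in> carrier (env_algebra L) \<and> m \<in> carrier M} \<union>
     {(\<lambda>a. delta (env_class L (word c []) \<otimes>\<^bsub>env_algebra L\<^esub> u, m) a - c * delta (u, m) a) | c u m.
        u \<in> carrier (env_algebra L) \<and> m \<in> carrier M} \<union>
     {(\<lambda>a. delta (u, m \<oplus>\<^bsub>M\<^esub> m') a - delta (u, m) a - delta (u, m') a) | u m m'.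
        u \<in> carrier (env_algebra L) \<and> m \<in> carrier M \<and> m' \<in> carrier M} \<union>
     {(\<lambda>a. delta (u, c \<odot>\<^bsub>M\<^esub> m) a - c * delta (u, m) a) | c u m.
        u \<in> carrier (env_algebra L) \<and> m \<in> carrier M} \<union>
     {(\<lambda>a. delta (u \<otimes>\<^bsub>env_algebra L\<^esub> env_class L q, m) a - delta (u, free_act M q m) a) | u q m.
        u \<in> carrier (env_algebra L) \<and> q \<in> carrier (free_algebra (carrier B)) \<and> m \<in> carrier M}"

definition tensor_kernel ::
    "'g lie_algebra \<Rightarrow> 'g lie_algebra \<Rightarrow> ('g, 'v) rep
       \<Rightarrow> ((('g list \<Rightarrow> complex) set \<times> 'v) \<Rightarrow> complex) set" where
  "tensor_kernel L B M = lin_span (pre_tensor L M) (tensor_relations L B M)"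

definition induced_rep ::
    "'g lie_algebra \<Rightarrow> 'g lie_algebra \<Rightarrow> ('g, 'v) rep
       \<Rightarrow> ('g, ((('g list \<Rightarrow> complex) set \<times> 'v) \<Rightarrow> complex) set) rep" where
  "induced_rep L B M = quot_rep (pre_tensor L M) (tensor_kernel L B M)"

definition pure_tensor ::
    "'g lie_algebra \<Rightarrow> 'g lie_algebra \<Rightarrow> ('g, 'v) rep \<Rightarrow> ('g list \<Rightarrow> complex) set \<Rightarrow> 'v
       \<Rightarrow> ((('g list \<Rightarrow> complex) set \<times> 'v) \<Rightarrow> complex) set" where
  "pure_tensor L B M u m = tensor_kernel L B M +>\<^bsub>pre_tensor L M\<^esub> delta (u, m)"


section \<open>The Takiff algebra of \<open>sl\<^sub>2\<close>\<close>

text \<open>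
  \<open>sl\<^sub>2\<close> consists of the traceless matrices, and the pair \<open>(A, B)\<close> stands for
  \<open>A \<otimes> 1 + B \<otimes> t\<close>. The coordinates of a traceless matrix in the basis \<open>e, h, f\<close> are its
  entries at \<open>(1,2)\<close>, \<open>(1,1)\<close> and \<open>(2,1)\<close>.
\<close>

type_synonym takiff = "(complex^2^2) \<times> (complex^2^2)"

definition commutator :: "complex^2^2 \<Rightarrow> complex^2^2 \<Rightarrow> complex^2^2" where
  "commutator A B = A ** B - B ** A"

definition takiff :: "takiff lie_algebra" where
  "takiff =
     \<lparr>carrier = {(A, B). trace A = 0 \<and> trace B = 0},
      mult = undefined, one = undefined, zero = (0, 0),
      add = (\<lambda>(A, B) (A', B'). (A + A', B + B')),
      smult = (\<lambda>c (A, B). (\<chi> i j. c * A $ i $ j, \<chi> i j. c * B $ i $ j)),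
      bracket = (\<lambda>(A, B) (A', B'). (commutator A A', commutator A B' + commutator B A'))\<rparr>"

definition h_el :: takiff where
  "h_el = (vector [vector [1, 0], vector [0, -1]], 0)"

definition hbar_el :: takiff where
  "hbar_el = (0, vector [vector [1, 0], vector [0, -1]])"

text \<open>The subalgebra spanned by \<open>h\<close>, \<open>h\<close>-bar, \<open>e\<close>, \<open>e\<close>-bar.\<close>

definition borel :: "takiff lie_algebra" where
  "borel = takiff\<lparr>carrier := {(A, B) \<in> carrier takiff. A $ 2 $ 1 = 0 \<and> B $ 2 $ 1 = 0}\<rparr>"

text \<open>
  A weight \<open>\<mu>\<close>, i.e. a linear functional on the span of \<open>h\<close> and \<open>h\<close>-bar, is given by its two
  values \<open>m = \<mu>(h)\<close> and \<open>mb = \<mu>(h-bar)\<close>. The action below is only meant for elements of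
  \<^const>\<open>borel\<close>.
\<close>

definition weight_line :: "complex \<Rightarrow> complex \<Rightarrow> (takiff, complex) rep" where
  "weight_line m mb =
     \<lparr>carrier = UNIV, mult = undefined, one = undefined, zero = 0, add = (+), smult = (*),
      act = (\<lambda>(A, B) z. (A $ 1 $ 1 * m + B $ 1 $ 1 * mb) * z)\<rparr>"

definition verma :: "complex \<Rightarrow> complex
    \<Rightarrow> (takiff, (((takiff list \<Rightarrow> complex) set \<times> complex) \<Rightarrow> complex) set) rep" where
  "verma m mb = induced_rep takiff borel (weight_line m mb)"

definition verma_gen :: "complex \<Rightarrow> complex
    \<Rightarrow> (((takiff list \<Rightarrow> complex) set \<times> complex) \<Rightarrow> complex) set" where
  "verma_gen m mb =
     pure_tensor takiff borel (weight_line m mb) \<one>\<^bsub>env_algebra takiff\<^esub> 1"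

definition is_verma_with_hwv :: "(takiff, 'v) rep \<Rightarrow> 'v \<Rightarrow> bool" where
  "is_verma_with_hwv M v \<longleftrightarrow>
     (\<exists>m mb f. rep_iso takiff (verma m mb) M f \<and> f (verma_gen m mb) = v)"

definition gen_weight_space :: "(takiff, 'v) rep \<Rightarrow> complex \<Rightarrow> complex \<Rightarrow> 'v set" where
  "gen_weight_space M m mb =
     {v \<in> carrier M. \<exists>k\<ge>1. \<exists>s\<ge>1.
        ((\<lambda>w. act M h_el w \<ominus>\<^bsub>M\<^esub> m \<odot>\<^bsub>M\<^esub> w) ^^ k) v = \<zero>\<^bsub>M\<^esub> \<and>
        ((\<lambda>w. act M hbar_el w \<ominus>\<^bsub>M\<^esub> mb \<odot>\<^bsub>M\<^esub> w) ^^ s) v = \<zero>\<^bsub>M\<^esub>}"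

definition gen_weight_module :: "(takiff, 'v) rep \<Rightarrow> bool" where
  "gen_weight_module M \<longleftrightarrow> lie_module takiff M \<and>
     lin_span M (\<Union>m mb. gen_weight_space M m mb) = carrier M"

definition infinite_dim :: "(complex, 'v, 'm) module_scheme \<Rightarrow> 'v set \<Rightarrow> bool" where
  "infinite_dim M W \<longleftrightarrow> \<not> (\<exists>S. finite S \<and> S \<subseteq> W \<and> W \<subseteq> lin_span M S)"

text \<open>
  Here a weight is a \<open>\<mu>\<close> whose generalized weight space is nonzero, and at least one such
  \<open>\<mu>\<close> is required.
\<close>

definition infinite_dim_weight_spaces :: "(takiff, 'v) rep \<Rightarrow> bool" where
  "infinite_dim_weight_spaces M \<longleftrightarrow>
     (\<exists>m mb. gen_weight_space M m mb \<noteq> {\<zero>\<^bsub>M\<^esub>}) \<and>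
     (\<forall>m mb. gen_weight_space M m mb \<noteq> {\<zero>\<^bsub>M\<^esub>} \<longrightarrow> infinite_dim M (gen_weight_space M m mb))"


section \<open>The modules \<open>\<Theta>\<close> and \<open>N\<close>\<close>

text \<open>
  The polynomial ring in \<open>h\<close> and \<open>h\<close>-bar is \<^typ>\<open>complex poly poly\<close>, where the outer variable
  is \<open>h\<close>-bar and the coefficients are polynomials in \<open>h\<close>; so \<^const>\<open>pderiv\<close> is the partial
  derivative in \<open>h\<close>-bar.
\<close>

type_synonym poly_hh = "complex poly poly"

definition const_p :: "complex \<Rightarrow> poly_hh" where
  "const_p c = [:[:c:]:]"

definition var_h :: poly_hh where
  "var_h = [:[:0, 1:]:]"

definition var_hbar :: poly_hh where
  "var_hbar = [:0, 1:]"

text \<open>The polynomial \<open>\<gamma>(h + c, h-bar)\<close>.\<close>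

definition shift_h :: "complex \<Rightarrow> poly_hh \<Rightarrow> poly_hh" where
  "shift_h c \<gamma> = map_poly (\<lambda>q. pcompose q [:c, 1:]) \<gamma>"

definition theta_f :: "complex \<Rightarrow> poly_hh \<Rightarrow> poly_hh" where
  "theta_f lam \<gamma> = const_p (2 * lam) * pderiv (shift_h 2 \<gamma>)"

definition theta_fbar :: "complex \<Rightarrow> poly_hh \<Rightarrow> poly_hh" where
  "theta_fbar lam \<gamma> = const_p lam * shift_h 2 \<gamma>"

definition theta_ebar :: "complex \<Rightarrow> complex \<Rightarrow> poly_hh \<Rightarrow> poly_hh" where
  "theta_ebar lam a \<gamma> =
     const_p (- (1 / (4 * lam))) * (var_hbar\<^sup>2 + const_p a) * shift_h (-2) \<gamma>"

definition theta_e :: "complex \<Rightarrow> complex \<Rightarrow> complex \<Rightarrow> poly_hh \<Rightarrow> poly_hh" where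
  "theta_e lam a b \<gamma> =
     const_p (- (1 / (2 * lam))) * ((var_h - const_p 2) * var_hbar + const_p b) * shift_h (-2) \<gamma>
     + const_p (1 / (2 * lam)) * (var_hbar\<^sup>2 + const_p a) * pderiv (shift_h (-2) \<gamma>)"

definition Theta :: "complex \<Rightarrow> complex \<Rightarrow> complex \<Rightarrow> (takiff, poly_hh) rep" where
  "Theta lam a b =
     \<lparr>carrier = UNIV, mult = undefined, one = undefined, zero = 0, add = (+),
      smult = (\<lambda>c \<gamma>. const_p c * \<gamma>),
      act = (\<lambda>(A, B) \<gamma>.
          const_p (A $ 1 $ 2) * theta_e lam a b \<gamma> + const_p (A $ 1 $ 1) * (var_h * \<gamma>)
        + const_p (A $ 2 $ 1) * theta_f lam \<gamma>
        + const_p (B $ 1 $ 2) * theta_ebar lam a \<gamma> + const_p (B $ 1 $ 1) * (var_hbar * \<gamma>)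
        + const_p (B $ 2 $ 1) * theta_fbar lam \<gamma>)\<rparr>"

text \<open>
  \<open>eta x y s\<close> is the functional \<open>\<eta>\<close> at the point \<open>(x, y)\<close> with index \<open>s \<ge> 1\<close>. The polynomials
  \<open>(h - x)\<^sup>i (h-bar - y)\<^sup>j\<close> form a basis, so it exists and is unique.
\<close>

definition eta :: "complex \<Rightarrow> complex \<Rightarrow> nat \<Rightarrow> poly_hh \<Rightarrow> complex" where
  "eta x y s = (THE \<phi>.
     (\<forall>p q. \<phi> (p + q) = \<phi> p + \<phi> q) \<and> (\<forall>c p. \<phi> (const_p c * p) = c * \<phi> p) \<and>
     (\<forall>i j. \<phi> ((var_h - const_p x) ^ i * (var_hbar - const_p y) ^ j) =
        (if i = 0 \<and> j = s - 1 then fact (s - 1) else 0)))"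

definition alpha_at :: "complex \<Rightarrow> int \<Rightarrow> complex" where
  "alpha_at \<alpha> k = \<alpha> + 2 * of_int k"

definition N_mod :: "complex \<Rightarrow> complex \<Rightarrow> complex \<Rightarrow> complex \<Rightarrow> complex
    \<Rightarrow> (takiff, poly_hh \<Rightarrow> complex) rep" where
  "N_mod lam a b \<alpha> \<beta> = (dual_rep (Theta lam a b))\<lparr>carrier :=
     lin_span (dual_rep (Theta lam a b)) {eta (alpha_at \<alpha> k) \<beta> s | k s. s \<ge> 1}\<rparr>"

end

theory Submission
  imports Defs "HOL-Library.Function_Algebras"
begin

text \<open>
  Write \<open>B k j\<close> for the functional \<open>eta (alpha_at \<alpha> k) \<beta> (j + 1)\<close>: it is the \<open>j\<close>-th derivative
  in \<open>h\<close>-bar, evaluated at the point \<open>(\<alpha> + 2k, \<beta>)\<close>. The \<open>B k j\<close> form a basis of \<open>N\<close>, and the six basis elements of the Takiff algebra act on it by the explicit formulas of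
  \<open>act_basis\<close>: \<open>h\<close> is diagonal with eigenvalue \<open>- (\<alpha> + 2k)\<close>, \<open>h\<close>-bar is \<open>- \<beta>\<close> plus a lowering of \<open>j\<close>,
  \<open>f\<close> and \<open>f\<close>-bar raise \<open>k\<close> (and \<open>f\<close> raises \<open>j\<close>), \<open>e\<close> and \<open>e\<close>-bar lower \<open>k\<close>. All parts of the theorem
  are read off from these formulas.

  Simplicity. In a nonzero submodule, \<open>h\<close> separates the indices \<open>k\<close>, and \<open>h\<close>-bar \<open>+ \<beta>\<close> lowers \<open>j\<close> until
  some \<open>B k 0\<close> is reached (\<open>submodule_contains_eta\<close>). From there \<open>f\<close>-bar reaches all larger \<open>k\<close>.
  Downwards, \<open>e\<close>-bar maps \<open>B k 0\<close> to \<open>B (k - 1) 0\<close> with a factor proportional to \<open>\<beta>\<^sup>2 + a\<close>, and if this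
  is zero, \<open>e\<close> does so with a factor proportional to \<open>(\<alpha> + 2k - 2) \<beta> + b\<close>. If neither obstruction
  occurs, all \<open>B k 0\<close> and then, by \<open>f\<close>, all \<open>B k j\<close> are reached (\<open>simple_if\<close>). If \<open>\<beta>\<^sup>2 + a = 0\<close> and the
  second factor vanishes at \<open>k0\<close>, the span \<open>W k0\<close> of the \<open>B k j\<close> with \<open>k \<ge> k0 + j\<close> is a proper
  submodule (\<open>W_submodule\<close>, \<open>not_simple\<close>). The values \<open>(\<alpha> + 2k - 2s) \<beta> + b\<close> for \<open>s \<ge> 1\<close> are those for
  \<open>s = 1\<close> at other \<open>k\<close>, so that the condition with \<open>s = 1\<close> is the one in the statement.

  Verma modules. The vectors \<open>f^j f-bar^i B k0 0\<close> are nonzero multiples of the \<open>B (k0 + i + j) j\<close>,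
  hence form a basis of \<open>W k0\<close>. By \<open>verma_characterisation\<close> a module in which the vectors
  \<open>f^j f-bar^i v\<close> for a highest weight vector \<open>v\<close> form a basis is a Verma module. Only the easy half of
  the Poincare-Birkhoff-Witt theorem enters: the monomials \<open>f^j f-bar^i \<otimes> 1\<close> span the induced module,
  because \<open>e\<close>, \<open>h\<close> and their barred versions can be commuted to the right. The canonical map sends these
  monomials to linearly independent vectors, and is therefore injective.

  Quotient. \<open>N / W k0\<close> has the images of the \<open>B k j\<close> with \<open>k < k0 + j\<close> as a basis; for each \<open>k\<close> these
  are infinitely many \<open>j\<close>, and \<open>h + (\<alpha> + 2k)\<close> and \<open>h\<close>-bar \<open>+ \<beta>\<close> act locally nilpotently on their span
  (\<open>Q_gen_weight\<close>, \<open>Q_infinite\<close>).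

  Isomorphisms. The map \<open>B k j \<mapsto> (\<lambda>'/\<lambda>)^k B k j\<close> intertwines the actions for \<open>\<lambda>\<close> and \<open>\<lambda>'\<close>
  (\<open>isomorphic_lam\<close>), and adding an even integer to \<open>\<alpha>\<close> only renumbers the basis (\<open>N_mod_shift\<close>).
  Conversely an isomorphism sends \<open>B 0 0\<close> to an eigenvector of \<open>h\<close> and \<open>h\<close>-bar, which must be a
  multiple of some \<open>B k 0\<close>. Its eigenvalues give \<open>\<beta>\<close> and \<open>\<alpha>\<close> modulo \<open>2Z\<close>; the eigenvalues of
  \<open>e\<close>-bar \<open>f\<close>-bar and of \<open>e f\<close>-bar \<open>+ e\<close>-bar \<open>f\<close>, which are the two Casimir elements up to polynomials
  in \<open>h\<close> and \<open>h\<close>-bar, give \<open>a\<close> and \<open>b\<close> (\<open>casimir\<close>, \<open>isomorphic_imp_parameters\<close>).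
\<close>

section \<open>Spaces of complex functions\<close>

definition fscale :: "complex \<Rightarrow> ('a \<Rightarrow> complex) \<Rightarrow> 'a \<Rightarrow> complex" where
  "fscale c \<phi> = (\<lambda>x. c * \<phi> x)"

lemma fscale_apply [simp]: "fscale c \<phi> x = c * \<phi> x"
  by (simp add: fscale_def)

interpretation fv: vector_space fscale
  by unfold_locales (simp_all add: fun_eq_iff algebra_simps)

lemma cplx_simps [simp]:
  "carrier cplx = UNIV" "mult cplx = (*)" "one cplx = 1" "zero cplx = 0" "add cplx = (+)"
  by (simp_all add: cplx_def)

lemma cring_cplx: "cring cplx"
proof (intro cringI abelian_groupI comm_monoidI)
  fix x :: complex
  show "\<exists>y\<in>carrier cplx. y \<oplus>\<^bsub>cplx\<^esub> x = \<zero>\<^bsub>cplx\<^esub>"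
    by (auto intro: exI[of _ "- x"])
qed (simp_all add: algebra_simps)

text \<open>
  The dual of a representation and the free vector space on a set both consist of complex functions
  with pointwise operations. For such modules, submodules and linear hulls are ordinary subspaces and
  spans, so that computations need no carriers.
\<close>

definition pointwise :: "(complex, 'a \<Rightarrow> complex, 'm) module_scheme \<Rightarrow> bool" where
  "pointwise M \<longleftrightarrow> fv.subspace (carrier M) \<and>
     zero M = 0 \<and> add M = (+) \<and> smult M = fscale"

lemma pointwiseD:
  assumes "pointwise M"
  shows "fv.subspace (carrier M)" "zero M = 0" "add M = (+)" "smult M = fscale"
  using assms by (simp_all add: pointwise_def)

lemma pointwise_module:
  assumes "pointwise M"
  shows "Module.module cplx M"
proof -
  note [simp] = pointwiseD[OF assms]
  have "\<exists>y\<in>carrier M. y + x = 0" if "x \<in> carrier M" for x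
    using fv.subspace_neg[OF pointwiseD(1)[OF assms] that] by (auto intro: bexI[of _ "- x"])
  then have "abelian_group M"
    by (intro abelian_groupI) (simp_all add: fv.subspace_add fv.subspace_0 add_ac)
  then show ?thesis
    by (intro module.intro cring_cplx module_axioms.intro)
      (simp_all add: fv.subspace_scale fv.scale_left_distrib fv.scale_right_distrib)
qed

lemma pointwise_minus:
  assumes "pointwise M" "v \<in> carrier M" "w \<in> carrier M"
  shows "\<ominus>\<^bsub>M\<^esub> w = - w" "v \<ominus>\<^bsub>M\<^esub> w = v - w"
proof -
  interpret module cplx M by (rule pointwise_module[OF assms(1)])
  note [simp] = pointwiseD[OF assms(1)]
  have "- w \<in> carrier M" using fv.subspace_neg[OF pointwiseD(1)[OF assms(1)] assms(3)] .
  then have "\<ominus>\<^bsub>M\<^esub> w = - w"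
    using assms(3) M.minus_equality[of "- w" w] by simp
  then show "\<ominus>\<^bsub>M\<^esub> w = - w" "v \<ominus>\<^bsub>M\<^esub> w = v - w"
    by (simp_all add: a_minus_def)
qed

lemma pointwise_submodule_iff:
  assumes "pointwise M"
  shows "submodule W cplx M \<longleftrightarrow> W \<subseteq> carrier M \<and> fv.subspace W"
proof
  interpret module cplx M by (rule pointwise_module[OF assms(1)])
  note [simp] = pointwiseD[OF assms(1)]
  {
    assume W: "submodule W cplx M"
    have "0 \<in> W" using subgroup.one_closed[OF submodule.axioms(1)[OF W]] by simp
    then show "W \<subseteq> carrier M \<and> fv.subspace W"
      using submoduleE[OF W] by (simp add: fv.subspace_def)
  }
  {
    assume W: "W \<subseteq> carrier M \<and> fv.subspace W"
    then show "submodule W cplx M"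
      by (intro submoduleI)
        (auto simp: fv.subspace_0 fv.subspace_add fv.subspace_scale pointwise_minus[OF assms] 
            fv.subspace_neg subset_iff)
  }
qed

lemma pointwise_lin_span:
  assumes "pointwise M" "S \<subseteq> carrier M"
  shows "lin_span M S = fv.span S"
proof
  have "submodule (fv.span S) cplx M"
    using assms fv.span_minimal[OF assms(2)]
    by (simp add: pointwise_submodule_iff pointwiseD)
  then show "lin_span M S \<subseteq> fv.span S"
    by (auto simp: lin_span_def fv.span_base)
  show "fv.span S \<subseteq> lin_span M S"
    using assms by (auto simp: lin_span_def pointwise_submodule_iff dest: fv.span_minimal)
qed

lemma finsum_eq_sum:
  fixes M :: "('v :: comm_monoid_add, 'm) ring_scheme"
  assumes "abelian_monoid M" "add M = (+)" "zero M = 0" "f \<in> A \<rightarrow> carrier M"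
  shows "finsum M f A = sum f A"
proof -
  interpret abelian_monoid M by fact
  show ?thesis
    using assms(4)
  proof (induction A rule: infinite_finite_induct)
    case (infinite A)
    then show ?case using assms by (simp add: finsum_infinite)
  next
    case empty
    then show ?case using assms by simp
  next
    case (insert x F)
    then show ?case using assms by (simp add: finsum_insert)
  qed
qed

lemma pointwise_update_carrier:
  fixes M :: "('g, 'a \<Rightarrow> complex) rep"
  assumes "pointwise M" "fv.subspace W"
  shows "pointwise (M\<lparr>carrier := W\<rparr>)"
  using assms by (simp add: pointwise_def)

lemma pointwise_lie_submodule_iff:
  assumes "pointwise M"
  shows "lie_submodule L M W \<longleftrightarrow> W \<subseteq> carrier M \<and> fv.subspace W \<and>
    (\<forall>x\<in>carrier L. \<forall>w\<in>W. act M x w \<in> W)"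
  by (simp add: lie_submodule_def pointwise_submodule_iff[OF assms] conj_assoc)

lemma pointwise_lie_module_iff:
  assumes "pointwise M"
  shows "lie_module L M \<longleftrightarrow>
     (\<forall>x\<in>carrier L. \<forall>v\<in>carrier M. act M x v \<in> carrier M) \<and>
     (\<forall>x\<in>carrier L. \<forall>v\<in>carrier M. \<forall>w\<in>carrier M. act M x (v + w) = act M x v + act M x w) \<and>
     (\<forall>x\<in>carrier L. \<forall>c. \<forall>v\<in>carrier M. act M x (fscale c v) = fscale c (act M x v)) \<and>
     (\<forall>x\<in>carrier L. \<forall>y\<in>carrier L. \<forall>v\<in>carrier M.
        act M (x \<oplus>\<^bsub>L\<^esub> y) v = act M x v + act M y v) \<and>
     (\<forall>c. \<forall>x\<in>carrier L. \<forall>v\<in>carrier M. act M (c \<odot>\<^bsub>L\<^esub> x) v = fscale c (act M x v)) \<and>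
     (\<forall>x\<in>carrier L. \<forall>y\<in>carrier L. \<forall>v\<in>carrier M.
        act M (bracket L x y) v = act M x (act M y v) - act M y (act M x v))"
  by (auto simp: lie_module_def pointwise_module[OF assms] pointwiseD[OF assms] 
       pointwise_minus[OF assms])

lemma lie_module_submodule:
  fixes M :: "('g, 'a \<Rightarrow> complex) rep"
  assumes "pointwise M" "lie_module L M" "lie_submodule L M W"
  shows "pointwise (M\<lparr>carrier := W\<rparr>)" "lie_module L (M\<lparr>carrier := W\<rparr>)"
proof -
  have W: "W \<subseteq> carrier M" "fv.subspace W" "\<forall>x\<in>carrier L. \<forall>w\<in>W. act M x w \<in> W"
    using assms by (simp_all add: pointwise_lie_submodule_iff)
  then show p: "pointwise (M\<lparr>carrier := W\<rparr>)"
    by (simp add: pointwise_update_carrier assms)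
  show "lie_module L (M\<lparr>carrier := W\<rparr>)"
    using assms(2) W unfolding pointwise_lie_module_iff[OF p] pointwise_lie_module_iff[OF assms(1)]
    by (simp add: subset_iff)
qed

lemma dual_rep_pointwise:
  assumes "carrier M = UNIV"
  shows "pointwise (dual_rep M)"
  using assms
  by (auto simp: pointwise_def dual_rep_def fv.subspace_def fun_eq_iff extensional_def 
      restrict_def algebra_simps)

text \<open>
  Dualising reverses the order of two operators; the sign in the dual action compensates for this in
  the commutator.
\<close>

lemma lie_module_dual_rep:
  assumes "lie_module L M" "carrier M = UNIV"
  shows "lie_module L (dual_rep M)"
proof -
  interpret M: module cplx M using assms(1) by (simp add: lie_module_def)
  note p = dual_rep_pointwise[OF assms(2)]
  have minus: "\<phi> (v \<ominus>\<^bsub>M\<^esub> w) = \<phi> v - \<phi> w" if "\<phi> \<in> carrier (dual_rep M)" for \<phi> v w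
  proof -
    have "\<phi> (v \<ominus>\<^bsub>M\<^esub> w) + \<phi> w = \<phi> ((v \<ominus>\<^bsub>M\<^esub> w) \<oplus>\<^bsub>M\<^esub> w)"
      using that assms(2) by (simp add: dual_rep_def)
    also have "(v \<ominus>\<^bsub>M\<^esub> w) \<oplus>\<^bsub>M\<^esub> w = v"
      using assms(2) by (simp add: M.minus_eq M.add.m_assoc M.l_neg)
    finally show ?thesis by (simp add: algebra_simps)
  qed
  have "act (dual_rep M) x \<phi> \<in> carrier (dual_rep M)"
    if "x \<in> carrier L" "\<phi> \<in> carrier (dual_rep M)" for x \<phi>
    using that assms by (simp add: lie_module_def dual_rep_def)
  moreover have "act (dual_rep M) (bracket L x y) \<phi> =
      act (dual_rep M) x (act (dual_rep M) y \<phi>) - act (dual_rep M) y (act (dual_rep M) x \<phi>)"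
    if "x \<in> carrier L" "y \<in> carrier L" "\<phi> \<in> carrier (dual_rep M)" for x y \<phi>
  proof
    fix v
    have "act M (bracket L x y) v = act M x (act M y v) \<ominus>\<^bsub>M\<^esub> act M y (act M x v)"
      using that assms by (simp add: lie_module_def)
    then show "act (dual_rep M) (bracket L x y) \<phi> v = (act (dual_rep M) x (act (dual_rep M) y \<phi>)
        - act (dual_rep M) y (act (dual_rep M) x \<phi>)) v"
      using minus[OF that(3)] by (simp add: dual_rep_def assms(2))
  qed
  ultimately show ?thesis
    using assms unfolding pointwise_lie_module_iff[OF p]
    by (auto simp: lie_module_def dual_rep_def fun_eq_iff algebra_simps)
qed

section \<open>Quotients of representations\<close>

context
  fixes M :: "('g, 'v) rep" and W :: "'v set"
  assumes M: "Module.module cplx M" and W: "submodule W cplx M"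
begin

interpretation module cplx M by (rule M)

interpretation W: abelian_subgroup W M
  by (intro abelian_subgroupI3 additive_subgroupI submodule.axioms(1)[OF W] M.abelian_group_axioms)

lemma coset_eq_iff:
  assumes "v \<in> carrier M" "w \<in> carrier M"
  shows "W +>\<^bsub>M\<^esub> v = W +>\<^bsub>M\<^esub> w \<longleftrightarrow> v \<ominus>\<^bsub>M\<^esub> w \<in> W"
proof -
  have "v \<in> W +>\<^bsub>M\<^esub> w \<longleftrightarrow> v \<ominus>\<^bsub>M\<^esub> w \<in> W"
    using W.a_rcos_module[OF assms(2,1)] by (simp add: a_minus_def)
  moreover have "v \<in> W +>\<^bsub>M\<^esub> w \<longleftrightarrow> W +>\<^bsub>M\<^esub> v = W +>\<^bsub>M\<^esub> w"
    using W.a_repr_independence'[of v w] W.a_rcos_self[of v] assms by auto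
  ultimately show ?thesis by simp
qed

lemma coset_eq_self_iff:
  assumes "v \<in> carrier M"
  shows "W +>\<^bsub>M\<^esub> v = W \<longleftrightarrow> v \<in> W"
proof -
  have "W +>\<^bsub>M\<^esub> \<zero>\<^bsub>M\<^esub> = W" by (rule M.a_coset_add_zero) (rule W.a_subset)
  moreover have "\<ominus>\<^bsub>M\<^esub> \<zero>\<^bsub>M\<^esub> = \<zero>\<^bsub>M\<^esub>" by (rule M.minus_equality) auto
  ultimately show ?thesis using coset_eq_iff[OF assms, of "\<zero>\<^bsub>M\<^esub>"] assms
    by (metis a_minus_def M.r_zero M.zero_closed)
qed

text \<open>
  The operations of the quotient are unions over all representatives; with this description of
  a coset they reduce to a single representative whenever the result does not depend on it.
\<close>

lemma in_coset_iff:
  assumes "v \<in> carrier M"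
  shows "w \<in> W +>\<^bsub>M\<^esub> v \<longleftrightarrow> w \<in> carrier M \<and> W +>\<^bsub>M\<^esub> w = W +>\<^bsub>M\<^esub> v"
proof -
  have "W +>\<^bsub>M\<^esub> v \<subseteq> carrier M" by (rule a_r_coset_subset_G) (use W.a_subset assms in auto)
  then show ?thesis
  using W.a_repr_independence'[of w v] W.a_rcos_self[of w] assms by auto
qed

lemma quot_rep_carrier: "carrier (quot_rep M W) = (\<lambda>v. W +>\<^bsub>M\<^esub> v) ` carrier M"
  by (auto simp: quot_rep_def A_RCOSETS_def' )

lemma quot_rep_zero: "\<zero>\<^bsub>quot_rep M W\<^esub> = W +>\<^bsub>M\<^esub> \<zero>\<^bsub>M\<^esub>"
  using coset_eq_self_iff[of "\<zero>\<^bsub>M\<^esub>"] W.zero_closed by (simp add: quot_rep_def)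

lemma quot_rep_add:
  assumes "v \<in> carrier M" "w \<in> carrier M"
  shows "(W +>\<^bsub>M\<^esub> v) \<oplus>\<^bsub>quot_rep M W\<^esub> (W +>\<^bsub>M\<^esub> w) = W +>\<^bsub>M\<^esub> (v \<oplus>\<^bsub>M\<^esub> w)"
  using W.a_rcos_sum[OF assms] by (simp add: quot_rep_def)

lemma UN_coset_const:
  assumes "v \<in> carrier M"
    and "\<And>w. w \<in> carrier M \<Longrightarrow> W +>\<^bsub>M\<^esub> w = W +>\<^bsub>M\<^esub> v \<Longrightarrow> g w = g v"
  shows "(\<Union>w\<in>W +>\<^bsub>M\<^esub> v. g w) = g v"
  using assms in_coset_iff[OF assms(1)] by blast

lemma quot_rep_smult:
  assumes "v \<in> carrier M"
  shows "c \<odot>\<^bsub>quot_rep M W\<^esub> (W +>\<^bsub>M\<^esub> v) = W +>\<^bsub>M\<^esub> (c \<odot>\<^bsub>M\<^esub> v)"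
proof -
  have "W +>\<^bsub>M\<^esub> (c \<odot>\<^bsub>M\<^esub> w) = W +>\<^bsub>M\<^esub> (c \<odot>\<^bsub>M\<^esub> v)" 
    if "w \<in> carrier M" "W +>\<^bsub>M\<^esub> w = W +>\<^bsub>M\<^esub> v" for w
  proof -
    have "w \<ominus>\<^bsub>M\<^esub> v \<in> W" using that coset_eq_iff assms by simp
    then have "c \<odot>\<^bsub>M\<^esub> (w \<ominus>\<^bsub>M\<^esub> v) \<in> W" using submoduleE(4)[OF W] by simp
    then show ?thesis using that assms
      by (simp add: coset_eq_iff a_minus_def smult_r_distr smult_r_minus)
  qed
  then show ?thesis
    using UN_coset_const[OF assms, of "\<lambda>w. W +>\<^bsub>M\<^esub> (c \<odot>\<^bsub>M\<^esub> w)"] by (simp add: quot_rep_def)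
qed

lemma quot_rep_act:
  assumes "v \<in> carrier M"
    and "\<And>w. w \<in> carrier M \<Longrightarrow> W +>\<^bsub>M\<^esub> w = W +>\<^bsub>M\<^esub> v \<Longrightarrow>
      W +>\<^bsub>M\<^esub> act M x w = W +>\<^bsub>M\<^esub> act M x v"
  shows "act (quot_rep M W) x (W +>\<^bsub>M\<^esub> v) = W +>\<^bsub>M\<^esub> act M x v"
  using UN_coset_const[OF assms(1), of "\<lambda>w. W +>\<^bsub>M\<^esub> act M x w"] assms(2)
  by (simp add: quot_rep_def)

text \<open>
  On the free vector space underlying an induced module the Lie algebra acts only modulo relations.
  Therefore \<open>M\<close> just carries operators that \<open>F\<close> intertwines with those of \<open>N\<close>; this makes the action on
  cosets well defined, since \<open>W\<close> is the kernel of \<open>F\<close>.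
\<close>

lemma first_isomorphism:
  assumes N: "Module.module cplx N"
    and F: "F ` carrier M = carrier N"
      "\<And>v w. v \<in> carrier M \<Longrightarrow> w \<in> carrier M \<Longrightarrow> F (v \<oplus>\<^bsub>M\<^esub> w) = F v \<oplus>\<^bsub>N\<^esub> F w"
      "\<And>c v. v \<in> carrier M \<Longrightarrow> F (c \<odot>\<^bsub>M\<^esub> v) = c \<odot>\<^bsub>N\<^esub> F v"
      "\<And>x v. x \<in> carrier L \<Longrightarrow> v \<in> carrier M \<Longrightarrow> F (act M x v) = act N x (F v)"
    and act: "\<And>x v. x \<in> carrier L \<Longrightarrow> v \<in> carrier M \<Longrightarrow> act M x v \<in> carrier M"
    and ker: "\<And>v. v \<in> carrier M \<Longrightarrow> F v = \<zero>\<^bsub>N\<^esub> \<longleftrightarrow> v \<in> W"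
  shows "\<exists>f. rep_iso L (quot_rep M W) N f \<and> (\<forall>v\<in>carrier M. f (W +>\<^bsub>M\<^esub> v) = F v)"
proof -
  interpret N: module cplx N by (rule N)
  have Fc: "F v \<in> carrier N" if "v \<in> carrier M" for v using F(1) that by auto
  have eq: "W +>\<^bsub>M\<^esub> v = W +>\<^bsub>M\<^esub> w \<longleftrightarrow> F v = F w" if vw: "v \<in> carrier M" "w \<in> carrier M" for v w
  proof -
    have "F v = F (v \<ominus>\<^bsub>M\<^esub> w) \<oplus>\<^bsub>N\<^esub> F w"
      using vw by (simp add: F(2)[symmetric] a_minus_def M.add.m_assoc M.l_neg)
    then have "F v = F w \<longleftrightarrow> F (v \<ominus>\<^bsub>M\<^esub> w) = \<zero>\<^bsub>N\<^esub>"
      using vw Fc by (metis M.minus_closed N.M.add.r_cancel_one N.M.l_zero)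
    then show ?thesis using vw ker by (simp add: coset_eq_iff)
  qed
  define f where "f C = F (SOME v. v \<in> carrier M \<and> C = W +>\<^bsub>M\<^esub> v)" for C
  have f: "f (W +>\<^bsub>M\<^esub> v) = F v" if "v \<in> carrier M" for v
  proof -
    have "\<exists>w. w \<in> carrier M \<and> W +>\<^bsub>M\<^esub> v = W +>\<^bsub>M\<^esub> w" using that by blast
    from someI_ex[OF this] eq that show ?thesis unfolding f_def by metis
  qed
  have act': "act (quot_rep M W) x (W +>\<^bsub>M\<^esub> v) = W +>\<^bsub>M\<^esub> act M x v"
    if "x \<in> carrier L" "v \<in> carrier M" for x v
    by (rule quot_rep_act) (use that eq F(4) act in auto)
  have "inj_on f (carrier (quot_rep M W))"
    by (auto simp: inj_on_def quot_rep_carrier f eq)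
  moreover have "f ` carrier (quot_rep M W) = carrier N"
    unfolding quot_rep_carrier F(1)[symmetric] image_image using f by (intro image_cong) auto
  ultimately have "rep_iso L (quot_rep M W) N f"
    by (auto simp: rep_iso_def bij_betw_def quot_rep_carrier quot_rep_add quot_rep_smult f F act' act)
  with f show ?thesis by blast
qed

end

text \<open>
  All module axioms are equations, so they pass to the image under a map \<open>p\<close> that respects the
  operations. This is applied to the projection onto a quotient.
\<close>

lemma lie_module_image:
  assumes M: "lie_module L M"
    and L: "\<And>x y. x \<in> carrier L \<Longrightarrow> y \<in> carrier L \<Longrightarrow> x \<oplus>\<^bsub>L\<^esub> y \<in> carrier L"
      "\<And>c x. x \<in> carrier L \<Longrightarrow> c \<odot>\<^bsub>L\<^esub> x \<in> carrier L"
      "\<And>x y. x \<in> carrier L \<Longrightarrow> y \<in> carrier L \<Longrightarrow> bracket L x y \<in> carrier L"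
    and p: "carrier Q = p ` carrier M" "\<zero>\<^bsub>Q\<^esub> = p \<zero>\<^bsub>M\<^esub>"
      "\<And>v w. v \<in> carrier M \<Longrightarrow> w \<in> carrier M \<Longrightarrow> p v \<oplus>\<^bsub>Q\<^esub> p w = p (v \<oplus>\<^bsub>M\<^esub> w)"
      "\<And>c v. v \<in> carrier M \<Longrightarrow> c \<odot>\<^bsub>Q\<^esub> p v = p (c \<odot>\<^bsub>M\<^esub> v)"
      "\<And>x v. x \<in> carrier L \<Longrightarrow> v \<in> carrier M \<Longrightarrow> act Q x (p v) = p (act M x v)"
  shows "lie_module L Q"
    and "\<And>v w. v \<in> carrier M \<Longrightarrow> w \<in> carrier M \<Longrightarrow> p v \<ominus>\<^bsub>Q\<^esub> p w = p (v \<ominus>\<^bsub>M\<^esub> w)"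
proof -
  interpret M: module cplx M using M by (simp add: lie_module_def)
  have "\<exists>y\<in>carrier M. p y \<oplus>\<^bsub>Q\<^esub> p x = \<zero>\<^bsub>Q\<^esub>" if "x \<in> carrier M" for x
    using that by (intro bexI[of _ "\<ominus>\<^bsub>M\<^esub> x"]) (simp_all add: p M.l_neg)
  then have Q: "abelian_group Q"
    by (intro abelian_groupI) (auto simp: p M.a_ac)
  interpret Q: module cplx Q
    by (intro module.intro Q cring_cplx module_axioms.intro)
     (use M.smult_l_distr M.smult_assoc1 M.smult_one in \<open>auto simp: p M.smult_r_distr\<close>)
  show mi: "p v \<ominus>\<^bsub>Q\<^esub> p w = p (v \<ominus>\<^bsub>M\<^esub> w)" if vw: "v \<in> carrier M" "w \<in> carrier M" for v w
  proof -
    have "p (\<ominus>\<^bsub>M\<^esub> w) \<oplus>\<^bsub>Q\<^esub> p w = \<zero>\<^bsub>Q\<^esub>" using vw by (simp add: p M.l_neg)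
    then have "\<ominus>\<^bsub>Q\<^esub> p w = p (\<ominus>\<^bsub>M\<^esub> w)"
      using vw by (intro Q.M.minus_equality) (auto simp: p)
    then show ?thesis using vw by (simp add: a_minus_def p)
  qed
  have ax: "act M x v \<in> carrier M" if "x \<in> carrier L" "v \<in> carrier M" for x v
    using M that by (simp add: lie_module_def)
  show "lie_module L Q"
    unfolding lie_module_def
    by (intro conjI Q.module_axioms ballI allI;
        use M L in \<open>auto simp: p ax mi lie_module_def\<close>)
qed

section \<open>Finitely supported functions\<close>

lemma sum_fun_apply: "(\<Sum>a\<in>A. g a) x = (\<Sum>a\<in>A. g a x)"
  by (induction A rule: infinite_finite_induct) auto

text \<open>
  The free vector space on \<open>X\<close>, with the functions \<open>delta a\<close> as its basis; \<open>lin_ext g\<close> below is the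
  linear map on it that extends \<open>g\<close>.
\<close>

definition fin_supp :: "'a set \<Rightarrow> ('a \<Rightarrow> complex) set" where
  "fin_supp X = {p. finite {a. p a \<noteq> 0} \<and> {a. p a \<noteq> 0} \<subseteq> X}"

definition lin_ext :: "('a \<Rightarrow> 'b \<Rightarrow> complex) \<Rightarrow> ('a \<Rightarrow> complex) \<Rightarrow> 'b \<Rightarrow> complex" where
  "lin_ext g p = (\<Sum>a | p a \<noteq> 0. fscale (p a) (g a))"

lemma lin_ext_superset:
  assumes "finite A" "{a. p a \<noteq> 0} \<subseteq> A"
  shows "lin_ext g p = (\<Sum>a\<in>A. fscale (p a) (g a))"
  unfolding lin_ext_def using assms by (intro sum.mono_neutral_left) (auto simp: fun_eq_iff)

lemma lin_ext_add:
  assumes "p \<in> fin_supp X" "q \<in> fin_supp X"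
  shows "lin_ext g (p + q) = lin_ext g p + lin_ext g q"
proof -
  let ?A = "{a. p a \<noteq> 0} \<union> {a. q a \<noteq> 0}"
  have "finite ?A" using assms by (simp add: fin_supp_def)
  moreover have "{a. (p + q) a \<noteq> 0} \<subseteq> ?A" by auto
  ultimately show ?thesis
    by (simp add: lin_ext_superset[of ?A] fv.scale_left_distrib sum.distrib)
qed

lemma lin_ext_scale: "lin_ext g (fscale c p) = fscale c (lin_ext g p)"
  by (cases "c = 0") (simp_all add: lin_ext_def fv.scale_sum_right)

lemma lin_ext_zero [simp]: "lin_ext g 0 = 0"
  by (simp add: lin_ext_def)

lemma lin_ext_diff:
  assumes "p \<in> fin_supp X" "q \<in> fin_supp X"
  shows "lin_ext g (p - q) = lin_ext g p - lin_ext g q"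
proof -
  have "fscale (-1) q \<in> fin_supp X" using assms by (simp add: fin_supp_def)
  then have "lin_ext g (p + fscale (-1) q) = lin_ext g p + fscale (-1) (lin_ext g q)"
    using lin_ext_add[OF assms(1)] lin_ext_scale by metis
  then show ?thesis by simp
qed

lemma lin_ext_delta [simp]: "lin_ext g (delta a) = g a"
  by (simp add: lin_ext_superset[of "{a}"] delta_def)

lemma lin_ext_in_subspace:
  assumes "fv.subspace W" "p \<in> fin_supp X" "\<And>a. a \<in> X \<Longrightarrow> g a \<in> W"
  shows "lin_ext g p \<in> W"
  unfolding lin_ext_def using assms
  by (intro fv.subspace_sum fv.subspace_scale) (auto simp: fin_supp_def)

lemma fin_supp_subspace: "fv.subspace (fin_supp X)"
proof -
  have *: "{a. x a + y a \<noteq> 0} \<subseteq> {a. x a \<noteq> 0} \<union> {a. y a \<noteq> 0}" for x y :: "'a \<Rightarrow> complex" by auto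
  have "x + y \<in> fin_supp X" if "x \<in> fin_supp X" "y \<in> fin_supp X" for x y
  proof -
    have "finite ({a. x a \<noteq> 0} \<union> {a. y a \<noteq> 0})" "{a. x a \<noteq> 0} \<union> {a. y a \<noteq> 0} \<subseteq> X"
      using that by (simp_all add: fin_supp_def)
    then show ?thesis
      using * unfolding fin_supp_def plus_fun_apply mem_Collect_eq
      by (metis (no_types, lifting) finite_subset order_trans)
  qed
  moreover have "fscale c x \<in> fin_supp X" if "x \<in> fin_supp X" for c x
    using that by (cases "c = 0") (auto simp: fin_supp_def)
  ultimately show ?thesis by (auto simp: fv.subspace_def fin_supp_def)
qed

lemma delta_in_fin_supp [simp]: "delta a \<in> fin_supp X \<longleftrightarrow> a \<in> X"
  by (auto simp: fin_supp_def delta_def)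

lemma lin_ext_delta_id:
  assumes "p \<in> fin_supp X"
  shows "lin_ext delta p = p"
proof
  fix x
  have "finite {a. p a \<noteq> 0}" using assms by (simp add: fin_supp_def)
  then show "lin_ext delta p x = p x"
    by (simp add: lin_ext_def sum_fun_apply delta_def if_distrib[of "\<lambda>z. _ * z"] cong: if_cong)
qed

text \<open>
  A statement that is closed under linear combinations need only be checked on basis elements;
  bilinear and trilinear identities follow by repeating this.
\<close>

lemma fin_supp_induct [consumes 1, case_names delta zero add scale]:
  assumes "p \<in> fin_supp X"
    and "\<And>a. a \<in> X \<Longrightarrow> P (delta a)"
    and "P 0"
    and "\<And>p q. p \<in> fin_supp X \<Longrightarrow> q \<in> fin_supp X \<Longrightarrow> P p \<Longrightarrow> P q \<Longrightarrow> P (p + q)"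
    and "\<And>c p. p \<in> fin_supp X \<Longrightarrow> P p \<Longrightarrow> P (fscale c p)"
  shows "P p"
proof -
  have "fv.subspace {p \<in> fin_supp X. P p}"
    using assms fin_supp_subspace[of X] by (simp add: fv.subspace_def)
  from lin_ext_in_subspace[OF this assms(1), of delta] show ?thesis
    using assms(2) by (simp add: lin_ext_delta_id[OF assms(1)])
qed

section \<open>The free associative algebra and its action\<close>

definition conv :: "('x list \<Rightarrow> complex) \<Rightarrow> ('x list \<Rightarrow> complex) \<Rightarrow> 'x list \<Rightarrow> complex" where
  "conv p q = (\<lambda>w. \<Sum>i\<le>length w. p (take i w) * q (drop i w))"

lemma word_eq: "word c w = fscale c (delta w)"
  by (auto simp: word_def delta_def fun_eq_iff)

lemma free_algebra_simps:
  "carrier (free_algebra X) = fin_supp (lists X)"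
  "mult (free_algebra X) = conv"
  "one (free_algebra X) = delta []"
  "zero (free_algebra X) = 0"
  "add (free_algebra X) = (+)"
  by (auto simp: free_algebra_def fin_supp_def conv_def word_eq fun_eq_iff lists_eq_set)

lemma conv_add_left: "conv (p + q) r = conv p r + conv q r"
  and conv_add_right: "conv r (p + q) = conv r p + conv r q"
  by (simp_all add: conv_def fun_eq_iff ring_distribs sum.distrib)

lemma conv_scale_left: "conv (fscale c p) r = fscale c (conv p r)"
  and conv_scale_right: "conv r (fscale c p) = fscale c (conv r p)"
  by (simp_all add: conv_def fun_eq_iff sum_distrib_left mult_ac)

lemma conv_zero [simp]: "conv 0 r = 0" "conv r 0 = 0"
  by (simp_all add: conv_def fun_eq_iff)

lemma conv_diff_left: "conv (p - q) r = conv p r - conv q r"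
  and conv_diff_right: "conv r (p - q) = conv r p - conv r q"
  by (simp_all add: conv_def fun_eq_iff ring_distribs sum_subtractf)

text \<open>
  The product of the free algebra concatenates words: a word \<open>w\<close> has exactly one splitting into \<open>u\<close>
  and \<open>v\<close> if \<open>w = u @ v\<close>, and none otherwise.
\<close>

lemma conv_delta: "conv (delta u) (delta v) = delta (u @ v)"
proof
  fix w
  have "delta u (take i w) * delta v (drop i w) = (if i = length u then delta (u @ v) w else 0)"
    if "i \<le> length w" for i
  proof -
    have "delta u (take i w) * delta v (drop i w) = (if take i w = u \<and> drop i w = v then 1 else 0)"
      by (simp add: delta_def)
    also have "take i w = u \<and> drop i w = v \<longleftrightarrow> i = length u \<and> w = u @ v"
      using that by (metis append_eq_conv_conj append_take_drop_id length_take min.absorb2)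
    finally show ?thesis by (simp add: delta_def)
  qed
  then have "conv (delta u) (delta v) w = 
      (\<Sum>i\<le>length w. if i = length u then delta (u @ v) w else 0)"
    unfolding conv_def by (intro sum.cong) auto
  also have "\<dots> = delta (u @ v) w"
    by (simp add: delta_def)
  finally show "conv (delta u) (delta v) w = delta (u @ v) w" .
qed

lemma conv_closed:
  assumes "p \<in> fin_supp (lists X)" "q \<in> fin_supp (lists X)"
  shows "conv p q \<in> fin_supp (lists X)"
  using assms
proof (induction p rule: fin_supp_induct)
  case (delta u)
  from delta(2,1) show ?case
    by (induction q rule: fin_supp_induct)
      (auto simp: conv_delta conv_add_right conv_scale_right 
        fv.subspace_0 fv.subspace_add fv.subspace_scale fin_supp_subspace)
qed (auto simp: conv_add_left conv_scale_left 
        fv.subspace_0 fv.subspace_add fv.subspace_scale fin_supp_subspace)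

lemma conv_assoc:
  assumes "p \<in> fin_supp (lists X)" "q \<in> fin_supp (lists X)" "r \<in> fin_supp (lists X)"
  shows "conv (conv p q) r = conv p (conv q r)"
  using assms
proof (induction p rule: fin_supp_induct)
  case (delta u)
  from delta(2,1,3) show ?case
  proof (induction q rule: fin_supp_induct)
    case (delta v)
    from delta(3,2,1) show ?case
      by (induction r rule: fin_supp_induct)
        (simp_all add: conv_delta conv_add_right conv_scale_right)
  qed (simp_all add: conv_add_left conv_scale_left conv_add_right conv_scale_right)
qed (simp_all add: conv_add_left conv_scale_left)

lemma conv_one:
  assumes "p \<in> fin_supp (lists X)"
  shows "conv (delta []) p = p" "conv p (delta []) = p"
  using assms
  by (induction p rule: fin_supp_induct)
    (simp_all add: conv_delta conv_add_right conv_scale_right conv_add_left conv_scale_left)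

lemma ring_free_algebra: "ring (free_algebra X)"
proof (intro ringI abelian_groupI monoidI)
  fix x assume "x \<in> carrier (free_algebra X)"
  then show "\<exists>y\<in>carrier (free_algebra X). y \<oplus>\<^bsub>free_algebra X\<^esub> x = \<zero>\<^bsub>free_algebra X\<^esub>"
    using fv.subspace_neg[OF fin_supp_subspace] 
    by (auto simp: free_algebra_simps intro!: bexI[of _ "- x"])
qed (auto simp: free_algebra_simps conv_closed conv_assoc conv_one conv_add_left conv_add_right
      fin_supp_subspace fv.subspace_0 fv.subspace_add add_ac)

lemma free_algebra_minus:
  assumes "p \<in> fin_supp (lists X)" "q \<in> fin_supp (lists X)"
  shows "p \<ominus>\<^bsub>free_algebra X\<^esub> q = p - q"
proof -
  interpret ring "free_algebra X" by (rule ring_free_algebra)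
  have "\<ominus>\<^bsub>free_algebra X\<^esub> q = - q"
    using assms(2) fv.subspace_neg[OF fin_supp_subspace assms(2)]
    by (intro minus_equality) (simp_all add: free_algebra_simps)
  then show ?thesis by (simp add: a_minus_def free_algebra_simps)
qed

lemma foldr_act_closed:
  assumes "lie_module L M" "set w \<subseteq> carrier L" "v \<in> carrier M"
  shows "foldr (act M) w v \<in> carrier M"
  using assms by (induction w) (auto simp: lie_module_def)

lemma free_act_eq:
  assumes "pointwise M" "lie_module L M" "p \<in> fin_supp (lists (carrier L))" "v \<in> carrier M"
  shows "free_act M p v = lin_ext (\<lambda>w. foldr (act M) w v) p"
proof -
  interpret module cplx M by (rule pointwise_module[OF assms(1)])
  have "fscale (p w) (foldr (act M) w v) \<in> carrier M" if "p w \<noteq> 0" for w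
    using foldr_act_closed[OF assms(2) _ assms(4)] that assms(3) 
    by (intro fv.subspace_scale[OF pointwiseD(1)[OF assms(1)]]) 
       (auto simp: fin_supp_def lists_eq_set)
  then show ?thesis
    by (simp add: free_act_def lin_ext_def pointwiseD[OF assms(1)] finsum_eq_sum Pi_iff
        M.abelian_monoid_axioms)
qed

lemma free_act_closed:
  assumes "pointwise M" "lie_module L M" "p \<in> fin_supp (lists (carrier L))" "v \<in> carrier M"
  shows "free_act M p v \<in> carrier M"
  unfolding free_act_eq[OF assms] using assms foldr_act_closed[OF assms(2) _ assms(4)]
  by (intro lin_ext_in_subspace[OF _ assms(3)]) (auto simp: pointwiseD lists_eq_set)

lemma foldr_act_linear:
  assumes "pointwise M" "lie_module L M" "set w \<subseteq> carrier L"
  shows "v \<in> carrier M \<Longrightarrow> v' \<in> carrier M \<Longrightarrow> 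
      foldr (act M) w (v + v') = foldr (act M) w v + foldr (act M) w v'"
    and "v \<in> carrier M \<Longrightarrow> foldr (act M) w (fscale c v) = fscale c (foldr (act M) w v)"
    and "foldr (act M) w 0 = 0"
proof -
  show "foldr (act M) w (v + v') = foldr (act M) w v + foldr (act M) w v'"
    if "v \<in> carrier M" "v' \<in> carrier M"
    using assms(3) that foldr_act_closed[OF assms(2)] assms(2)[unfolded pointwise_lie_module_iff[OF assms(1)]]
    by (induction w) auto
  show *: "foldr (act M) w (fscale c v) = fscale c (foldr (act M) w v)"
    if "v \<in> carrier M" for v c
    using assms(3) that foldr_act_closed[OF assms(2)] assms(2)[unfolded pointwise_lie_module_iff[OF assms(1)]]
    by (induction w) auto
  show "foldr (act M) w 0 = 0"
    using *[of 0 0] pointwiseD(1)[OF assms(1)] by (simp add: fv.subspace_0)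
qed

text \<open>
  Both sides are bilinear in \<open>p\<close> and \<open>q\<close>, and on words the claim is that of \<open>foldr\<close> on an append.
\<close>

lemma free_act_mult:
  assumes "pointwise M" "lie_module L M" "v \<in> carrier M"
    and pq: "p \<in> fin_supp (lists (carrier L))" "q \<in> fin_supp (lists (carrier L))"
  shows "free_act M (conv p q) v = free_act M p (free_act M q v)"
proof -
  let ?E = "\<lambda>v. lin_ext (\<lambda>w. foldr (act M) w v)"
  have E: "?E v q \<in> carrier M" if "q \<in> fin_supp (lists (carrier L))" for q
    using free_act_closed[OF assms(1,2) that assms(3)] free_act_eq[OF assms(1,2) that assms(3)] by simp
  have "?E v (conv p q) = ?E (?E v q) p"
    using pq
  proof (induction p rule: fin_supp_induct)
    case (delta u)
    then have u: "set u \<subseteq> carrier L" by auto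
    note lin = foldr_act_linear[OF assms(1,2) u]
    from delta(2,1) show ?case
      by (induction q rule: fin_supp_induct)
        (simp_all add: conv_delta conv_add_right conv_scale_right lin lin_ext_scale E conv_closed
           lin_ext_add[of _ "lists (carrier L)"] fun_eq_iff)
  qed (simp_all add: lin_ext_add[of _ "lists (carrier L)"] lin_ext_scale
         conv_add_left conv_scale_left conv_closed)
  then show ?thesis
    using assms pq by (simp add: free_act_eq[where L = L] conv_closed E)
qed

section \<open>The universal enveloping algebra\<close>

text \<open>
  The enveloping algebra is defined by generators and relations; closedness puts the relations into the
  free algebra on the carrier.
\<close>

locale lie_closed =
  fixes L :: "'g lie_algebra"
  assumes add_closed: "\<And>x y. x \<in> carrier L \<Longrightarrow> y \<in> carrier L \<Longrightarrow> x \<oplus>\<^bsub>L\<^esub> y \<in> carrier L"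
    and smult_closed: "\<And>c x. x \<in> carrier L \<Longrightarrow> c \<odot>\<^bsub>L\<^esub> x \<in> carrier L"
    and bracket_closed: "\<And>x y. x \<in> carrier L \<Longrightarrow> y \<in> carrier L \<Longrightarrow> bracket L x y \<in> carrier L"
begin

abbreviation FA where "FA \<equiv> fin_supp (lists (carrier L))"
abbreviation gen where "gen x \<equiv> delta [x :: 'g]"

lemma FA_subspace: "fv.subspace FA" by (rule fin_supp_subspace)

lemma FA_closed [simp]:
  "0 \<in> FA" "delta [] \<in> FA"
  "p \<in> FA \<Longrightarrow> q \<in> FA \<Longrightarrow> p + q \<in> FA"
  "p \<in> FA \<Longrightarrow> q \<in> FA \<Longrightarrow> p - q \<in> FA"
  "p \<in> FA \<Longrightarrow> fscale c p \<in> FA"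
  "p \<in> FA \<Longrightarrow> q \<in> FA \<Longrightarrow> conv p q \<in> FA"
  by (simp_all add: FA_subspace fv.subspace_0 fv.subspace_add fv.subspace_diff fv.subspace_scale
      conv_closed)

lemma env_relations_eq:
  "env_relations L =
     {gen (x \<oplus>\<^bsub>L\<^esub> y) - gen x - gen y | x y. x \<in> carrier L \<and> y \<in> carrier L} \<union>
     {gen (c \<odot>\<^bsub>L\<^esub> x) - fscale c (gen x) | c x. x \<in> carrier L} \<union>
     {conv (gen x) (gen y) - conv (gen y) (gen x) - gen (bracket L x y) | x y.
        x \<in> carrier L \<and> y \<in> carrier L}"
  by (simp add: env_relations_def word_eq fun_diff_def conv_delta)

lemma env_relations_subset: "env_relations L \<subseteq> FA"
  by (auto simp: env_relations_eq add_closed smult_closed bracket_closed)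

interpretation A: ring "free_algebra (carrier L)" by (rule ring_free_algebra)

lemma env_ideal_ideal: "ideal (env_ideal L) (free_algebra (carrier L))"
  unfolding env_ideal_def using env_relations_subset
  by (intro A.genideal_ideal) (simp add: free_algebra_simps)

interpretation I: ideal "env_ideal L" "free_algebra (carrier L)" by (rule env_ideal_ideal)

lemma env_ideal_FA: "p \<in> env_ideal L \<Longrightarrow> p \<in> FA"
  using I.Icarr by (simp add: free_algebra_simps)

lemma env_ideal_conv:
  assumes "p \<in> env_ideal L" "q \<in> FA"
  shows "conv p q \<in> env_ideal L" "conv q p \<in> env_ideal L"
  using I.I_r_closed[OF assms(1), of q] I.I_l_closed[OF assms(1), of q] assms(2)
  by (simp_all add: free_algebra_simps)

lemma env_relations_in_ideal: "p \<in> env_relations L \<Longrightarrow> p \<in> env_ideal L"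
  unfolding env_ideal_def using A.genideal_self[of "env_relations L"] env_relations_subset
  by (auto simp: free_algebra_simps)

lemma env_ideal_gens:
  assumes "x \<in> carrier L" "y \<in> carrier L"
  shows "gen (x \<oplus>\<^bsub>L\<^esub> y) - gen x - gen y \<in> env_ideal L"
    "gen (c \<odot>\<^bsub>L\<^esub> x) - fscale c (gen x) \<in> env_ideal L"
    "conv (gen x) (gen y) - conv (gen y) (gen x) - gen (bracket L x y) \<in> env_ideal L"
  using assms by (rule_tac env_relations_in_ideal; unfold env_relations_eq; blast)+

lemma env_algebra_carrier: "carrier (env_algebra L) = env_class L ` FA"
  by (auto simp: env_algebra_def FactRing_def A_RCOSETS_def' env_class_def free_algebra_simps)

lemma env_class_closed [simp]: "p \<in> FA \<Longrightarrow> env_class L p \<in> carrier (env_algebra L)"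
  by (simp add: env_algebra_carrier)

lemma env_class_hom:
  assumes "p \<in> FA" "q \<in> FA"
  shows "env_class L p \<otimes>\<^bsub>env_algebra L\<^esub> env_class L q = env_class L (conv p q)"
    "env_class L p \<oplus>\<^bsub>env_algebra L\<^esub> env_class L q = env_class L (p + q)"
  using I.rcoset_mult_add[of p q] I.a_rcos_sum[of p q] assms
  by (simp_all add: env_algebra_def FactRing_def env_class_def free_algebra_simps)

lemma env_algebra_one: "\<one>\<^bsub>env_algebra L\<^esub> = env_class L (delta [])"
  by (simp add: env_algebra_def FactRing_def env_class_def free_algebra_simps)

lemma env_class_eq_iff:
  assumes "p \<in> FA" "q \<in> FA"
  shows "env_class L p = env_class L q \<longleftrightarrow> p - q \<in> env_ideal L"
  using A.quotient_eq_iff_same_a_r_cos[OF env_ideal_ideal, of p q] assms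
  by (simp add: env_class_def free_algebra_simps free_algebra_minus)

text \<open>
  The annihilator of a Lie module in the free algebra is a two-sided ideal which contains the defining
  relations, hence the whole ideal. So representatives of a class in \<open>U(L)\<close> act alike.
\<close>

lemma env_ideal_annihilates:
  assumes M: "pointwise M" "lie_module L M" and "p \<in> env_ideal L" "v \<in> carrier M"
  shows "free_act M p v = 0"
proof -
  let ?Ann = "{p \<in> FA. \<forall>v\<in>carrier M. free_act M p v = 0}"
  note fa = free_act_eq[OF M]
  note lie = M(2)[unfolded pointwise_lie_module_iff[OF M(1)]]
  have c0: "0 \<in> carrier M" using pointwiseD(1)[OF M(1)] fv.subspace_0 by auto
  have f0: "free_act M q 0 = 0" if "q \<in> FA" for q
  proof -
    have "lin_ext (\<lambda>w. foldr (act M) w 0) q = 0"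
      unfolding lin_ext_def using that foldr_act_linear(3)[OF M]
      by (intro sum.neutral) (auto simp: fin_supp_def lists_eq_set)
    then show ?thesis using fa[OF that c0] by simp
  qed
  have "ideal ?Ann (free_algebra (carrier L))"
  proof (intro idealI ring_free_algebra)
    show "subgroup ?Ann (add_monoid (free_algebra (carrier L)))"
    proof (rule A.add.subgroupI)
      fix p assume p: "p \<in> ?Ann"
      have "0 \<ominus>\<^bsub>free_algebra (carrier L)\<^esub> p = 0 - p"
        using p by (intro free_algebra_minus) auto
      then have "\<ominus>\<^bsub>free_algebra (carrier L)\<^esub> p = fscale (-1) p"
        by (simp add: a_minus_def free_algebra_simps)
      moreover have "fscale (-1) p \<in> ?Ann"
      proof -
        have "free_act M (fscale (-1) p) v = fscale (-1) (free_act M p v)" if "v \<in> carrier M" for v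
          using p that by (simp only: mem_Collect_eq fa FA_closed lin_ext_scale)
        then show "fscale (-1) p \<in> ?Ann" using p FA_closed(5)[of p "-1"] by simp
      qed
      ultimately show "\<ominus>\<^bsub>free_algebra (carrier L)\<^esub> p \<in> ?Ann"
        by (simp only:)
    next
      have "0 \<in> ?Ann" by (simp add: fa lin_ext_def)
      then show "?Ann \<noteq> {}" by blast
    qed (auto simp: free_algebra_simps fa lin_ext_add[where X = "lists (carrier L)"])
  qed (auto simp: free_algebra_simps free_act_mult[OF M] f0 free_act_closed[OF M])
  moreover have "env_relations L \<subseteq> ?Ann"
  proof
    fix p assume p: "p \<in> env_relations L"
    then have "free_act M p v = 0" if "v \<in> carrier M" for v
      unfolding env_relations_eq using lie that
      by (auto simp: fa lin_ext_diff[where X = "lists (carrier L)"] lin_ext_scale conv_delta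
          add_closed smult_closed bracket_closed)
    with p env_relations_subset show "p \<in> ?Ann" by auto
  qed
  ultimately have "env_ideal L \<subseteq> ?Ann"
    unfolding env_ideal_def by (rule A.genideal_minimal)
  then show ?thesis using assms by auto
qed

end

section \<open>Modules induced from a character\<close>

text \<open>
  Induction of a one-dimensional module: \<open>Z\<close> is the line on which \<open>x\<close> acts by the scalar \<open>ch x\<close>. For Verma
  modules \<open>ch\<close> is, on the Borel subalgebra, a weight extended by zero to \<open>e\<close> and \<open>e\<close>-bar.
\<close>

locale induced_line = lie_closed L for L :: "'g lie_algebra" +
  fixes B :: "'g lie_algebra" and Z :: "('g, complex) rep" and ch :: "'g \<Rightarrow> complex"
  assumes B_sub: "carrier B \<subseteq> carrier L"
    and Z: "carrier Z = UNIV" "add Z = (+)" "zero Z = 0" "smult Z = (*)"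
      "\<And>x z. act Z x z = ch x * z"
begin

abbreviation P where "P \<equiv> pre_tensor L Z"
abbreviation K where "K \<equiv> tensor_kernel L B Z"
abbreviation U where "U \<equiv> carrier (env_algebra L)"
abbreviation D where "D p \<equiv> delta (env_class L p, 1 :: complex)"

lemma P_carrier: "carrier P = fin_supp (U \<times> UNIV)"
  by (auto simp: pre_tensor_def fin_supp_def Z)

lemma P_pointwise: "pointwise P"
  unfolding pointwise_def P_carrier using fin_supp_subspace
  by (auto simp: pre_tensor_def fun_eq_iff)

text \<open>
  The action on the free vector space pushes a coefficient function forward along left multiplication.
  Written as a linear extension it is visibly linear in \<open>\<phi>\<close>.
\<close>

lemma P_act:
  assumes "\<phi> \<in> carrier P"
  shows "act P x \<phi> = 
    lin_ext (\<lambda>(u, m). delta (env_class L (gen x) \<otimes>\<^bsub>env_algebra L\<^esub> u, m)) \<phi>"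
proof
  fix a :: "('g list \<Rightarrow> complex) set \<times> complex"
  obtain u' m where a: "a = (u', m)" by fastforce
  let ?x = "\<lambda>u. env_class L (gen x) \<otimes>\<^bsub>env_algebra L\<^esub> u"
  let ?S = "{u. \<phi> (u, m) \<noteq> 0 \<and> ?x u = u'}"
  have fin: "finite {b. \<phi> b \<noteq> 0}" using assms by (simp add: P_carrier fin_supp_def)
  have "lin_ext (\<lambda>(u, m). delta (?x u, m)) \<phi> a =
      (\<Sum>b | \<phi> b \<noteq> 0. \<phi> b * delta (?x (fst b), snd b) a)"
    by (simp add: lin_ext_def sum_fun_apply case_prod_beta)
  also have "\<dots> = (\<Sum>b\<in>(\<lambda>u. (u, m)) ` ?S. \<phi> b * delta (?x (fst b), snd b) a)"
    by (rule sum.mono_neutral_right[OF fin]) (auto simp: a delta_def image_iff)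
  also have "\<dots> = (\<Sum>u\<in>?S. \<phi> (u, m))"
    by (subst sum.reindex) (auto simp: inj_on_def a delta_def)
  finally show "act P x \<phi> a = lin_ext (\<lambda>(u, m). delta (?x u, m)) \<phi> a"
    by (simp add: pre_tensor_def a word_eq)
qed

lemma U_mult_closed:
  assumes "u \<in> U" "u' \<in> U"
  shows "u \<otimes>\<^bsub>env_algebra L\<^esub> u' \<in> U" "u \<oplus>\<^bsub>env_algebra L\<^esub> u' \<in> U"
  using assms by (auto simp: env_algebra_carrier env_class_hom)

lemma gen_FA: "x \<in> carrier L \<Longrightarrow> gen x \<in> FA"
  by simp

lemma P_act_closed:
  assumes "x \<in> carrier L" "\<phi> \<in> carrier P"
  shows "act P x \<phi> \<in> carrier P"
  unfolding P_act[OF assms(2)]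
  using assms U_mult_closed gen_FA fin_supp_subspace 
  by (intro lin_ext_in_subspace[of _ _ "U \<times> UNIV"]) (auto simp: P_carrier)

lemma tensor_relations_eq:
  "tensor_relations L B Z =
     {delta (u \<oplus>\<^bsub>env_algebra L\<^esub> u', m) - delta (u, m) - delta (u', m) | u u' m.
        u \<in> U \<and> u' \<in> U} \<union>
     {delta (env_class L (word c []) \<otimes>\<^bsub>env_algebra L\<^esub> u, m) - fscale c (delta (u, m)) | c u m.
        u \<in> U} \<union>
     {delta (u, m + m') - delta (u, m) - delta (u, m') | u m m'. u \<in> U} \<union>
     {delta (u, c * m) - fscale c (delta (u, m)) | c u m. u \<in> U} \<union>
     {delta (u \<otimes>\<^bsub>env_algebra L\<^esub> env_class L q, m) - delta (u, free_act Z q m) | u q m.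
        u \<in> U \<and> q \<in> carrier (free_algebra (carrier B))}"
  by (simp add: tensor_relations_def fun_diff_def fscale_def Z)

lemma tensor_relations_cases:
  assumes "r \<in> tensor_relations L B Z"
  obtains u u' m where "u \<in> U" "u' \<in> U"
      "r = delta (u \<oplus>\<^bsub>env_algebra L\<^esub> u', m) - delta (u, m) - delta (u', m)"
    | c u m where "u \<in> U"
      "r = delta (env_class L (word c []) \<otimes>\<^bsub>env_algebra L\<^esub> u, m) - fscale c (delta (u, m))"
    | u m m' where "u \<in> U" "r = delta (u, m + m') - delta (u, m) - delta (u, m')"
    | c u m where "u \<in> U" "r = delta (u, c * m) - fscale c (delta (u, m))"
    | u q m where "u \<in> U" "q \<in> carrier (free_algebra (carrier B))"
      "r = delta (u \<otimes>\<^bsub>env_algebra L\<^esub> env_class L q, m) - delta (u, free_act Z q m)"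
  using assms unfolding tensor_relations_eq by blast

lemma tensor_relations_subset: "tensor_relations L B Z \<subseteq> carrier P"
proof -
  have d: "delta (u, m) \<in> carrier P" if "u \<in> U" for u and m :: complex 
    using that by (simp add: P_carrier)
  have sub: "fv.subspace (carrier P)" using P_pointwise pointwiseD(1) by blast
  have q: "env_class L q \<in> U" if "q \<in> carrier (free_algebra (carrier B))" for q
    using that B_sub by (intro env_class_closed) (auto simp: free_algebra_simps fin_supp_def)
  have w: "env_class L (word c []) \<in> U" for c by (simp add: word_eq)
  show ?thesis
  proof
    fix r assume "r \<in> tensor_relations L B Z"
    then show "r \<in> carrier P"
      by (cases rule: tensor_relations_cases) (simp_all add: fv.subspace_diff[OF sub] fv.subspace_scale[OF sub] d U_mult_closed q w)
  qed
qed

lemma K_eq: "K = fv.span (tensor_relations L B Z)"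
  unfolding tensor_kernel_def 
  by (rule pointwise_lin_span[OF P_pointwise tensor_relations_subset])

lemma K_rels:
  assumes "u \<in> U" "u' \<in> U"
  shows "delta (u \<oplus>\<^bsub>env_algebra L\<^esub> u', m) - delta (u, m) - delta (u', m) \<in> K"
    "delta (env_class L (word c []) \<otimes>\<^bsub>env_algebra L\<^esub> u, m) - fscale c (delta (u, m)) \<in> K"
    "delta (u, c * m) - fscale c (delta (u, m)) \<in> K"
    "q \<in> carrier (free_algebra (carrier B)) \<Longrightarrow> 
       delta (u \<otimes>\<^bsub>env_algebra L\<^esub> env_class L q, m) - delta (u, free_act Z q m) \<in> K"
  unfolding K_eq using assms
  by (rule_tac fv.span_base; unfold tensor_relations_eq; blast)+

lemma free_act_Z:
  assumes "q \<in> carrier (free_algebra (carrier B))"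
  shows "free_act Z q m = (\<Sum>w | q w \<noteq> 0. q w * foldr (act Z) w 1) * m"
proof -
  have ab: "abelian_monoid Z"
  proof (intro abelian_monoidI)
  qed (simp_all add: Z)
  have "foldr (act Z) w m = foldr (act Z) w 1 * m" for w
    by (induction w) (simp_all add: Z)
  then show ?thesis
    by (simp add: free_act_def finsum_eq_sum[OF ab] Z sum_distrib_right mult.assoc)
qed


lemma D_rels:
  assumes "p \<in> FA" "q \<in> FA"
  shows "D (p + q) - D p - D q \<in> K" "D (fscale c p) - fscale c (D p) \<in> K"
    "delta (env_class L p, m) - fscale m (D p) \<in> K"
    "b \<in> carrier B \<Longrightarrow> D (conv p (gen b)) - fscale (ch b) (D p) \<in> K"
proof -
  show "D (p + q) - D p - D q \<in> K"
    using K_rels(1)[of "env_class L p" "env_class L q" 1] assms by (simp add: env_class_hom)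
  show "D (fscale c p) - fscale c (D p) \<in> K"
    using K_rels(2)[of "env_class L p" "env_class L q" c 1] assms 
    by (simp add: env_class_hom word_eq conv_scale_left conv_one[of _ "carrier L"])
  show *: "delta (env_class L p, m) - fscale m (D p) \<in> K" for m
    using K_rels(3)[of "env_class L p" "env_class L q" m 1] assms by simp
  assume b: "b \<in> carrier B"
  have "{w. delta [b] w \<noteq> 0} = {[b]}" by (auto simp: delta_def)
  moreover have gb: "gen b \<in> carrier (free_algebra (carrier B))"
    using b by (simp add: free_algebra_simps)
  ultimately have "free_act Z (gen b) 1 = ch b"
    by (simp add: free_act_Z Z) (simp add: delta_def)
  moreover have "gen b \<in> FA" using b B_sub by auto
  ultimately have "D (conv p (gen b)) - delta (env_class L p, ch b) \<in> K"
    using K_rels(4)[of "env_class L p" "env_class L q" "gen b" 1] assms b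
    by (simp add: free_algebra_simps env_class_hom)
  then show "D (conv p (gen b)) - fscale (ch b) (D p) \<in> K"
    using fv.subspace_add[OF fv.subspace_span[of "tensor_relations L B Z"], folded K_eq] *[of "ch b"]
    by fastforce
qed

lemma K_subspace: "fv.subspace K"
  unfolding K_eq by simp

lemma D_span:
  assumes "fv.subspace T" "K \<subseteq> T" 
  shows "fv.subspace {p \<in> FA. D p \<in> T}"
proof -
  have tr: "x \<in> T" if "x - y \<in> K" "y \<in> T" for x y
    using fv.subspace_add[OF assms(1) subsetD[OF assms(2) that(1)] that(2)] by simp
  have "D (fscale c p) \<in> T" if "p \<in> FA" "D p \<in> T" for c p
    using D_rels(2)[OF that(1) that(1)] fv.subspace_scale[OF assms(1) that(2)] by (rule tr)
  moreover have "D (p + q) \<in> T" if "p \<in> FA" "q \<in> FA" "D p \<in> T" "D q \<in> T" for p q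
    using D_rels(1)[OF that(1,2)] fv.subspace_add[OF assms(1) that(3,4)]
    by (intro tr[of "D (p + q)" "D p + D q"]) (simp_all add: diff_diff_eq)
  moreover have "D 0 \<in> T"
    using D_rels(2)[of 0 0 0] fv.subspace_0[OF assms(1)] by (intro tr[of "D 0" 0]) simp_all
  ultimately show ?thesis by (auto simp: fv.subspace_def)
qed

text \<open>
  The left ideal of all \<open>p\<close> with \<open>U(L) p (1 \<otimes> 1) = 0\<close> in the induced module. All left multiples of \<open>p\<close> are
  quantified over so that \<open>J\<close> is a left ideal by definition; that \<open>K\<close> is stable under left
  multiplication would otherwise have to be checked relation by relation.
\<close>

definition J where "J = {p \<in> FA. \<forall>q\<in>FA. D (conv q p) \<in> K}"

lemma J_left: "p \<in> J \<Longrightarrow> q \<in> FA \<Longrightarrow> conv q p \<in> J"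
  by (auto simp: J_def conv_assoc[of _ "carrier L", symmetric])

lemma J_K: "p \<in> J \<Longrightarrow> D p \<in> K"
  using conv_one(1)[of p "carrier L"] by (auto simp: J_def dest: bspec[of _ _ "delta []"])

lemma env_ideal_J: 
  assumes "p \<in> env_ideal L"
  shows "p \<in> J"
proof -
  have "D (conv q p) \<in> K" if "q \<in> FA" for q
  proof -
    have "env_class L (conv q p) = env_class L 0"
      using env_ideal_conv(2)[OF assms that] env_ideal_FA that by (simp add: env_class_eq_iff)
    moreover have "D 0 \<in> K" using D_rels(2)[of 0 0 0] by simp
    ultimately show ?thesis by simp
  qed
  then show ?thesis using assms env_ideal_FA by (simp add: J_def)
qed

lemma J_char:
  assumes "b \<in> carrier B"
  shows "gen b - fscale (ch b) (delta []) \<in> J"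
proof -
  have b: "gen b \<in> FA" using assms B_sub by auto
  have "D (conv q (gen b) - fscale (ch b) q) \<in> K" if q: "q \<in> FA" for q
  proof -
    have 1: "D (conv q (gen b)) - fscale (ch b) (D q) \<in> K" by (rule D_rels(4)[OF q q assms])
    have 2: "D (fscale (- ch b) q) - fscale (- ch b) (D q) \<in> K" by (rule D_rels(2)[OF q q])
    have 3: "D (conv q (gen b) + fscale (- ch b) q) - D (conv q (gen b)) - D (fscale (- ch b) q) \<in> K"
      by (rule D_rels(1)[OF FA_closed(6)[OF q b] FA_closed(5)[OF q]])
    from fv.subspace_add[OF K_subspace fv.subspace_add[OF K_subspace 1 2] 3] show ?thesis
      by (simp add: algebra_simps)
  qed
  then show ?thesis using b
    by (auto simp: J_def conv_diff_right conv_scale_right conv_one[of _ "carrier L"])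
qed

text \<open>
  A word is obtained from the empty word by left multiplications.
\<close>

lemma span_stable_eq_FA:
  assumes "fv.subspace S" "delta [] \<in> S"
    and "\<And>x p. x \<in> carrier L \<Longrightarrow> p \<in> S \<Longrightarrow> conv (gen x) p \<in> S"
  shows "FA \<subseteq> S"
proof
  have w: "delta w \<in> S" if "set w \<subseteq> carrier L" for w
    using that
  proof (induction w)
    case (Cons x w)
    then show ?case using assms(3)[of x "delta w"] by (simp add: conv_delta)
  qed (use assms in simp)
  fix p assume "p \<in> FA"
  then show "p \<in> S"
    using lin_ext_in_subspace[OF assms(1), of p "lists (carrier L)" delta] w
    by (auto simp: lin_ext_delta_id lists_eq_set)
qed

text \<open>
  Passage from the algebra to the tensor product: \<open>u \<otimes> m\<close> is \<open>m (u \<otimes> 1)\<close> modulo \<open>K\<close>, and \<open>p\<close> acts on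
  \<open>1 \<otimes> 1\<close> by a linear combination of \<open>Y\<close> once \<open>p\<close> is one modulo \<open>J\<close>.
\<close>

lemma P_span:
  assumes "FA \<subseteq> fv.span (J \<union> Y)" "Y \<subseteq> FA"
  shows "carrier P \<subseteq> fv.span (K \<union> D ` Y)"
proof
  let ?T = "fv.span (K \<union> D ` Y)"
  have KT: "K \<subseteq> ?T" using fv.span_superset by blast
  have "fv.subspace {p \<in> FA. D p \<in> ?T}" by (rule D_span) (use KT in auto)
  moreover have "J \<union> Y \<subseteq> {p \<in> FA. D p \<in> ?T}"
    using KT J_K assms(2) by (auto simp: J_def intro: fv.span_base)
  ultimately have "fv.span (J \<union> Y) \<subseteq> {p \<in> FA. D p \<in> ?T}" by (intro fv.span_minimal)
  then have D: "D p \<in> ?T" if "p \<in> FA" for p using that assms(1) by blast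
  have 1: "delta (env_class L p, m) \<in> ?T" if "p \<in> FA" for p m
  proof -
    have "delta (env_class L p, m) - fscale m (D p) \<in> ?T" using KT D_rels(3)[OF that that] by blast
    from fv.span_add[OF this fv.span_scale[OF D[OF that], of m]] show ?thesis by simp
  qed
  fix \<phi> assume "\<phi> \<in> carrier P"
  then have "\<phi> \<in> fin_supp (U \<times> UNIV)" by (simp add: P_carrier)
  moreover have "delta a \<in> ?T" if "a \<in> U \<times> UNIV" for a
    using that 1 by (auto simp: env_algebra_carrier)
  ultimately show "\<phi> \<in> ?T"
    using lin_ext_in_subspace[OF fv.subspace_span, of \<phi> "U \<times> UNIV" delta]
    by (simp only: lin_ext_delta_id)
qed

text \<open>
  The element \<open>u v\<close> of \<open>N\<close> for a class \<open>u\<close> in \<open>U(L)\<close>; the choice of the representative is immaterial by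
  \<open>env_class_eq_iff\<close> and \<open>env_ideal_annihilates\<close>. Then \<open>can_map\<close> is the map \<open>u \<otimes> m \<mapsto> m (u v)\<close> given by
  the universal property of induction.
\<close>

definition env_act where
  "env_act N v u = free_act N (SOME p. p \<in> FA \<and> env_class L p = u) v"

definition can_map where
  "can_map N v = lin_ext (\<lambda>(u, m :: complex). fscale m (env_act N v u))"

context
  fixes N :: "('g, 'a \<Rightarrow> complex) rep" and v
  assumes N: "pointwise N" "lie_module L N" and v: "v \<in> carrier N"
    and ch: "\<And>b. b \<in> carrier B \<Longrightarrow> act N b v = fscale (ch b) v"
begin

lemma env_act_class:
  assumes "p \<in> FA"
  shows "env_act N v (env_class L p) = free_act N p v"
proof -
  define q where "q = (SOME q. q \<in> FA \<and> env_class L q = env_class L p)"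
  have q: "q \<in> FA" "env_class L q = env_class L p"
    unfolding q_def using someI[of "\<lambda>q. q \<in> FA \<and> env_class L q = env_class L p" p] assms by auto
  then have "q - p \<in> env_ideal L" using assms by (simp add: env_class_eq_iff)
  then have "free_act N (q - p) v = 0" using env_ideal_annihilates[OF N] v by blast
  then have "free_act N q v = free_act N p v"
    using q(1) assms v by (simp add: free_act_eq[OF N] lin_ext_diff[of _ "lists (carrier L)"])
  then show ?thesis by (simp add: env_act_def q_def[symmetric])
qed

lemma env_act_closed: "u \<in> U \<Longrightarrow> env_act N v u \<in> carrier N"
  by (auto simp: env_algebra_carrier env_act_class free_act_closed[OF N] v)

lemma free_act_gen:
  assumes "x \<in> carrier L" "y \<in> carrier N"
  shows "free_act N (gen x) y = act N x y"
  using assms by (simp add: free_act_eq[OF N])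

lemma env_act_hom:
  assumes "u \<in> U" "u' \<in> U"
  shows "env_act N v (u \<oplus>\<^bsub>env_algebra L\<^esub> u') = env_act N v u + env_act N v u'" (is ?P1)
    "x \<in> carrier L \<Longrightarrow> 
      env_act N v (env_class L (gen x) \<otimes>\<^bsub>env_algebra L\<^esub> u) = act N x (env_act N v u)"
    "env_act N v (env_class L (word c []) \<otimes>\<^bsub>env_algebra L\<^esub> u) = fscale c (env_act N v u)" (is ?P2)
    "q \<in> carrier (free_algebra (carrier B)) \<Longrightarrow> 
      env_act N v (u \<otimes>\<^bsub>env_algebra L\<^esub> env_class L q) = fscale (free_act Z q 1) (env_act N v u)"
proof -
  obtain p p' where p: "p \<in> FA" "u = env_class L p" "p' \<in> FA" "u' = env_class L p'"
    using assms by (auto simp: env_algebra_carrier)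
  show ?P1
    using p v by (simp add: env_class_hom env_act_class free_act_eq[OF N] 
        lin_ext_add[of _ "lists (carrier L)"])
  show "env_act N v (env_class L (gen x) \<otimes>\<^bsub>env_algebra L\<^esub> u) = act N x (env_act N v u)"
    if "x \<in> carrier L"
    using p v that by (simp add: env_class_hom env_act_class free_act_mult[OF N] 
        free_act_closed[OF N] free_act_gen)
  show ?P2
    using p v by (simp add: env_class_hom env_act_class free_act_eq[OF N] word_eq conv_scale_left
       conv_one[of _ "carrier L"] lin_ext_scale)
  assume q: "q \<in> carrier (free_algebra (carrier B))"
  then have q': "q \<in> FA" using B_sub by (auto simp: free_algebra_simps fin_supp_def)
  have "foldr (act N) w v = fscale (foldr (act Z) w 1) v" if "set w \<subseteq> carrier B" for w
    using that
  proof (induction w)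
    case (Cons b w)
    then have "b \<in> carrier L" using B_sub by auto
    then have "act N b (fscale c v) = fscale c (act N b v)" for c
      using N v by (simp add: pointwise_lie_module_iff)
    moreover have "foldr (act N) w v = fscale (foldr (act Z) w 1) v"
      by (rule Cons.IH) (use Cons.prems in auto)
    moreover have "act N b v = fscale (ch b) v" using Cons ch by simp
    moreover have "foldr (act Z) (b # w) 1 = ch b * foldr (act Z) w 1" by (simp add: Z(5))
    ultimately show ?case by (simp only: foldr.simps o_apply fv.scale_scale mult.commute)
  qed simp
  then have "free_act N q v = fscale (free_act Z q 1) v"
    using q q' v by (auto simp: free_act_eq[OF N] free_act_Z lin_ext_def fv.scale_sum_left 
        free_algebra_simps fin_supp_def lists_eq_set intro!: sum.cong)
  moreover have "free_act N p (fscale c v) = fscale c (free_act N p v)" for c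
  proof -
    have "fscale c v \<in> carrier N" using v N by (simp add: pointwise_def fv.subspace_scale)
    moreover have "lin_ext (\<lambda>w. foldr (act N) w (fscale c v)) p = 
        fscale c (lin_ext (\<lambda>w. foldr (act N) w v) p)"
      unfolding lin_ext_def fv.scale_sum_right using p(1) foldr_act_linear(2)[OF N] v
      by (intro sum.cong) (auto simp: fin_supp_def lists_eq_set)
    ultimately show ?thesis using p v by (simp add: free_act_eq[OF N])
  qed
  ultimately show "env_act N v (u \<otimes>\<^bsub>env_algebra L\<^esub> env_class L q) = 
      fscale (free_act Z q 1) (env_act N v u)"
    using p q' v by (simp add: env_class_hom env_act_class free_act_mult[OF N])
qed

lemma can_map_delta: "can_map N v (delta (u, c)) = fscale c (env_act N v u)"
  unfolding can_map_def lin_ext_delta prod.case ..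

lemma can_map_zero: "can_map N v 0 = 0"
  unfolding can_map_def by (rule lin_ext_zero)

lemma can_map_linear:
  assumes "\<phi> \<in> carrier P" "\<psi> \<in> carrier P"
  shows "can_map N v (\<phi> + \<psi>) = can_map N v \<phi> + can_map N v \<psi>"
    "can_map N v (\<phi> - \<psi>) = can_map N v \<phi> - can_map N v \<psi>"
  using assms unfolding can_map_def P_carrier
  by (simp_all add: lin_ext_add lin_ext_diff)

lemma can_map_scale: "can_map N v (fscale c \<phi>) = fscale c (can_map N v \<phi>)"
  unfolding can_map_def by (rule lin_ext_scale)

lemma can_map_closed: "\<phi> \<in> carrier P \<Longrightarrow> can_map N v \<phi> \<in> carrier N"
  unfolding can_map_def P_carrier
  by (rule lin_ext_in_subspace[of _ _ "U \<times> UNIV"]) 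
    (use N env_act_closed in \<open>auto simp: pointwise_def intro!: fv.subspace_scale\<close>)

lemma can_map_act:
  assumes "\<phi> \<in> carrier P" "x \<in> carrier L"
  shows "can_map N v (act P x \<phi>) = act N x (can_map N v \<phi>)"
proof -
  have "\<phi> \<in> fin_supp (U \<times> UNIV)" using assms by (simp add: P_carrier)
  then show ?thesis
  proof (induction \<phi> rule: fin_supp_induct)
    case (delta a)
    obtain u m where a: "a = (u, m)" "u \<in> U" using delta by auto
    have "delta a \<in> carrier P" using delta by (simp add: P_carrier)
    moreover have "act N x (fscale m (env_act N v u)) = fscale m (act N x (env_act N v u))"
      using N env_act_closed[OF a(2)] assms(2) by (simp add: pointwise_lie_module_iff)
    moreover have "act P x (delta a) = delta (env_class L (gen x) \<otimes>\<^bsub>env_algebra L\<^esub> u, m)"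
      using P_act[OF calculation(1)] by (simp only: lin_ext_delta a prod.case)
    ultimately show ?case using env_act_hom(2)[OF a(2) a(2) assms(2)]
      unfolding a by (simp only: can_map_delta)
  next
    case zero
    have 0: "0 \<in> carrier P" "0 \<in> carrier N"
      using N P_pointwise by (simp_all add: pointwise_def fv.subspace_0)
    have "act N x (fscale 0 0) = fscale 0 (act N x 0)"
      using N 0 assms(2) by (simp add: pointwise_lie_module_iff del: fv.scale_zero_left fv.scale_zero_right)
    then have "act N x 0 = 0" by simp
    moreover have "act P x 0 = 0" unfolding P_act[OF 0(1)] by (rule lin_ext_zero)
    ultimately show ?case by (simp only: can_map_zero)
  next
    case (add p q)
    then have pq: "p \<in> carrier P" "q \<in> carrier P" "p + q \<in> carrier P"
      by (simp_all add: P_carrier fv.subspace_add fin_supp_subspace)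
    have "act P x (p + q) = act P x p + act P x q"
      using pq lin_ext_add[OF add(1,2)] by (simp add: P_act)
    then have "can_map N v (act P x (p + q)) = act N x (can_map N v (p + q))"
      using add pq N can_map_closed assms(2)
      by (simp add: can_map_linear P_act_closed pointwise_lie_module_iff)
    then show ?case .
  next
    case (scale c p)
    then have pq: "p \<in> carrier P" "fscale c p \<in> carrier P"
      by (simp_all add: P_carrier fv.subspace_scale fin_supp_subspace)
    have "act P x (fscale c p) = fscale c (act P x p)"
      using pq by (simp add: P_act lin_ext_scale)
    then have "can_map N v (act P x (fscale c p)) = act N x (can_map N v (fscale c p))"
      using scale pq N can_map_closed assms(2)
      by (simp add: can_map_linear can_map_scale P_act_closed pointwise_lie_module_iff)
    then show ?case .
  qed
qed

text \<open>
  Each of the five kinds of tensor relations is respected: four by linearity of the action, the last one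
  because \<open>B\<close> acts on \<open>v\<close> by the character.
\<close>

lemma can_map_K:
  assumes "\<phi> \<in> K"
  shows "\<phi> \<in> carrier P" "can_map N v \<phi> = 0"
proof -
  have sub: "fv.subspace {\<phi> \<in> carrier P. can_map N v \<phi> = 0}"
    unfolding fv.subspace_def mem_Collect_eq
    using pointwiseD(1)[OF P_pointwise] can_map_linear(1) can_map_scale
    by (auto simp: can_map_zero fv.subspace_def)
  have d: "delta (u, m) \<in> carrier P" if "u \<in> U" for u and m :: complex 
    using that by (simp add: P_carrier)
  have Psub: "fv.subspace (carrier P)" using P_pointwise pointwiseD(1) by blast
  have q: "env_class L q \<in> U" if "q \<in> carrier (free_algebra (carrier B))" for q
    using that B_sub by (intro env_class_closed) (auto simp: free_algebra_simps fin_supp_def)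
  have w: "env_class L (word c []) \<in> U" for c by (simp add: word_eq)
  have fz: "free_act Z q m = m * free_act Z q 1" if "q \<in> carrier (free_algebra (carrier B))" for q m
    using free_act_Z[OF that, of m] free_act_Z[OF that, of 1] by simp
  have "can_map N v r = 0" if "r \<in> tensor_relations L B Z" for r
    using that
  proof (cases rule: tensor_relations_cases)
    case (5 u q' m)
    then have "can_map N v r = fscale m (env_act N v (u \<otimes>\<^bsub>env_algebra L\<^esub> env_class L q')) 
        - fscale (free_act Z q' m) (env_act N v u)"
      using q U_mult_closed by (simp add: can_map_linear can_map_delta d)
    then show ?thesis using 5 by (simp add: env_act_hom fz[of q' m])
  qed (simp_all add: fv.subspace_diff[OF Psub] fv.subspace_scale[OF Psub] d U_mult_closed w
        can_map_linear can_map_scale can_map_delta env_act_hom fv.scale_right_distrib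
        fv.scale_left_distrib mult.commute)
  then have "K \<subseteq> {\<phi> \<in> carrier P. can_map N v \<phi> = 0}"
    unfolding K_eq using tensor_relations_subset by (intro fv.span_minimal sub) auto
  then show "\<phi> \<in> carrier P" "can_map N v \<phi> = 0" using assms by auto
qed

end

end

section \<open>The Takiff algebra in a basis\<close>

definition e_el :: takiff where "e_el = (vector [vector [0, 1], vector [0, 0]], 0)"
definition f_el :: takiff where "f_el = (vector [vector [0, 0], vector [1, 0]], 0)"
definition ebar_el :: takiff where "ebar_el = (0, vector [vector [0, 1], vector [0, 0]])"
definition fbar_el :: takiff where "fbar_el = (0, vector [vector [0, 0], vector [1, 0]])"

abbreviation takiff_basis :: "takiff set" where
  "takiff_basis \<equiv> {e_el, h_el, f_el, ebar_el, hbar_el, fbar_el}"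

lemmas basis_defs = e_el_def f_el_def ebar_el_def fbar_el_def h_el_def hbar_el_def

lemma trace_2: "trace (A :: complex^2^2) = A $ 1 $ 1 + A $ 2 $ 2"
  by (simp add: trace_def sum_2)

lemma takiff_simps:
  "(A, B) \<in> carrier takiff \<longleftrightarrow> A $ 2 $ 2 = - (A $ 1 $ 1) \<and> B $ 2 $ 2 = - (B $ 1 $ 1)"
  "(A, B) \<oplus>\<^bsub>takiff\<^esub> (A', B') = (A + A', B + B')"
  "c \<odot>\<^bsub>takiff\<^esub> (A, B) = (\<chi> i j. c * A $ i $ j, \<chi> i j. c * B $ i $ j)"
  "bracket takiff (A, B) (A', B') = (commutator A A', commutator A B' + commutator B A')"
  by (simp_all add: takiff_def trace_2 add_eq_0_iff)

lemma commutator_entries: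
  "commutator A B $ 1 $ 1 = A $ 1 $ 2 * B $ 2 $ 1 - B $ 1 $ 2 * A $ 2 $ 1"
  "commutator A B $ 1 $ 2 = A $ 1 $ 1 * B $ 1 $ 2 + A $ 1 $ 2 * B $ 2 $ 2 - B $ 1 $ 1 * A $ 1 $ 2 - B $ 1 $ 2 * A $ 2 $ 2"
  "commutator A B $ 2 $ 1 = A $ 2 $ 1 * B $ 1 $ 1 + A $ 2 $ 2 * B $ 2 $ 1 - B $ 2 $ 1 * A $ 1 $ 1 - B $ 2 $ 2 * A $ 2 $ 1"
  "commutator A B $ 2 $ 2 = A $ 2 $ 1 * B $ 1 $ 2 - B $ 2 $ 1 * A $ 1 $ 2"
  by (simp_all add: commutator_def matrix_matrix_mult_def sum_2)

interpretation takiff: lie_closed takiff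
proof
  fix x y :: takiff and c
  obtain A B A' B' where xy: "x = (A, B)" "y = (A', B')" by fastforce
  show "c \<odot>\<^bsub>takiff\<^esub> x \<in> carrier takiff" if "x \<in> carrier takiff"
    using that by (simp add: xy takiff_simps)
  assume "x \<in> carrier takiff" "y \<in> carrier takiff"
  then show "x \<oplus>\<^bsub>takiff\<^esub> y \<in> carrier takiff" "bracket takiff x y \<in> carrier takiff"
    by (simp_all add: xy takiff_simps commutator_entries algebra_simps)
qed

lemma basis_takiff [simp]:
  "e_el \<in> carrier takiff" "f_el \<in> carrier takiff" "ebar_el \<in> carrier takiff"
  "fbar_el \<in> carrier takiff" "h_el \<in> carrier takiff" "hbar_el \<in> carrier takiff"
  by (simp_all add: basis_defs takiff_simps vector_2)

lemma basis_borel [simp]: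
  "e_el \<in> carrier borel" "ebar_el \<in> carrier borel" "h_el \<in> carrier borel" "hbar_el \<in> carrier borel"
  using basis_takiff by (simp_all add: borel_def basis_defs vector_2)

lemma takiff_decomp:
  assumes "(A, B) \<in> carrier takiff"
  shows "(A, B) = (A $ 1 $ 2 \<odot>\<^bsub>takiff\<^esub> e_el) \<oplus>\<^bsub>takiff\<^esub> ((A $ 1 $ 1 \<odot>\<^bsub>takiff\<^esub> h_el) \<oplus>\<^bsub>takiff\<^esub> 
    ((A $ 2 $ 1 \<odot>\<^bsub>takiff\<^esub> f_el) \<oplus>\<^bsub>takiff\<^esub> ((B $ 1 $ 2 \<odot>\<^bsub>takiff\<^esub> ebar_el) \<oplus>\<^bsub>takiff\<^esub> 
    ((B $ 1 $ 1 \<odot>\<^bsub>takiff\<^esub> hbar_el) \<oplus>\<^bsub>takiff\<^esub> (B $ 2 $ 1 \<odot>\<^bsub>takiff\<^esub> fbar_el)))))"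
  using assms by (simp add: basis_defs takiff_simps vec_eq_iff forall_2 vector_2)

text \<open>
  A property that is linear in the element of the Takiff algebra need only be checked on the six
  basis elements.
\<close>

lemma takiff_induct [consumes 1, case_names e h f ebar hbar fbar add smult]:
  assumes "x \<in> carrier takiff" "Q e_el" "Q h_el" "Q f_el" "Q ebar_el" "Q hbar_el" "Q fbar_el"
    and add: "\<And>x y. x \<in> carrier takiff \<Longrightarrow> y \<in> carrier takiff \<Longrightarrow> Q x \<Longrightarrow> Q y \<Longrightarrow> Q (x \<oplus>\<^bsub>takiff\<^esub> y)"
    and smult: "\<And>c x. x \<in> carrier takiff \<Longrightarrow> Q x \<Longrightarrow> Q (c \<odot>\<^bsub>takiff\<^esub> x)"
  shows "Q x"
proof -
  obtain A B where x: "x = (A, B)" by fastforce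
  show ?thesis
    unfolding x takiff_decomp[OF assms(1)[unfolded x]]
    by (intro add smult takiff.add_closed takiff.smult_closed basis_takiff assms(2-7))
qed

lemma brackets:
  "bracket takiff fbar_el f_el = 0 \<odot>\<^bsub>takiff\<^esub> f_el"
  "bracket takiff hbar_el fbar_el = 0 \<odot>\<^bsub>takiff\<^esub> f_el"
  "bracket takiff hbar_el f_el = (-2) \<odot>\<^bsub>takiff\<^esub> fbar_el"
  "bracket takiff h_el fbar_el = (-2) \<odot>\<^bsub>takiff\<^esub> fbar_el"
  "bracket takiff h_el f_el = (-2) \<odot>\<^bsub>takiff\<^esub> f_el"
  "bracket takiff ebar_el fbar_el = 0 \<odot>\<^bsub>takiff\<^esub> f_el"
  "bracket takiff ebar_el f_el = hbar_el"
  "bracket takiff e_el fbar_el = hbar_el"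
  "bracket takiff e_el f_el = h_el"
  by (simp_all add: basis_defs takiff_simps vec_eq_iff forall_2 vector_2 commutator_entries)

lemma act_decomp:
  assumes N: "pointwise N" "lie_module takiff N" and x: "(A, B) \<in> carrier takiff" and v: "v \<in> carrier N"
  shows "act N (A, B) v = fscale (A $ 1 $ 2) (act N e_el v) + (fscale (A $ 1 $ 1) (act N h_el v) + 
    (fscale (A $ 2 $ 1) (act N f_el v) + (fscale (B $ 1 $ 2) (act N ebar_el v) + 
    (fscale (B $ 1 $ 1) (act N hbar_el v) + fscale (B $ 2 $ 1) (act N fbar_el v)))))"
proof -
  have lin: "act N (x \<oplus>\<^bsub>takiff\<^esub> y) v = act N x v + act N y v"
    if "x \<in> carrier takiff" "y \<in> carrier takiff" for x y
    using N v that by (simp add: pointwise_lie_module_iff)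
  have sc: "act N (c \<odot>\<^bsub>takiff\<^esub> x) v = fscale c (act N x v)"
    if "x \<in> carrier takiff" for x c
    using N v that by (simp add: pointwise_lie_module_iff)
  show ?thesis
    by (subst takiff_decomp[OF x])
      (simp add: lin sc takiff.add_closed takiff.smult_closed)
qed

section \<open>A characterisation of Verma modules\<close>

lemma span_range_sum:
  assumes "x \<in> fv.span (range g)"
  shows "\<exists>T c. finite T \<and> x = (\<Sum>t\<in>T. fscale (c t) (g t))"
proof -
  obtain S r where S: "finite S" "S \<subseteq> range g" "x = (\<Sum>a\<in>S. fscale (r a) a)"
    using assms by (auto simp: fv.span_explicit)
  obtain T where T: "inj_on g T" "S = g ` T" using S(2) by (auto simp: subset_image_inj)
  have "finite T" using S(1) T by (simp add: finite_image_iff)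
  moreover have "x = (\<Sum>t\<in>T. fscale (r (g t)) (g t))"
    unfolding S(3) T(2) by (rule sum.reindex_cong[OF T(1)]) auto
  ultimately show ?thesis by (intro exI[of _ T] exI[of _ "\<lambda>t. r (g t)"]) simp
qed

interpretation verma: induced_line takiff borel "weight_line m mb" 
  "\<lambda>x. fst x $ 1 $ 1 * m + snd x $ 1 $ 1 * mb" for m mb
  by unfold_locales (auto simp: borel_def weight_line_def)

context
  fixes m mb :: complex
begin

abbreviation "lmul x \<equiv> conv (takiff.gen x)"
abbreviation "JJ \<equiv> verma.J m mb"
abbreviation "pbw \<equiv> \<lambda>(i, j). delta (replicate j f_el @ replicate i fbar_el)"
text \<open>
  The ordered monomials \<open>f^j f-bar^i\<close> span the enveloping algebra modulo \<open>J\<close>. It suffices that the span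
  is stable under left multiplication; this is shown for \<open>f\<close>, \<open>f\<close>-bar, \<open>h\<close>-bar, \<open>h\<close>, \<open>e\<close>-bar and \<open>e\<close> in
  this order, each commutator with \<open>f\<close> and \<open>f\<close>-bar leading back to earlier elements.
\<close>

abbreviation "pbw_span \<equiv> fv.span (JJ \<union> range pbw)"

lemma pbw_FA: "pbw t \<in> takiff.FA"
  by (cases t) (auto simp: in_lists_conv_set)

lemma pbw_span_FA: "pbw_span \<subseteq> takiff.FA"
proof (rule fv.span_minimal)
  show "JJ \<union> range pbw \<subseteq> takiff.FA" using pbw_FA by (auto simp: verma.J_def)
qed (rule takiff.FA_subspace)

lemma pbw_in_span: "pbw t \<in> pbw_span"
  by (intro fv.span_base) blast

lemma J_in_span: "p \<in> JJ \<Longrightarrow> p \<in> pbw_span"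
  by (intro fv.span_base) blast

lemma stable_from_pbw:
  assumes "x \<in> carrier takiff" "\<And>i j. lmul x (pbw (i, j)) \<in> pbw_span" "p \<in> pbw_span"
  shows "lmul x p \<in> pbw_span"
proof -
  have "fv.subspace {p. lmul x p \<in> pbw_span}"
    unfolding fv.subspace_def mem_Collect_eq conv_add_right conv_scale_right conv_zero
    by (blast intro: fv.span_add fv.span_scale fv.span_zero)
  moreover have "lmul x p \<in> pbw_span" if "p \<in> JJ" for p
    using assms(1) that by (intro J_in_span verma.J_left) auto
  ultimately have "pbw_span \<subseteq> {p. lmul x p \<in> pbw_span}"
    using assms(2) by (intro fv.span_minimal) auto
  then show ?thesis using assms(3) by blast
qed

text \<open>
  The relations hold under any right factor \<open>p\<close> since the defining ideal is two-sided.
\<close>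

lemma stable_commute:
  assumes xy: "x \<in> carrier takiff" "y \<in> carrier takiff" and p: "p \<in> takiff.FA"
    and "lmul y (lmul x p) \<in> pbw_span"
    and "lmul (bracket takiff x y) p \<in> pbw_span"
  shows "lmul x (lmul y p) \<in> pbw_span"
proof -
  have g: "takiff.gen x \<in> takiff.FA" "takiff.gen y \<in> takiff.FA" using xy by auto
  have "conv (lmul x (takiff.gen y) - lmul y (takiff.gen x) 
      - takiff.gen (bracket takiff x y)) p \<in> pbw_span"
    by (intro J_in_span verma.env_ideal_J takiff.env_ideal_conv takiff.env_ideal_gens xy p)
  then have "lmul x (lmul y p) - lmul y (lmul x p) 
      - lmul (bracket takiff x y) p \<in> pbw_span"
    by (simp only: conv_diff_left conv_assoc[OF g p] conv_assoc[OF g(2,1) p])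
  from fv.span_add[OF fv.span_add[OF this assms(5)] assms(4)] show ?thesis by simp
qed

lemma stable_smult:
  assumes "x \<in> carrier takiff" "p \<in> takiff.FA" "lmul x p \<in> pbw_span"
  shows "lmul (c \<odot>\<^bsub>takiff\<^esub> x) p \<in> pbw_span"
proof -
  have "conv (takiff.gen (c \<odot>\<^bsub>takiff\<^esub> x) - fscale c (takiff.gen x)) p \<in> pbw_span"
    by (intro J_in_span verma.env_ideal_J takiff.env_ideal_conv takiff.env_ideal_gens(2)[OF assms(1,1)] assms(2))
  then have "lmul (c \<odot>\<^bsub>takiff\<^esub> x) p - fscale c (lmul x p) \<in> pbw_span"
    by (simp only: conv_diff_left conv_scale_left)
  from fv.span_add[OF this fv.span_scale[OF assms(3), of c]] show ?thesis by simp
qed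

lemma stable_add:
  assumes "x \<in> carrier takiff" "y \<in> carrier takiff" "p \<in> takiff.FA" 
    "lmul x p \<in> pbw_span" "lmul y p \<in> pbw_span"
  shows "lmul (x \<oplus>\<^bsub>takiff\<^esub> y) p \<in> pbw_span"
proof -
  have "conv (takiff.gen (x \<oplus>\<^bsub>takiff\<^esub> y) - takiff.gen x - takiff.gen y) p \<in> pbw_span"
    by (intro J_in_span verma.env_ideal_J takiff.env_ideal_conv takiff.env_ideal_gens assms)
  then have "lmul (x \<oplus>\<^bsub>takiff\<^esub> y) p - lmul x p - lmul y p \<in> pbw_span"
    by (simp only: conv_diff_left)
  from fv.span_add[OF fv.span_add[OF this assms(5)] assms(4)] show ?thesis by simp
qed

lemma pbw_f: "lmul f_el (pbw (i, j)) = pbw (i, Suc j)"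
  and pbw_fbar: "lmul fbar_el (pbw (i, 0)) = pbw (Suc i, 0)"
  by (simp_all add: conv_delta)

lemma stable_f:
  assumes "p \<in> pbw_span" shows "lmul f_el p \<in> pbw_span"
proof (rule stable_from_pbw[OF _ _ assms])
  show "lmul f_el (pbw (i, j)) \<in> pbw_span" for i j
    unfolding pbw_f by (rule pbw_in_span)
qed simp

lemma stable_fbar:
  assumes "p \<in> pbw_span" shows "lmul fbar_el p \<in> pbw_span"
proof (rule stable_from_pbw[OF _ _ assms])
  fix i j
  show "lmul fbar_el (pbw (i, j)) \<in> pbw_span"
  proof (induction j)
    case 0
    show ?case unfolding pbw_fbar by (rule pbw_in_span)
  next
    case (Suc j)
    have "lmul fbar_el (lmul f_el (pbw (i, j))) \<in> pbw_span"
    proof (rule stable_commute[OF basis_takiff(4,2) pbw_FA])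
      show "lmul (bracket takiff fbar_el f_el) (pbw (i, j)) \<in> pbw_span"
        unfolding brackets by (rule stable_smult[OF basis_takiff(2) pbw_FA stable_f[OF pbw_in_span]])
    qed (rule stable_f[OF Suc.IH])
    then show ?case unfolding pbw_f .
  qed
qed simp

text \<open>
  An element \<open>x\<close> of the Borel subalgebra is moved to the right through \<open>f\<close> and \<open>f\<close>-bar, leaving brackets
  \<open>[x, f]\<close> and \<open>[x, f-bar]\<close> behind, until it meets the generator, where it becomes a scalar modulo \<open>J\<close>.
\<close>

lemma stable_borel:
  assumes x: "x \<in> carrier borel"
    and f: "\<And>p. p \<in> pbw_span \<Longrightarrow> lmul (bracket takiff x f_el) p \<in> pbw_span"
    and fbar: "\<And>p. p \<in> pbw_span \<Longrightarrow> lmul (bracket takiff x fbar_el) p \<in> pbw_span"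
    and p: "p \<in> pbw_span"
  shows "lmul x p \<in> pbw_span"
proof -
  have xt: "x \<in> carrier takiff" using x verma.B_sub by blast
  have fbar': "lmul x (pbw (i, 0)) \<in> pbw_span" for i
  proof (induction i)
    case 0
    let ?c = "fst x $ 1 $ 1 * m + snd x $ 1 $ 1 * mb"
    have "takiff.gen x - fscale ?c (delta []) \<in> pbw_span"
      by (rule J_in_span, rule verma.J_char[OF x])
    moreover have "delta [] \<in> pbw_span" using pbw_in_span[of "(0, 0)"] by simp
    ultimately have "(takiff.gen x - fscale ?c (delta [])) + fscale ?c (delta []) \<in> pbw_span"
      by (intro fv.span_add fv.span_scale)
    then have "lmul x (pbw (0, 0)) \<in> pbw_span" by (simp add: conv_delta)
    then show ?case .
  next
    case (Suc i)
    have "lmul x (lmul fbar_el (pbw (i, 0))) \<in> pbw_span"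
      by (rule stable_commute[OF xt basis_takiff(4) pbw_FA stable_fbar[OF Suc.IH] fbar[OF pbw_in_span]])
    then show ?case unfolding pbw_fbar .
  qed
  have "lmul x (pbw (i, j)) \<in> pbw_span" for i j
  proof (induction j)
    case (Suc j)
    have "lmul x (lmul f_el (pbw (i, j))) \<in> pbw_span"
      by (rule stable_commute[OF xt basis_takiff(2) pbw_FA stable_f[OF Suc.IH] f[OF pbw_in_span]])
    then show ?case unfolding pbw_f .
  qed (rule fbar')
  from stable_from_pbw[OF xt this p] show ?thesis .
qed

lemma stable_all:
  assumes "x \<in> carrier takiff" "p \<in> pbw_span"
  shows "lmul x p \<in> pbw_span"
proof -
  have sm: "lmul (c \<odot>\<^bsub>takiff\<^esub> x) p \<in> pbw_span" 
    if "x \<in> carrier takiff" "\<And>p. p \<in> pbw_span \<Longrightarrow> lmul x p \<in> pbw_span" "p \<in> pbw_span" for c x p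
    using that pbw_span_FA by (intro stable_smult) auto
  note sf = sm[OF basis_takiff(2) stable_f] and sfb = sm[OF basis_takiff(4) stable_fbar]
  have hbar: "lmul hbar_el p \<in> pbw_span" if "p \<in> pbw_span" for p
    by (rule stable_borel[OF _ _ _ that]; (unfold brackets)?; (rule basis_borel sf sfb)?; assumption?)
  have h: "lmul h_el p \<in> pbw_span" if "p \<in> pbw_span" for p
    by (rule stable_borel[OF _ _ _ that]; (unfold brackets)?; (rule basis_borel sf sfb)?; assumption?)
  have ebar: "lmul ebar_el p \<in> pbw_span" if "p \<in> pbw_span" for p
    by (rule stable_borel[OF _ _ _ that]; (unfold brackets)?; (rule basis_borel sf sfb hbar)?; assumption?)
  have e: "lmul e_el p \<in> pbw_span" if "p \<in> pbw_span" for p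
    by (rule stable_borel[OF _ _ _ that]; (unfold brackets)?; (rule basis_borel sf sfb h hbar)?; assumption?)
  let ?Q = "\<lambda>x. \<forall>p\<in>pbw_span. lmul x p \<in> pbw_span"
  have "?Q x"
  proof (rule takiff_induct[OF assms(1), of ?Q])
    show "?Q (x \<oplus>\<^bsub>takiff\<^esub> y)" 
      if "x \<in> carrier takiff" "y \<in> carrier takiff" "?Q x" "?Q y" for x y
      using that pbw_span_FA by (intro ballI stable_add) auto
    show "?Q (c \<odot>\<^bsub>takiff\<^esub> x)" if "x \<in> carrier takiff" "?Q x" for c x
      using that by (intro ballI sm) auto
  qed (intro ballI e h stable_f ebar hbar stable_fbar; assumption)+
  then show ?thesis using assms(2) by blast
qed

lemma FA_subset_pbw_span: "takiff.FA \<subseteq> pbw_span"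
  by (rule verma.span_stable_eq_FA) (use stable_all pbw_in_span[of "(0, 0)"] in auto)

end

text \<open>
  The canonical map from the Verma module to \<open>N\<close> sends the spanning monomials \<open>f^j f-bar^i \<otimes> 1\<close> to the
  vectors \<open>w (i, j)\<close>. Linear independence of the latter makes it injective, and makes the monomials a
  basis of the Verma module at the same time.
\<close>

theorem verma_characterisation:
  fixes N :: "(takiff, 'a \<Rightarrow> complex) rep"
  assumes N: "pointwise N" "lie_module takiff N" and v: "v \<in> carrier N"
    and hw: "act N e_el v = 0" "act N ebar_el v = 0" 
      "act N h_el v = fscale m v" "act N hbar_el v = fscale mb v"
  defines "w \<equiv> \<lambda>(i, j). (act N f_el ^^ j) ((act N fbar_el ^^ i) v)"
  assumes indep: "\<And>T c. finite T \<Longrightarrow> (\<Sum>t\<in>T. fscale (c t) (w t)) = 0 \<Longrightarrow> \<forall>t\<in>T. c t = 0"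
    and span: "carrier N \<subseteq> fv.span (range w)"
  shows "is_verma_with_hwv N v"
proof -
  define pb where "pb = (\<lambda>(i, j). delta (replicate j f_el @ replicate i fbar_el))"
  let ?Z = "weight_line m mb"
  let ?P = "pre_tensor takiff ?Z" and ?K = "tensor_kernel takiff borel ?Z"
  let ?D = "\<lambda>p. delta (env_class takiff p, 1 :: complex)"
  let ?F = "verma.can_map N v"
  have ch: "act N b v = fscale (fst b $ 1 $ 1 * m + snd b $ 1 $ 1 * mb) v" if "b \<in> carrier borel" for b
  proof -
    obtain A B where b: "b = (A, B)" by fastforce
    have "(A, B) \<in> carrier takiff" "A $ 2 $ 1 = 0" "B $ 2 $ 1 = 0"
      using that by (auto simp: b borel_def)
    then show ?thesis using hw by (simp add: b act_decomp[OF N _ v] fv.scale_left_distrib)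
  qed
  have Fdelta: "?F (delta (u, c)) = fscale c (verma.env_act N v u)" for u c
    by (rule verma.can_map_delta[where m = m and mb = mb, OF N v ch])
  have Fclosed: "?F \<phi> \<in> carrier N" if "\<phi> \<in> carrier ?P" for \<phi>
    by (rule verma.can_map_closed[OF N v ch that])
  have Fact: "?F (act ?P x \<phi>) = act N x (?F \<phi>)" if "\<phi> \<in> carrier ?P" "x \<in> carrier takiff" for x \<phi>
    by (rule verma.can_map_act[OF N v ch that])
  have FK: "\<phi> \<in> carrier ?P" "?F \<phi> = 0" if "\<phi> \<in> ?K" for \<phi>
    by (rule verma.can_map_K(1)[OF N v ch that], assumption)
      (rule verma.can_map_K(2)[OF N v ch that], assumption)
  have Fadd: "?F (\<phi> + \<psi>) = ?F \<phi> + ?F \<psi>" if "\<phi> \<in> carrier ?P" "\<psi> \<in> carrier ?P" for \<phi> \<psi>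
    by (rule verma.can_map_linear[OF N v ch that])
  have Fscale: "?F (fscale c \<phi>) = fscale c (?F \<phi>)" for c \<phi>
    by (rule verma.can_map_scale[where m = m and mb = mb, OF N v ch])
  have Fclass: "verma.env_act N v (env_class takiff p) = free_act N p v" if "p \<in> takiff.FA" for p
    by (rule verma.env_act_class[where m = m and mb = mb, OF N v ch that])
  have pbw: "pb t \<in> takiff.FA" for t
    by (cases t) (auto simp: pb_def in_lists_conv_set)
  have w: "?F (?D (pb t)) = w t" for t
  proof -
    obtain i j where t: "t = (i, j)" by fastforce
    have "?F (?D (pb t)) = free_act N (pb t) v"
      using Fdelta[of "env_class takiff (pb t)" 1] Fclass[OF pbw[of t]] by simp
    also have "\<dots> = foldr (act N) (replicate j f_el @ replicate i fbar_el) v"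
      using free_act_eq[OF N pbw v, of t] by (simp add: t pb_def)
    finally show ?thesis by (simp add: t w_def foldr_replicate)
  qed
  have DP: "?D (pb t) \<in> carrier ?P" for t
    using pbw by (simp add: verma.P_carrier)
  have Psub: "fv.subspace (carrier ?P)" using verma.P_pointwise pointwiseD(1) by blast
  have F0: "?F 0 = 0" using Fscale[of 0 0] by simp
  let ?s = "\<lambda>c T. \<Sum>t\<in>T. fscale (c t) (?D (pb t))"
  have Fsum: "?F (?s c T) = (\<Sum>t\<in>T. fscale (c t) (w t))"
    "(?s c T) \<in> carrier ?P" if "finite T" for T c
    using that
  proof (induction T)
    case (insert t T)
    have cl: "fscale (c t) (?D (pb t)) \<in> carrier ?P" by (rule fv.subspace_scale[OF Psub DP])
    have "?F (fscale (c t) (?D (pb t)) + (?s c T)) =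
        fscale (c t) (w t) + (\<Sum>t\<in>T. fscale (c t) (w t))"
      by (simp only: Fadd[OF cl insert.IH(2)] insert.IH(1) Fscale w)
    then show "?F (\<Sum>t\<in>insert t T. fscale (c t) (?D (pb t))) = (\<Sum>t\<in>insert t T. fscale (c t) (w t))"
      by (simp only: sum.insert[OF insert(1,2)])
    show "(\<Sum>t\<in>insert t T. fscale (c t) (?D (pb t))) \<in> carrier ?P"
      unfolding sum.insert[OF insert(1,2)]
      by (intro fv.subspace_add[OF Psub] fv.subspace_scale[OF Psub] DP insert.IH)
  next
    case empty
    show "?F (\<Sum>t\<in>{}. fscale (c t) (?D (pb t))) = (\<Sum>t\<in>{}. fscale (c t) (w t))"
      by (simp only: sum.empty F0)
    show "(\<Sum>t\<in>{}. fscale (c t) (?D (pb t))) \<in> carrier ?P"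
      unfolding sum.empty by (rule fv.subspace_0[OF Psub])
  qed
  have "carrier ?P \<subseteq> fv.span (?K \<union> ?D ` range pb)"
    by (rule verma.P_span) (use FA_subset_pbw_span[of m mb] pbw in \<open>auto simp: pb_def\<close>)
  then have Pspan: "\<exists>\<kappa> T c. \<kappa> \<in> ?K \<and> finite T \<and> \<phi> = \<kappa> + (?s c T)" 
    if "\<phi> \<in> carrier ?P" for \<phi>
  proof -
    have "\<phi> \<in> fv.span (?K \<union> range (\<lambda>t. ?D (pb t)))"
      using that \<open>carrier ?P \<subseteq> _\<close> by (auto simp: image_image)
    then obtain \<kappa> s where s: "\<kappa> \<in> fv.span ?K" "s \<in> fv.span (range (\<lambda>t. ?D (pb t)))" "\<phi> = \<kappa> + s"
      unfolding fv.span_Un by blast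
    have "\<kappa> \<in> ?K" using s(1) fv.span_minimal[OF order_refl verma.K_subspace] by blast
    moreover obtain T c where "finite T" "s = (?s c T)"
      using span_range_sum[OF s(2)] by blast
    ultimately show ?thesis using s(3) by blast
  qed
  \<comment> \<open>Modulo \<open>K\<close> every element is a combination of the monomials; if its image vanishes, independence of
    the \<open>w t\<close> kills all coefficients.\<close>
  have ker: "?F \<phi> = 0 \<longleftrightarrow> \<phi> \<in> ?K" if \<phi>: "\<phi> \<in> carrier ?P" for \<phi>
  proof
    assume F: "?F \<phi> = 0"
    obtain \<kappa> T c where s: "\<kappa> \<in> ?K" "finite T" "\<phi> = \<kappa> + (?s c T)"
      using Pspan[OF \<phi>] by blast
    have "?F \<phi> = ?F \<kappa> + (\<Sum>t\<in>T. fscale (c t) (w t))"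
      unfolding s(3) using Fadd[OF FK(1)[OF s(1)] Fsum(2)[OF s(2), of c]] Fsum(1)[OF s(2), of c] by simp
    then have "(\<Sum>t\<in>T. fscale (c t) (w t)) = 0"
      using F FK(2)[OF s(1)] by simp
    from indep[OF s(2) this] have "(?s c T) = 0"
      by (intro sum.neutral) (auto simp: fun_eq_iff)
    then show "\<phi> \<in> ?K" using s by simp
  qed (rule FK(2))
  have "?F ` carrier ?P = carrier N"
  proof
    show "?F ` carrier ?P \<subseteq> carrier N" using Fclosed by blast
    have "w t \<in> ?F ` carrier ?P" for t using w[of t] DP[of t] by (metis imageI)
    moreover have "fv.subspace (?F ` carrier ?P)"
      unfolding fv.subspace_def
    proof (intro conjI ballI allI)
      show "0 \<in> ?F ` carrier ?P" using F0 fv.subspace_0[OF Psub] by (metis imageI)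
      show "x + y \<in> ?F ` carrier ?P" if "x \<in> ?F ` carrier ?P" "y \<in> ?F ` carrier ?P" for x y
        using that Fadd[symmetric] fv.subspace_add[OF Psub] by (auto simp: image_iff)
      show "fscale c x \<in> ?F ` carrier ?P" if "x \<in> ?F ` carrier ?P" for c x
        using that Fscale[symmetric] fv.subspace_scale[OF Psub] by (auto simp: image_iff)
    qed
    ultimately show "carrier N \<subseteq> ?F ` carrier ?P"
      using span fv.span_minimal[of "range w" "?F ` carrier ?P"] by blast
  qed
  note im = this
  have Ksub: "submodule ?K cplx ?P"
    using verma.K_subspace FK(1) verma.P_pointwise
    by (auto simp: pointwise_submodule_iff)
  have "\<exists>f. rep_iso takiff (quot_rep ?P ?K) N f \<and> (\<forall>\<phi>\<in>carrier ?P. f (?K +>\<^bsub>?P\<^esub> \<phi>) = ?F \<phi>)"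
  proof (rule first_isomorphism[OF pointwise_module[OF verma.P_pointwise] Ksub pointwise_module[OF N(1)] im])
    show "?F (\<phi> \<oplus>\<^bsub>?P\<^esub> \<psi>) = ?F \<phi> \<oplus>\<^bsub>N\<^esub> ?F \<psi>" if "\<phi> \<in> carrier ?P" "\<psi> \<in> carrier ?P" for \<phi> \<psi>
      using that Fadd by (simp add: pointwiseD[OF N(1)] pointwiseD[OF verma.P_pointwise])
    show "?F (c \<odot>\<^bsub>?P\<^esub> \<phi>) = c \<odot>\<^bsub>N\<^esub> ?F \<phi>" if "\<phi> \<in> carrier ?P" for c \<phi>
      using Fscale by (simp add: pointwiseD[OF N(1)] pointwiseD[OF verma.P_pointwise])
    show "(?F \<phi> = \<zero>\<^bsub>N\<^esub>) = (\<phi> \<in> ?K)" if "\<phi> \<in> carrier ?P" for \<phi>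
      using ker[OF that] by (simp add: pointwiseD[OF N(1)])
  qed (use Fact verma.P_act_closed in auto)
  then obtain f where f: "rep_iso takiff (quot_rep ?P ?K) N f" 
      "\<And>\<phi>. \<phi> \<in> carrier ?P \<Longrightarrow> f (?K +>\<^bsub>?P\<^esub> \<phi>) = ?F \<phi>" by blast
  have "f (verma_gen m mb) = ?F (?D (pb (0, 0)))"
    using f(2)[OF DP[of "(0, 0)"]] 
    by (simp add: verma_gen_def pure_tensor_def takiff.env_algebra_one pb_def)
  also have "\<dots> = v" using w[of "(0, 0)"] by (simp add: w_def)
  finally show ?thesis
    using f(1) unfolding is_verma_with_hwv_def verma_def induced_rep_def by blast
qed

section \<open>Commutation relations on polynomials\<close>

lemma const_p_simps [simp]:
  "const_p c * const_p d = const_p (c * d)" "const_p 0 = 0" "const_p 1 = 1"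
  "const_p c * (const_p d * p) = const_p (c * d) * p"
  "const_p c + const_p d = const_p (c + d)"
  "- const_p c = const_p (- c)"
  "pderiv (const_p c) = 0"
  by (simp_all add: const_p_def one_pCons mult.assoc[symmetric])

lemma const_p_numeral: "const_p (numeral n) = numeral n"
  by (simp add: const_p_def numeral_poly)

lemma coeff_shift_h [simp]: "coeff (shift_h c p) n = pcompose (coeff p n) [:c, 1:]"
  by (simp add: shift_h_def coeff_map_poly)

lemma shift_h_add [simp]: "shift_h c (p + q) = shift_h c p + shift_h c q"
  by (intro poly_eqI) (simp add: pcompose_add)

lemma shift_h_mult [simp]: "shift_h c (p * q) = shift_h c p * shift_h c q"
  by (intro poly_eqI) (simp add: coeff_mult pcompose_sum pcompose_mult)

lemma shift_h_const [simp]: "shift_h c (const_p d) = const_p d"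
  by (intro poly_eqI) (simp add: const_p_def coeff_pCons split: nat.split)

lemma shift_h_var_h [simp]: "shift_h c var_h = var_h + const_p c"
  by (intro poly_eqI) (simp add: var_h_def const_p_def coeff_pCons pcompose_pCons split: nat.split)

lemma shift_h_var_hbar [simp]: "shift_h c var_hbar = var_hbar"
  by (intro poly_eqI) (simp add: var_hbar_def coeff_pCons pcompose_1 split: nat.split)

lemma shift_h_shift_h [simp]: "shift_h c (shift_h d p) = shift_h (c + d) p"
  by (intro poly_eqI) (simp add: pcompose_assoc[symmetric] pcompose_pCons add.commute)

lemma shift_h_0 [simp]: "shift_h 0 p = p"
  by (intro poly_eqI) simp

lemma pderiv_shift_h [simp]: "pderiv (shift_h c p) = shift_h c (pderiv p)"
proof -
  have "pcompose (of_nat n * q) r = of_nat n * pcompose q r" for n and q r :: "complex poly"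
    by (simp add: of_nat_poly pcompose_smult)
  then show ?thesis by (intro poly_eqI) (simp add: coeff_pderiv del: of_nat_Suc)
qed

lemma pderiv_vars [simp]: "pderiv var_h = 0" "pderiv var_hbar = 1"
  by (simp_all add: var_h_def var_hbar_def pderiv_pCons)

context
  fixes lam a b :: complex
  assumes lam: "lam \<noteq> 0"
begin

text \<open>
  The functional equations behind the module \<open>Theta\<close>: shifting \<open>h\<close> and differentiating in \<open>h\<close>-bar commute,
  and a shift passes multiplication by \<open>h\<close> at the cost of a constant.
\<close>

lemma theta_relations:
  shows "theta_e lam a b (theta_f lam \<gamma>) - theta_f lam (theta_e lam a b \<gamma>) = var_h * \<gamma>" (is ?P1)
    "theta_e lam a b (theta_fbar lam \<gamma>) - theta_fbar lam (theta_e lam a b \<gamma>) = var_hbar * \<gamma>" (is ?P2)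
    "theta_ebar lam a (theta_f lam \<gamma>) - theta_f lam (theta_ebar lam a \<gamma>) = var_hbar * \<gamma>" (is ?P3)
    "theta_ebar lam a (theta_fbar lam \<gamma>) - theta_fbar lam (theta_ebar lam a \<gamma>) = 0" (is ?P4)
    "theta_e lam a b (theta_ebar lam a \<gamma>) - theta_ebar lam a (theta_e lam a b \<gamma>) = 0" (is ?P5)
    "theta_f lam (theta_fbar lam \<gamma>) - theta_fbar lam (theta_f lam \<gamma>) = 0" (is ?P6)
    "var_h * theta_e lam a b \<gamma> - theta_e lam a b (var_h * \<gamma>) = 2 * theta_e lam a b \<gamma>" (is ?P7)
    "var_h * theta_f lam \<gamma> - theta_f lam (var_h * \<gamma>) = - 2 * theta_f lam \<gamma>" (is ?P8)
    "var_h * theta_ebar lam a \<gamma> - theta_ebar lam a (var_h * \<gamma>) = 2 * theta_ebar lam a \<gamma>" (is ?P9)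
    "var_h * theta_fbar lam \<gamma> - theta_fbar lam (var_h * \<gamma>) = - 2 * theta_fbar lam \<gamma>" (is ?P10)
    "var_hbar * theta_e lam a b \<gamma> - theta_e lam a b (var_hbar * \<gamma>) = 2 * theta_ebar lam a \<gamma>" (is ?P11)
    "var_hbar * theta_f lam \<gamma> - theta_f lam (var_hbar * \<gamma>) = - 2 * theta_fbar lam \<gamma>" (is ?P12)
    "var_hbar * theta_ebar lam a \<gamma> - theta_ebar lam a (var_hbar * \<gamma>) = 0" (is ?P13)
    "var_hbar * theta_fbar lam \<gamma> - theta_fbar lam (var_hbar * \<gamma>) = 0" (is ?P14)
proof -
  \<comment> \<open>With \<open>q = 1 / (4 lam)\<close> and \<open>u = lam\<close> all constants in the formulas are integer multiples of \<open>q\<close> and \<open>u\<close>,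
    and the only relation between them is \<open>4 q u = 1\<close>. As opaque ring elements they keep the normalisation
    of polynomials from touching their values.\<close>
  define q u A B where "q = const_p (1 / (4 * lam))" and "u = const_p lam" 
    and "A = const_p a" and "B = const_p b"
  have qu: "4 * q * u = 1"
    using lam unfolding q_def u_def const_p_numeral[symmetric] by simp
  have c: "const_p (2 * lam) = 2 * u" "const_p (- (1 / (4 * lam))) = - q"
    "const_p (- (1 / (2 * lam))) = - 2 * q" "const_p (1 / (2 * lam)) = 2 * q" "const_p lam = u"
    "const_p 2 = 2" "const_p (- 2) = - 2"
    unfolding q_def u_def const_p_numeral[symmetric] by (simp_all del: const_p_simps(6) add: const_p_simps(6)[symmetric])
  have sh: "shift_h d q = q" "shift_h d u = u" "shift_h d A = A" "shift_h d B = B" 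
    "pderiv q = 0" "pderiv u = 0" "pderiv A = 0" "pderiv B = 0" for d
    by (simp_all add: q_def u_def A_def B_def)
  have num: "shift_h d 2 = 2" "pderiv (2 :: poly_hh) = 0" for d
    using shift_h_const[of d 2] const_p_simps(7)[of 2] unfolding const_p_numeral by simp_all
  have sm: "shift_h d (- p) = - shift_h d p" "shift_h d (p - p') = shift_h d p - shift_h d p'" for d p p'
    by (intro poly_eqI; simp add: pcompose_uminus pcompose_diff)+
  have F: "theta_f lam \<gamma> = 2 * u * pderiv (shift_h 2 \<gamma>)" for \<gamma>
    by (simp add: theta_f_def c)
  have Fb: "theta_fbar lam \<gamma> = u * shift_h 2 \<gamma>" for \<gamma>
    by (simp add: theta_fbar_def c)
  have Eb: "theta_ebar lam a \<gamma> = - q * (var_hbar * var_hbar + A) * shift_h (-2) \<gamma>" for \<gamma>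
    by (simp add: theta_ebar_def c A_def power2_eq_square)
  have E: "theta_e lam a b \<gamma> = - 2 * q * ((var_h - 2) * var_hbar + B) * shift_h (-2) \<gamma>
     + 2 * q * (var_hbar * var_hbar + A) * pderiv (shift_h (-2) \<gamma>)" for \<gamma>
    by (simp add: theta_e_def c A_def B_def power2_eq_square)
  note hom = shift_h_mult shift_h_add sm num sh shift_h_shift_h shift_h_var_h shift_h_var_hbar
      pderiv_mult pderiv_add pderiv_diff pderiv_minus pderiv_shift_h pderiv_vars c
      mult_zero_left mult_zero_right add_0_left add_0_right diff_0_right mult_1_right mult_1_left
      add.right_inverse add.left_inverse shift_h_0
  note op_eqs = F Fb Eb E
  have "theta_e lam a b (theta_f lam \<gamma>) - theta_f lam (theta_e lam a b \<gamma>) = 4 * q * u * (var_h * \<gamma>)"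
    by (simp only: op_eqs hom) (simp add: algebra_simps)
  then show ?P1
    by (simp only: qu mult_1)
  have "theta_e lam a b (theta_fbar lam \<gamma>) - theta_fbar lam (theta_e lam a b \<gamma>) = 4 * q * u * (var_hbar * \<gamma>)"
    by (simp only: op_eqs hom) (simp add: algebra_simps)
  then show ?P2
    by (simp only: qu mult_1)
  have "theta_ebar lam a (theta_f lam \<gamma>) - theta_f lam (theta_ebar lam a \<gamma>) = 4 * q * u * (var_hbar * \<gamma>)"
    by (simp only: op_eqs hom) (simp add: algebra_simps)
  then show ?P3
    by (simp only: qu mult_1)
  show ?P4
    by (simp only: op_eqs hom) (simp add: algebra_simps)
  show ?P5
    by (simp only: op_eqs hom) (simp add: algebra_simps)
  show ?P6
    by (simp only: op_eqs hom) (simp add: algebra_simps)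
  show ?P7
    by (simp only: op_eqs hom) (simp add: algebra_simps)
  show ?P8
    by (simp only: op_eqs hom) (simp add: algebra_simps)
  show ?P9
    by (simp only: op_eqs hom) (simp add: algebra_simps)
  show ?P10
    by (simp only: op_eqs hom) (simp add: algebra_simps)
  show ?P11
    by (simp only: op_eqs hom) (simp add: algebra_simps)
  show ?P12
    by (simp only: op_eqs hom) (simp add: algebra_simps)
  show ?P13
    by (simp only: op_eqs hom) (simp add: algebra_simps)
  show ?P14
    by (simp only: op_eqs hom) (simp add: algebra_simps)
qed

end

section \<open>Derivatives at a point\<close>

text \<open>
  The expansion of \<open>\<gamma>\<close> in powers of \<open>h\<close>-bar \<open>- y\<close>, with coefficients that are polynomials in \<open>h\<close>.
\<close>

definition taylor :: "complex \<Rightarrow> poly_hh \<Rightarrow> poly_hh" where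
  "taylor y \<gamma> = pcompose \<gamma> [:[:y:], 1:]"

text \<open>
  The derivative of order \<open>j\<close> in \<open>h\<close>-bar at the point \<open>(x, y)\<close>, expressed by a Taylor coefficient since
  this makes the values on products of powers immediate.
\<close>

definition point_deriv :: "complex \<Rightarrow> complex \<Rightarrow> nat \<Rightarrow> poly_hh \<Rightarrow> complex" where
  "point_deriv x y j \<gamma> = fact j * poly (coeff (taylor y \<gamma>) j) x"

lemma taylor_simps:
  "taylor y (p + q) = taylor y p + taylor y q"
  "taylor y (p * q) = taylor y p * taylor y q"
  "taylor y (p ^ n) = taylor y p ^ n"
  "taylor y [:r:] = [:r:]"
  "taylor y var_hbar = [:[:y:], 1:]"
  "taylor y (pderiv p) = pderiv (taylor y p)"
proof -
  show "taylor y (p ^ n) = taylor y p ^ n"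
    by (induction n) (simp_all add: taylor_def pcompose_mult pcompose_1)
qed (simp_all add: taylor_def pcompose_add pcompose_mult var_hbar_def pderiv_pcompose pderiv_pCons pcompose_pCons)

lemma taylor_shift_h: "taylor y (shift_h c p) = shift_h c (taylor y p)"
proof (induction p)
  case (pCons r p)
  have s: "shift_h c (pCons r p) = [:pcompose r [:c, 1:]:] + var_hbar * shift_h c p" for r p
    by (intro poly_eqI) (simp add: var_hbar_def coeff_pCons split: nat.split)
  have t: "taylor y (pCons r p) = [:r:] + [:[:y:], 1:] * taylor y p" for r p
    by (simp add: taylor_def pcompose_pCons)
  have k: "shift_h c [:r:] = [:pcompose r [:c, 1:]:]" for r
    by (intro poly_eqI) (simp add: coeff_pCons split: nat.split)
  have l: "shift_h c [:[:y:], 1:] = [:[:y:], 1:]"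
    by (intro poly_eqI) (simp add: coeff_pCons pcompose_1 split: nat.split)
  have "taylor y (shift_h c (pCons r p)) = [:pcompose r [:c, 1:]:] + [:[:y:], 1:] * shift_h c (taylor y p)"
    by (simp only: s[of r p] taylor_simps pCons.IH)
  also have "\<dots> = shift_h c (taylor y (pCons r p))"
    by (simp only: t[of r p] shift_h_add shift_h_mult k l)
  finally show ?case .
qed (simp add: taylor_def shift_h_def)

lemma point_deriv_add: "point_deriv x y j (p + q) = point_deriv x y j p + point_deriv x y j q"
  by (simp add: point_deriv_def taylor_simps ring_distribs)

lemma point_deriv_poly_h: "point_deriv x y j ([:r:] * p) = poly r x * point_deriv x y j p"
  by (simp add: point_deriv_def taylor_def pcompose_smult)

lemma point_deriv_scale: "point_deriv x y j (const_p c * p) = c * point_deriv x y j p"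
  unfolding const_p_def by (simp only: point_deriv_poly_h) simp

lemma point_deriv_uminus: "point_deriv x y j (- p) = - point_deriv x y j p"
  using point_deriv_scale[of x y j "-1" p] unfolding const_p_simps(6)[symmetric] by simp

lemma point_deriv_diff: "point_deriv x y j (p - q) = point_deriv x y j p - point_deriv x y j q"
  using point_deriv_add[of x y j p "- q"] by (simp add: point_deriv_uminus)

lemma point_deriv_var_h: "point_deriv x y j (var_h * p) = x * point_deriv x y j p"
  unfolding var_h_def by (simp only: point_deriv_poly_h) simp

text \<open>
  The Leibniz rule for multiplication by \<open>h\<close>-bar. For \<open>j = 0\<close> the index \<open>j - 1\<close> has coefficient zero.
\<close>

lemma point_deriv_var_hbar: "point_deriv x y j (var_hbar * p) = y * point_deriv x y j p + of_nat j * point_deriv x y (j - 1) p"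
  by (cases j) (simp_all add: point_deriv_def taylor_simps coeff_pCons algebra_simps)

lemma point_deriv_pderiv: "point_deriv x y j (pderiv p) = point_deriv x y (Suc j) p"
  by (simp add: point_deriv_def taylor_simps coeff_pderiv algebra_simps)

lemma point_deriv_shift_h: "point_deriv x y j (shift_h c p) = point_deriv (x + c) y j p"
  by (simp add: point_deriv_def taylor_shift_h poly_pcompose add.commute)

lemma point_deriv_dual_basis:
  "point_deriv x y j ([:r:] * (var_hbar - const_p y) ^ i) = (if i = j then fact j * poly r x else 0)"
proof -
  have "taylor y (var_hbar - const_p y) = monom 1 1"
    by (simp add: taylor_def var_hbar_def const_p_def pcompose_pCons monom_altdef)
  then have "taylor y ((var_hbar - const_p y) ^ i) = monom 1 i"
    by (simp add: taylor_simps monom_power)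
  then have "point_deriv x y j ((var_hbar - const_p y) ^ i) = (if i = j then fact j else 0)"
    by (simp add: point_deriv_def)
  then show ?thesis by (simp only: point_deriv_poly_h) simp
qed

text \<open>
  The products \<open>(h - x)^i (h-bar - y)^j\<close> span all polynomials: divide by \<open>h-bar - y\<close> repeatedly, and
  divide each remainder, a polynomial in \<open>h\<close>, repeatedly by \<open>h - x\<close>.
\<close>

lemma functional_unique:
  fixes \<psi> :: "poly_hh \<Rightarrow> complex"
  assumes add: "\<And>p q. \<psi> (p + q) = \<psi> p + \<psi> q"
    and scale: "\<And>c p. \<psi> (const_p c * p) = c * \<psi> p"
    and zero: "\<And>i j. \<psi> ((var_h - const_p x) ^ i * (var_hbar - const_p y) ^ j) = 0"
  shows "\<psi> p = 0"
proof -
  have vh: "var_h - const_p x = [:[:-x, 1:]:]" by (simp add: var_h_def const_p_def)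
  have vb: "var_hbar - const_p y = [:[:-y:], 1:]" by (simp add: var_hbar_def const_p_def)
  have 1: "\<psi> ((var_h - const_p x) ^ i * (var_hbar - const_p y) ^ j * [:r:]) = 0" 
    if "degree r < n" for i j r n
    using that
  proof (induction n arbitrary: i r)
    case (Suc n)
    have "r = [:poly r x:] + [:-x, 1:] * synthetic_div r x"
      using synthetic_div_correct'[of x r] by (simp only: add.commute)
    then have "[:r:] = [:[:poly r x:] + [:-x, 1:] * synthetic_div r x:]" by (rule arg_cong)
    also have "\<dots> = const_p (poly r x) + (var_h - const_p x) * [:synthetic_div r x:]"
      unfolding vh by (simp add: const_p_def)
    finally have "[:r:] = const_p (poly r x) + (var_h - const_p x) * [:synthetic_div r x:]" .
    then have "(var_h - const_p x) ^ i * (var_hbar - const_p y) ^ j * [:r:] =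
        const_p (poly r x) * ((var_h - const_p x) ^ i * (var_hbar - const_p y) ^ j) +
        (var_h - const_p x) ^ Suc i * (var_hbar - const_p y) ^ j * [:synthetic_div r x:]"
      by (simp only: power_Suc) (simp only: algebra_simps)
    moreover have "\<psi> ((var_h - const_p x) ^ Suc i * (var_hbar - const_p y) ^ j * [:synthetic_div r x:]) = 0"
    proof (cases n)
      case 0
      then have "synthetic_div r x = 0" using Suc.prems by (simp add: synthetic_div_eq_0_iff)
      then show ?thesis using scale[of 0 0] by simp
    next
      case (Suc n')
      then show ?thesis using Suc.prems by (intro Suc.IH) (simp add: degree_synthetic_div)
    qed
    ultimately show ?case by (simp add: add scale zero)
  qed simp
  have 2: "\<psi> ((var_hbar - const_p y) ^ j * r) = 0" if "degree r < n" for j r n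
    using that
  proof (induction n arbitrary: j r)
    case (Suc n)
    have "r = [:poly r [:y:]:] + (var_hbar - const_p y) * synthetic_div r [:y:]"
      using synthetic_div_correct'[of "[:y:]" r] by (simp add: vb add.commute)
    moreover have "D ^ j * r = H ^ 0 * D ^ j * R + D ^ Suc j * S" if "r = R + D * S" for r R D S H :: poly_hh
      using that by (simp add: algebra_simps)
    ultimately have "(var_hbar - const_p y) ^ j * r = 
        (var_h - const_p x) ^ 0 * (var_hbar - const_p y) ^ j * [:poly r [:y:]:] +
        (var_hbar - const_p y) ^ Suc j * synthetic_div r [:y:]"
      by blast
    moreover have "\<psi> ((var_hbar - const_p y) ^ Suc j * synthetic_div r [:y:]) = 0"
    proof (cases n)
      case 0
      then have "synthetic_div r [:y:] = 0" using Suc.prems by (simp add: synthetic_div_eq_0_iff)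
      then show ?thesis using scale[of 0 0] by simp
    next
      case (Suc n')
      then show ?thesis using Suc.prems by (intro Suc.IH) (simp add: degree_synthetic_div)
    qed
    ultimately show ?case using 1[where r = "poly r [:y:]" and i = 0 and j = j, OF lessI] by (simp only: add) simp
  qed simp
  from 2[where r = p and j = 0, OF lessI] show ?thesis by simp
qed

text \<open>
  The functional of order \<open>s - 1\<close> has the prescribed values, and these determine a linear functional.
  This identifies the description by a unique choice.
\<close>

lemma eta_eq_point_deriv:
  assumes "s \<ge> 1"
  shows "eta x y s = point_deriv x y (s - 1)"
proof -
  have val: "point_deriv x y j ((var_h - const_p x) ^ i * (var_hbar - const_p y) ^ i') =
      (if i = 0 \<and> i' = j then fact j else 0)" for i i' j
  proof -
    have "(var_h - const_p x) ^ i = [:[:-x, 1:] ^ i:]"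
      by (induction i) (simp_all add: var_h_def const_p_def one_pCons)
    then show ?thesis by (simp only: point_deriv_dual_basis) (auto simp: poly_power)
  qed
  show ?thesis
    unfolding eta_def
  proof (rule the_equality)
    fix \<phi> assume \<phi>: "(\<forall>p q. \<phi> (p + q) = \<phi> p + \<phi> q) \<and> (\<forall>c p. \<phi> (const_p c * p) = c * \<phi> p) \<and>
       (\<forall>i j. \<phi> ((var_h - const_p x) ^ i * (var_hbar - const_p y) ^ j) =
        (if i = 0 \<and> j = s - 1 then fact (s - 1) else 0))"
    have "\<phi> p - point_deriv x y (s - 1) p = 0" for p
      by (rule functional_unique[of "\<lambda>p. \<phi> p - point_deriv x y (s - 1) p" x y])
        (use \<phi> in \<open>simp_all add: point_deriv_add point_deriv_scale val right_diff_distrib\<close>)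
    then show "\<phi> = point_deriv x y (s - 1)" by (simp add: fun_eq_iff)
  qed (auto simp: point_deriv_add point_deriv_scale val)
qed

section \<open>Theta and its dual as Lie modules\<close>

lemma theta_linear:
  "theta_e lam a b (p + q) = theta_e lam a b p + theta_e lam a b q"
  "theta_f lam (p + q) = theta_f lam p + theta_f lam q"
  "theta_ebar lam a (p + q) = theta_ebar lam a p + theta_ebar lam a q"
  "theta_fbar lam (p + q) = theta_fbar lam p + theta_fbar lam q"
  "theta_e lam a b (const_p c * p) = const_p c * theta_e lam a b p"
  "theta_f lam (const_p c * p) = const_p c * theta_f lam p"
  "theta_ebar lam a (const_p c * p) = const_p c * theta_ebar lam a p"
  "theta_fbar lam (const_p c * p) = const_p c * theta_fbar lam p"
  by (simp_all add: theta_e_def theta_f_def theta_ebar_def theta_fbar_def pderiv_add pderiv_mult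
      distrib_left mult.left_commute del: const_p_simps(1,4))

lemma Theta_simps:
  "carrier (Theta lam a b) = UNIV" "zero (Theta lam a b) = 0" "add (Theta lam a b) = (+)"
  "smult (Theta lam a b) = (\<lambda>c \<gamma>. const_p c * \<gamma>)"
  "act (Theta lam a b) (A, B) \<gamma> = const_p (A $ 1 $ 2) * theta_e lam a b \<gamma> + const_p (A $ 1 $ 1) * (var_h * \<gamma>)
        + const_p (A $ 2 $ 1) * theta_f lam \<gamma>
        + const_p (B $ 1 $ 2) * theta_ebar lam a \<gamma> + const_p (B $ 1 $ 1) * (var_hbar * \<gamma>)
        + const_p (B $ 2 $ 1) * theta_fbar lam \<gamma>"
  by (simp_all add: Theta_def)

lemma Theta_act_basis:
  "act (Theta lam a b) e_el \<gamma> = theta_e lam a b \<gamma>"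
  "act (Theta lam a b) h_el \<gamma> = var_h * \<gamma>"
  "act (Theta lam a b) f_el \<gamma> = theta_f lam \<gamma>"
  "act (Theta lam a b) ebar_el \<gamma> = theta_ebar lam a \<gamma>"
  "act (Theta lam a b) hbar_el \<gamma> = var_hbar * \<gamma>"
  "act (Theta lam a b) fbar_el \<gamma> = theta_fbar lam \<gamma>"
  by (simp_all add: basis_defs Theta_simps vector_2)

lemma Theta_module: "Module.module cplx (Theta lam a b)"
proof -
  have "abelian_group (Theta lam a b)"
    by (intro abelian_groupI) (auto simp: Theta_simps add_ac intro: exI[of _ "- x" for x])
  then show ?thesis
    by (intro module.intro cring_cplx module_axioms.intro)
      (simp_all add: Theta_simps distrib_left distrib_right flip: const_p_simps(5))
qed

lemma Theta_minus: "p \<ominus>\<^bsub>Theta lam a b\<^esub> q = p - q"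
proof -
  interpret module cplx "Theta lam a b" by (rule Theta_module)
  have "\<ominus>\<^bsub>Theta lam a b\<^esub> q = - q"
    by (rule M.minus_equality) (simp_all add: Theta_simps)
  then show ?thesis by (simp add: a_minus_def Theta_simps)
qed

lemma Theta_act_linear:
  "act (Theta lam a b) x (p + q) = act (Theta lam a b) x p + act (Theta lam a b) x q" (is ?P1)
  "act (Theta lam a b) x (const_p c * p) = const_p c * act (Theta lam a b) x p" (is ?P2)
  "act (Theta lam a b) (x \<oplus>\<^bsub>takiff\<^esub> y) p = act (Theta lam a b) x p + act (Theta lam a b) y p" (is ?P3)
  "act (Theta lam a b) (c \<odot>\<^bsub>takiff\<^esub> x) p = const_p c * act (Theta lam a b) x p" (is ?P4)
proof -
  obtain A B A' B' where xy: "x = (A, B)" "y = (A', B')" by fastforce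
  show ?P1
    by (simp add: xy Theta_simps theta_linear distrib_left)
  show ?P2
    by (simp only: xy Theta_simps theta_linear distrib_left mult.left_commute)
  show ?P3
    by (simp add: xy Theta_simps takiff_simps distrib_right flip: const_p_simps(5))
  show ?P4
    by (simp add: xy Theta_simps takiff_simps distrib_left)
qed

lemma bracket_bilinear:
  "bracket takiff (x \<oplus>\<^bsub>takiff\<^esub> x') y = bracket takiff x y \<oplus>\<^bsub>takiff\<^esub> bracket takiff x' y"
  "bracket takiff y (x \<oplus>\<^bsub>takiff\<^esub> x') = bracket takiff y x \<oplus>\<^bsub>takiff\<^esub> bracket takiff y x'"
  "bracket takiff (c \<odot>\<^bsub>takiff\<^esub> x) y = c \<odot>\<^bsub>takiff\<^esub> bracket takiff x y"
  "bracket takiff y (c \<odot>\<^bsub>takiff\<^esub> x) = c \<odot>\<^bsub>takiff\<^esub> bracket takiff y x"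
  "bracket takiff x y = (-1) \<odot>\<^bsub>takiff\<^esub> bracket takiff y x"
  by (cases x; cases x'; cases y; 
      simp add: takiff_simps vec_eq_iff forall_2 commutator_entries algebra_simps)+

lemma brackets_all:
  "bracket takiff h_el e_el = 2 \<odot>\<^bsub>takiff\<^esub> e_el"
  "bracket takiff h_el f_el = (-2) \<odot>\<^bsub>takiff\<^esub> f_el"
  "bracket takiff h_el ebar_el = 2 \<odot>\<^bsub>takiff\<^esub> ebar_el"
  "bracket takiff h_el fbar_el = (-2) \<odot>\<^bsub>takiff\<^esub> fbar_el"
  "bracket takiff h_el hbar_el = 0 \<odot>\<^bsub>takiff\<^esub> e_el"
  "bracket takiff hbar_el e_el = 2 \<odot>\<^bsub>takiff\<^esub> ebar_el"
  "bracket takiff hbar_el f_el = (-2) \<odot>\<^bsub>takiff\<^esub> fbar_el"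
  "bracket takiff hbar_el ebar_el = 0 \<odot>\<^bsub>takiff\<^esub> e_el"
  "bracket takiff hbar_el fbar_el = 0 \<odot>\<^bsub>takiff\<^esub> e_el"
  "bracket takiff e_el f_el = 1 \<odot>\<^bsub>takiff\<^esub> h_el"
  "bracket takiff e_el fbar_el = 1 \<odot>\<^bsub>takiff\<^esub> hbar_el"
  "bracket takiff e_el ebar_el = 0 \<odot>\<^bsub>takiff\<^esub> e_el"
  "bracket takiff ebar_el f_el = 1 \<odot>\<^bsub>takiff\<^esub> hbar_el"
  "bracket takiff ebar_el fbar_el = 0 \<odot>\<^bsub>takiff\<^esub> e_el"
  "bracket takiff f_el fbar_el = 0 \<odot>\<^bsub>takiff\<^esub> e_el"
  "bracket takiff x x = 0 \<odot>\<^bsub>takiff\<^esub> x"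
  by (cases x; simp add: basis_defs takiff_simps vec_eq_iff forall_2 vector_2 commutator_entries)+

text \<open>
  Both sides are bilinear in \<open>x\<close> and \<open>y\<close> and antisymmetric, which leaves the fifteen pairs of distinct
  basis elements.
\<close>

lemma Theta_bracket:
  assumes lam: "lam \<noteq> 0" and "x \<in> carrier takiff" "y \<in> carrier takiff"
  shows "act (Theta lam a b) (bracket takiff x y) \<gamma> = 
    act (Theta lam a b) x (act (Theta lam a b) y \<gamma>) - act (Theta lam a b) y (act (Theta lam a b) x \<gamma>)"
proof -
  let ?C = "\<lambda>x y. \<forall>\<gamma>. act (Theta lam a b) (bracket takiff x y) \<gamma> = 
    act (Theta lam a b) x (act (Theta lam a b) y \<gamma>) - act (Theta lam a b) y (act (Theta lam a b) x \<gamma>)"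
  have m1: "const_p (-1) * p = - p" for p by (simp flip: const_p_simps(6))
  have sym: "?C y x" if "?C x y" for x y
    using that by (subst bracket_bilinear(5)) (simp add: Theta_act_linear m1)
  have two: "const_p 2 = 2" "const_p (-2) = -2"
    using const_p_numeral[of "num.Bit0 num.One"] by (simp_all flip: const_p_simps(6))
  have C: "?C h_el e_el" "?C h_el f_el" "?C h_el ebar_el" "?C h_el fbar_el" "?C h_el hbar_el"
    "?C hbar_el e_el" "?C hbar_el f_el" "?C hbar_el ebar_el" "?C hbar_el fbar_el"
    "?C e_el f_el" "?C e_el fbar_el" "?C e_el ebar_el" "?C ebar_el f_el" "?C ebar_el fbar_el" 
    "?C f_el fbar_el"
    by (simp_all only: brackets_all Theta_act_linear Theta_act_basis two const_p_simps mult_zero_left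
        mult_1 theta_relations[OF lam]) (simp_all add: mult.left_commute)
  have diag: "?C x x" for x by (simp add: brackets_all Theta_act_linear)
  note all = C C[THEN sym] diag
  have one: "?C z y" if "?C z e_el" "?C z h_el" "?C z f_el" "?C z ebar_el" "?C z hbar_el" "?C z fbar_el" 
    "y \<in> carrier takiff" for z y
    by (rule takiff_induct[OF that(7), of "\<lambda>y. ?C z y"], fact that, fact that, fact that, 
        fact that, fact that, fact that)
      (simp_all add: bracket_bilinear(2,4) Theta_act_linear right_diff_distrib add_diff_add del: const_p_simps)
  have "?C x y"
    by (rule takiff_induct[OF assms(2), of "\<lambda>x. ?C x y"]; (rule one; (fact all | fact assms(3)))?)
      (simp_all add: bracket_bilinear(1,3) Theta_act_linear right_diff_distrib add_diff_add del: const_p_simps)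
  then show ?thesis by blast
qed

lemma Theta_lie_module:
  assumes "lam \<noteq> 0"
  shows "lie_module takiff (Theta lam a b)"
  using Theta_module Theta_bracket[OF assms]
  by (simp add: lie_module_def Theta_simps(1-4) Theta_minus Theta_act_linear)

abbreviation Dual where "Dual lam a b \<equiv> dual_rep (Theta lam a b)"

lemma Dual_act: "act (Dual lam a b) x \<phi> = (\<lambda>\<gamma>. - \<phi> (act (Theta lam a b) x \<gamma>))"
  by (simp add: dual_rep_def Theta_simps restrict_def)

lemma Dual_pointwise: "pointwise (Dual lam a b)"
  by (rule dual_rep_pointwise) (rule Theta_simps)

lemma Dual_lie_module: "lam \<noteq> 0 \<Longrightarrow> lie_module takiff (Dual lam a b)"
  by (rule lie_module_dual_rep[OF Theta_lie_module]) (simp_all add: Theta_simps)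

lemma point_deriv_Dual: "point_deriv x y j \<in> carrier (Dual lam a b)"
  by (simp add: dual_rep_def Theta_simps point_deriv_add point_deriv_scale)

text \<open>
  The formulas of \<open>Theta\<close> transposed. Multiplication by \<open>h\<close>-bar becomes lowering of \<open>j\<close>, differentiation
  becomes raising, and a shift of \<open>h\<close> moves the point.
\<close>

lemma Dual_act_point_deriv:
  assumes "lam \<noteq> 0"
  shows "act (Dual lam a b) h_el (point_deriv x y j) = fscale (- x) (point_deriv x y j)" (is ?P1)
    "act (Dual lam a b) hbar_el (point_deriv x y j) = fscale (- y) (point_deriv x y j) + fscale (- of_nat j) (point_deriv x y (j - 1))" (is ?P2)
    "act (Dual lam a b) f_el (point_deriv x y j) = fscale (- 2 * lam) (point_deriv (x + 2) y (Suc j))" (is ?P3)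
    "act (Dual lam a b) fbar_el (point_deriv x y j) = fscale (- lam) (point_deriv (x + 2) y j)" (is ?P4)
    "act (Dual lam a b) ebar_el (point_deriv x y j) = fscale (1 / (4 * lam)) (fscale (y\<^sup>2 + a) (point_deriv (x - 2) y j) + 
       fscale (2 * y * of_nat j) (point_deriv (x - 2) y (j - 1)) + 
       fscale (of_nat j * of_nat (j - 1)) (point_deriv (x - 2) y (j - 2)))" (is ?P5)
    "act (Dual lam a b) e_el (point_deriv x y j) = fscale (1 / (2 * lam)) (fscale (- (y\<^sup>2 + a)) (point_deriv (x - 2) y (Suc j)) + 
       fscale ((x - 2 * of_nat (Suc j)) * y + b) (point_deriv (x - 2) y j) + 
       fscale (of_nat j * (x - of_nat (Suc j))) (point_deriv (x - 2) y (j - 1)))" (is ?P6)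
proof -
  have sq: "(var_hbar\<^sup>2 + const_p a) * p = var_hbar * (var_hbar * p) + const_p a * p" for p
    by (simp add: power2_eq_square algebra_simps)
  have hh: "((var_h - const_p 2) * var_hbar + const_p b) * p = 
      var_h * (var_hbar * p) - const_p 2 * (var_hbar * p) + const_p b * p" for p
    by (simp add: algebra_simps)
  note et = point_deriv_add point_deriv_diff point_deriv_scale point_deriv_var_h point_deriv_var_hbar point_deriv_pderiv point_deriv_shift_h mult.assoc sq hh
  show ?P1
    by (simp add: fun_eq_iff Dual_act Theta_act_basis point_deriv_var_h)
  show ?P2
    by (simp add: fun_eq_iff Dual_act Theta_act_basis point_deriv_var_hbar)
  show ?P3
    by (simp add: fun_eq_iff Dual_act Theta_act_basis theta_f_def et del: pderiv_shift_h)
  show ?P4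
    by (simp add: fun_eq_iff Dual_act Theta_act_basis theta_fbar_def et)
  have "act (Dual lam a b) ebar_el (point_deriv x y j) \<gamma> = 1 / (4 * lam) * ((y\<^sup>2 + a) * point_deriv (x - 2) y j \<gamma> + 
       2 * y * of_nat j * point_deriv (x - 2) y (j - 1) \<gamma> + 
       of_nat j * of_nat (j - 1) * point_deriv (x - 2) y (j - 2) \<gamma>)" for \<gamma>
    unfolding Dual_act Theta_act_basis theta_ebar_def et
    using assms by (simp add: field_simps power2_eq_square numeral_2_eq_2)
  then show ?P5
    by (simp add: fun_eq_iff)
  have j: "j = 0 \<or> j = 1 \<or> (\<exists>n. j = Suc (Suc n))" by (metis One_nat_def not0_implies_Suc)
  have "act (Dual lam a b) e_el (point_deriv x y j) \<gamma> = 1 / (2 * lam) * (- (y\<^sup>2 + a) * point_deriv (x - 2) y (Suc j) \<gamma> + 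
       ((x - 2 * of_nat (Suc j)) * y + b) * point_deriv (x - 2) y j \<gamma> + 
       of_nat j * (x - of_nat (Suc j)) * point_deriv (x - 2) y (j - 1) \<gamma>)" for \<gamma>
    using j unfolding Dual_act Theta_act_basis theta_e_def et
    using assms by (auto simp: field_simps power2_eq_square)
  then show ?P6
    by (simp add: fun_eq_iff)
qed

section \<open>Coordinates with respect to an independent family\<close>

text \<open>
  Independence is stated for coefficient functions, so that \<open>coord\<close> is a linear inverse of \<open>lin_ext g\<close>
  on the span of the family.
\<close>

locale fun_basis =
  fixes g :: "'i \<Rightarrow> 'a \<Rightarrow> complex"
  assumes independent: "\<And>c. c \<in> fin_supp UNIV \<Longrightarrow> lin_ext g c = 0 \<Longrightarrow> c = 0"
begin

definition coord where "coord v = inv_into (fin_supp UNIV) (lin_ext g) v"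

lemma inj: "inj_on (lin_ext g) (fin_supp UNIV)"
proof (rule inj_onI)
  fix c d assume cd: "c \<in> fin_supp UNIV" "d \<in> fin_supp UNIV" "lin_ext g c = lin_ext g d"
  then have "lin_ext g (c - d) = 0"
    using lin_ext_diff[OF cd(1,2), of g] by simp
  then have "c - d = 0"
    by (rule independent[OF fv.subspace_diff[OF fin_supp_subspace cd(1,2)]])
  then show "c = d" by simp
qed

lemma coord_lin_ext [simp]: "c \<in> fin_supp UNIV \<Longrightarrow> coord (lin_ext g c) = c"
  unfolding coord_def by (rule inv_into_f_f[OF inj])

lemma span_eq: "fv.span (range g) = lin_ext g ` fin_supp UNIV"
proof
  have "fv.subspace (lin_ext g ` fin_supp UNIV)"
    unfolding fv.subspace_def
  proof (intro conjI ballI allI)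
    show "0 \<in> lin_ext g ` fin_supp UNIV"
      using fv.subspace_0[OF fin_supp_subspace] by (intro image_eqI[of _ _ 0]) simp_all
    show "x + y \<in> lin_ext g ` fin_supp UNIV" 
      if "x \<in> lin_ext g ` fin_supp UNIV" "y \<in> lin_ext g ` fin_supp UNIV" for x y
      using that lin_ext_add[symmetric] fv.subspace_add[OF fin_supp_subspace] by fast
    show "fscale c x \<in> lin_ext g ` fin_supp UNIV" if "x \<in> lin_ext g ` fin_supp UNIV" for c x
      using that lin_ext_scale[symmetric] fv.subspace_scale[OF fin_supp_subspace] by fast
  qed
  moreover have "g t \<in> lin_ext g ` fin_supp UNIV" for t
    by (rule image_eqI[of _ _ "delta t"]) simp_all
  ultimately show "fv.span (range g) \<subseteq> lin_ext g ` fin_supp UNIV" by (intro fv.span_minimal) auto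
  show "lin_ext g ` fin_supp UNIV \<subseteq> fv.span (range g)"
    by (intro image_subsetI lin_ext_in_subspace[OF fv.subspace_span]) (simp_all add: fv.span_base)
qed

lemma coord_fin_supp: "v \<in> fv.span (range g) \<Longrightarrow> coord v \<in> fin_supp UNIV"
  by (auto simp: span_eq)

lemma lin_ext_coord: "v \<in> fv.span (range g) \<Longrightarrow> lin_ext g (coord v) = v"
  by (auto simp: span_eq)

lemma coord_add:
  assumes "v \<in> fv.span (range g)" "w \<in> fv.span (range g)"
  shows "coord (v + w) = coord v + coord w"
  using assms unfolding span_eq
  by (auto simp: lin_ext_add[symmetric] fv.subspace_add[OF fin_supp_subspace])

lemma coord_scale:
  assumes "v \<in> fv.span (range g)"
  shows "coord (fscale c v) = fscale c (coord v)"
  using assms unfolding span_eq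
  by (auto simp: lin_ext_scale[symmetric] fv.subspace_scale[OF fin_supp_subspace])

lemma coord_diff:
  assumes "v \<in> fv.span (range g)" "w \<in> fv.span (range g)"
  shows "coord (v - w) = coord v - coord w"
  using assms unfolding span_eq
  by (auto simp: lin_ext_diff[symmetric] fv.subspace_diff[OF fin_supp_subspace])

lemma coord_basis [simp]: "coord (g t) = delta t"
  using coord_lin_ext[of "delta t"] by simp

lemma coord_zero [simp]: "coord 0 = 0"
  using coord_lin_ext[OF fv.subspace_0[OF fin_supp_subspace]] by simp

lemma coord_eq_0_iff: "v \<in> fv.span (range g) \<Longrightarrow> coord v = 0 \<longleftrightarrow> v = 0"
  using lin_ext_coord[of v] by auto

text \<open>
  A subspace spanned by part of the family consists of the vectors with coordinates supported there.
\<close>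

lemma span_image_iff:
  "v \<in> fv.span (g ` I) \<longleftrightarrow> v \<in> fv.span (range g) \<and> (\<forall>t. coord v t \<noteq> 0 \<longrightarrow> t \<in> I)"
proof
  let ?V = "{v \<in> fv.span (range g). \<forall>t. coord v t \<noteq> 0 \<longrightarrow> t \<in> I}"
  have "fv.subspace ?V"
    unfolding fv.subspace_def mem_Collect_eq
  proof (intro conjI ballI allI impI)
    show "0 \<in> fv.span (range g)" by (rule fv.span_zero)
    show "t \<in> I" if "coord 0 t \<noteq> 0" for t using that by simp
    fix x y assume xy: "x \<in> ?V" 
       "y \<in> ?V"
    then show "x + y \<in> fv.span (range g)" by (auto intro: fv.span_add)
    show "t \<in> I" if "coord (x + y) t \<noteq> 0" for t using that xy by (cases "coord x t = 0") (auto simp: coord_add)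
  next
    fix c x assume x: "x \<in> ?V"
    then show "fscale c x \<in> fv.span (range g)" by (auto intro: fv.span_scale)
    show "t \<in> I" if "coord (fscale c x) t \<noteq> 0" for t using that x by (auto simp: coord_scale)
  qed
  moreover have "g ` I \<subseteq> ?V"
    by (auto simp: delta_def intro: fv.span_base split: if_splits)
  ultimately have "fv.span (g ` I) \<subseteq> ?V"
    by (rule fv.span_minimal[rotated])
  then show "v \<in> fv.span (range g) \<and> (\<forall>t. coord v t \<noteq> 0 \<longrightarrow> t \<in> I)" if "v \<in> fv.span (g ` I)"
    using that by blast
  assume v: "v \<in> fv.span (range g) \<and> (\<forall>t. coord v t \<noteq> 0 \<longrightarrow> t \<in> I)"
  then have "coord v \<in> fin_supp I" using coord_fin_supp[of v] by (auto simp: fin_supp_def)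
  then have "lin_ext g (coord v) \<in> fv.span (g ` I)"
    by (rule lin_ext_in_subspace[OF fv.subspace_span]) (auto intro: fv.span_base)
  then show "v \<in> fv.span (g ` I)" using v lin_ext_coord by simp
qed

end

text \<open>
  The index \<open>j\<close> counts derivatives and is one less than the index \<open>s\<close> of \<open>eta\<close>.
\<close>

definition bas :: "complex \<Rightarrow> complex \<Rightarrow> int \<times> nat \<Rightarrow> poly_hh \<Rightarrow> complex" where
  "bas \<alpha> \<beta> = (\<lambda>(k, j). point_deriv (alpha_at \<alpha> k) \<beta> j)"

lemma alpha_at_inj: "alpha_at \<alpha> k = alpha_at \<alpha> l \<longleftrightarrow> k = l"
  by (simp add: alpha_at_def)

interpretation bas: fun_basis "bas \<alpha> \<beta>" for \<alpha> \<beta>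
proof
  fix c :: "int \<times> nat \<Rightarrow> complex" assume c: "c \<in> fin_supp UNIV" "lin_ext (bas \<alpha> \<beta>) c = 0"
  let ?T = "{t. c t \<noteq> 0}"
  have T: "finite ?T" using c by (simp add: fin_supp_def)
  have "c (k, j) = 0" for k j
  proof -
    \<comment> \<open>A polynomial dual to the basis element with index \<open>(k, j)\<close> among those that occur in the relation: its
      factor in \<open>h\<close> vanishes at all other points, and the power of \<open>h\<close>-bar \<open>- \<beta>\<close> selects the order \<open>j\<close>.\<close>
    define r where "r = (\<Prod>l\<in>fst ` ?T - {k}. [:- alpha_at \<alpha> l, 1:])"
    have r: "poly r (alpha_at \<alpha> l) = 0 \<longleftrightarrow> l \<in> fst ` ?T - {k}" for l
      using T by (simp add: r_def poly_prod alpha_at_inj)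
    let ?p = "[:r:] * (var_hbar - const_p \<beta>) ^ j"
    have "0 = lin_ext (bas \<alpha> \<beta>) c ?p" by (simp add: c)
    also have "\<dots> = (\<Sum>t\<in>?T. c t * bas \<alpha> \<beta> t ?p)" by (simp add: lin_ext_def sum_fun_apply)
    also have "\<dots> = (\<Sum>t\<in>?T. if t = (k, j) then c (k, j) * (fact j * poly r (alpha_at \<alpha> k)) else 0)"
    proof (rule sum.cong[OF refl])
      fix t assume t: "t \<in> ?T"
      obtain l i where li: "t = (l, i)" by fastforce
      have "l \<in> fst ` ?T" using t li by force
      then have "poly r (alpha_at \<alpha> l) = 0" if "l \<noteq> k" using r[of l] that by simp
      moreover have "bas \<alpha> \<beta> t ?p = (if j = i then fact i * poly r (alpha_at \<alpha> l) else 0)"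
        unfolding bas_def li by (simp only: prod.case point_deriv_dual_basis)
      ultimately show "c t * bas \<alpha> \<beta> t ?p = (if t = (k, j) then c (k, j) * (fact j * poly r (alpha_at \<alpha> k)) else 0)"
        by (auto simp: li)
    qed
    also have "\<dots> = c (k, j) * (fact j * poly r (alpha_at \<alpha> k))"
      using T by simp
    finally show ?thesis using r[of k] by simp
  qed
  then show "c = 0" by (auto simp: fun_eq_iff)
qed

section \<open>Submodules generated by a vector or a stable set\<close>

lemma span_lie_submodule:
  fixes M :: "(takiff, 'a \<Rightarrow> complex) rep"
  assumes M: "pointwise M" "lie_module takiff M" and G: "G \<subseteq> carrier M"
    and st: "\<And>z v. z \<in> takiff_basis \<Longrightarrow> v \<in> G \<Longrightarrow> act M z v \<in> fv.span G"
  shows "lie_submodule takiff M (fv.span G)"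
proof -
  have sub: "fv.subspace (carrier M)" using M(1) pointwiseD(1) by blast
  have GM: "fv.span G \<subseteq> carrier M" by (rule fv.span_minimal[OF G sub])
  have "act M x v \<in> fv.span G" if x: "x \<in> carrier takiff" and v: "v \<in> fv.span G" for x v
  proof -
    have lin: "act M x (p + q) = act M x p + act M x q" "act M x (fscale c p) = fscale c (act M x p)"
      if "p \<in> carrier M" "q \<in> carrier M" for p q c
      using M that x by (simp_all add: pointwise_lie_module_iff)
    have 0: "0 \<in> carrier M" by (rule fv.subspace_0[OF sub])
    have "act M x 0 = 0" using lin(2)[OF 0 0, of 0] by simp
    then have "fv.subspace {p \<in> carrier M. act M x p \<in> fv.span G}"
      unfolding fv.subspace_def mem_Collect_eq
      using lin 0 by (auto simp: fv.span_zero fv.subspace_add[OF sub] fv.subspace_scale[OF sub]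
          intro: fv.span_add fv.span_scale)
    moreover have "act M x p \<in> fv.span G" if "p \<in> G" for p
    proof -
      obtain A B where AB: "x = (A, B)" by fastforce
      have p: "p \<in> carrier M" using that G by blast
      show ?thesis unfolding AB act_decomp[OF M x[unfolded AB] p]
        by (intro fv.span_add fv.span_scale st that) auto
    qed
    ultimately have "fv.span G \<subseteq> {p \<in> carrier M. act M x p \<in> fv.span G}"
      using G by (intro fv.span_minimal) auto
    then show ?thesis using v by blast
  qed
  then show ?thesis
    using GM by (simp add: pointwise_lie_submodule_iff[OF M(1)])
qed

lemma lie_submodule_contains_orbit:
  fixes M :: "(takiff, 'a \<Rightarrow> complex) rep"
  assumes M: "pointwise M" "lie_module takiff M" and W: "lie_submodule takiff M W" and v: "v \<in> W"
  shows "env_orbit takiff M v \<subseteq> W"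
proof -
  have W': "W \<subseteq> carrier M" "fv.subspace W" "\<And>x w. x \<in> carrier takiff \<Longrightarrow> w \<in> W \<Longrightarrow> act M x w \<in> W"
    using W by (auto simp: pointwise_lie_submodule_iff[OF M(1)])
  have "foldr (act M) w v \<in> W" if "set w \<subseteq> carrier takiff" for w
    using that by (induction w) (auto simp: v W')
  then have "lin_ext (\<lambda>w. foldr (act M) w v) p \<in> W" if "p \<in> takiff.FA" for p
    by (intro lin_ext_in_subspace[OF W'(2) that]) auto
  then show ?thesis
    using v W'(1) by (auto simp: env_orbit_def free_algebra_simps free_act_eq[OF M])
qed

lemma orbit_lie_submodule:
  fixes M :: "(takiff, 'a \<Rightarrow> complex) rep"
  assumes M: "pointwise M" "lie_module takiff M" and v: "v \<in> carrier M"
  shows "lie_submodule takiff M (env_orbit takiff M v)" (is ?P1) "v \<in> env_orbit takiff M v"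
proof -
  let ?e = "lin_ext (\<lambda>w. foldr (act M) w v)"
  have fa: "free_act M p v = ?e p" if "p \<in> takiff.FA" for p
    by (rule free_act_eq[OF M that v])
  have orb: "env_orbit takiff M v = ?e ` takiff.FA"
    unfolding env_orbit_def free_algebra_simps by (rule image_cong[OF refl fa])
  show "v \<in> env_orbit takiff M v"
    unfolding orb by (rule image_eqI[of _ _ "delta []"]) simp_all
  have "env_orbit takiff M v \<subseteq> carrier M"
    unfolding env_orbit_def free_algebra_simps using free_act_closed[OF M _ v] by blast
  moreover have "fv.subspace (env_orbit takiff M v)"
    unfolding fv.subspace_def orb
  proof (intro conjI ballI allI)
    show "0 \<in> ?e ` takiff.FA"
      by (rule image_eqI[of _ _ 0]) simp_all
    show "x + y \<in> ?e ` takiff.FA"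
      if xy: "x \<in> ?e ` takiff.FA" "y \<in> ?e ` takiff.FA" for x y
    proof -
      obtain p q where p: "p \<in> takiff.FA" "x = ?e p" and 
        q: "q \<in> takiff.FA" "y = ?e q" using xy by blast
      show ?thesis unfolding p(2) q(2) lin_ext_add[OF p(1) q(1), symmetric] 
        by (rule imageI) (rule takiff.FA_closed(3)[OF p(1) q(1)])
    qed
    show "fscale c x \<in> ?e ` takiff.FA"
      if x: "x \<in> ?e ` takiff.FA" for c x
    proof -
      obtain p where p: "p \<in> takiff.FA" "x = ?e p" using x by blast
      show ?thesis unfolding p(2) lin_ext_scale[symmetric] 
        by (rule imageI) (rule takiff.FA_closed(5)[OF p(1)])
    qed
  qed
  moreover have "act M x w \<in> env_orbit takiff M v" if x: "x \<in> carrier takiff" and w: "w \<in> env_orbit takiff M v" for x w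
  proof -
    obtain p where p: "p \<in> takiff.FA" "w = free_act M p v"
      using w by (auto simp: env_orbit_def free_algebra_simps)
    have g: "takiff.gen x \<in> takiff.FA" using x by auto
    have "free_act M (lmul x p) v = free_act M (takiff.gen x) w"
      unfolding p(2) by (rule free_act_mult[OF M v g p(1)])
    also have "\<dots> = act M x w"
      using free_act_eq[OF M g free_act_closed[OF M p(1) v]] p(2) by simp
    finally show ?thesis
      using takiff.FA_closed(6)[OF g p(1)] by (metis env_orbit_def free_algebra_simps(1) imageI)
  qed
  ultimately show ?P1
    by (simp add: pointwise_lie_submodule_iff[OF M(1)])
qed

section \<open>The module N and its simplicity\<close>

lemma alpha_at_step: "alpha_at \<alpha> (k + 1) = alpha_at \<alpha> k + 2" "alpha_at \<alpha> (k - 1) = alpha_at \<alpha> k - 2"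
  by (simp_all add: alpha_at_def algebra_simps)

lemma eta_bas: "eta (alpha_at \<alpha> k) \<beta> 1 = bas \<alpha> \<beta> (k, 0)"
  by (simp add: eta_eq_point_deriv bas_def)

lemma eta_set: "{eta (alpha_at \<alpha> k) \<beta> s | k s. s \<ge> 1} = range (bas \<alpha> \<beta>)"
proof -
  have "bas \<alpha> \<beta> (k, j) = eta (alpha_at \<alpha> k) \<beta> (Suc j)" for k j
    by (simp add: eta_eq_point_deriv bas_def)
  moreover have "\<exists>j. s = Suc j" if "s \<ge> 1" for s using that by (cases s) auto
  ultimately show ?thesis by (fastforce simp: image_iff)
qed

lemma N_mod_eq: "N_mod lam a b \<alpha> \<beta> = (Dual lam a b)\<lparr>carrier := fv.span (range (bas \<alpha> \<beta>))\<rparr>"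
proof -
  have "range (bas \<alpha> \<beta>) \<subseteq> carrier (Dual lam a b)" by (auto simp: bas_def point_deriv_Dual)
  then show ?thesis unfolding N_mod_def eta_set by (simp only: pointwise_lin_span[OF Dual_pointwise])
qed

locale nmod =
  fixes lam a b \<alpha> \<beta> :: complex
  assumes lam: "lam \<noteq> 0"
begin

abbreviation N where "N \<equiv> N_mod lam a b \<alpha> \<beta>"
abbreviation B where "B k j \<equiv> bas \<alpha> \<beta> (k, j)"
abbreviation al where "al k \<equiv> alpha_at \<alpha> k"
abbreviation co where "co \<equiv> bas.coord \<alpha> \<beta>"

lemma carrier_N: "carrier N = fv.span (range (bas \<alpha> \<beta>))"
  by (simp add: N_mod_eq)

lemma B_N [simp]: "bas \<alpha> \<beta> t \<in> carrier N"
  unfolding carrier_N by (rule fv.span_base) simp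

lemma act_N: "act N = act (Dual lam a b)"
  by (simp add: N_mod_eq)

text \<open>
  In the index arithmetic on natural numbers, \<open>j - 1\<close> and \<open>j - 2\<close> are only truncated where their
  coefficient is zero.
\<close>

lemma act_basis:
  "act N h_el (B k j) = fscale (- al k) (B k j)"
  "act N hbar_el (B k j) = fscale (- \<beta>) (B k j) + fscale (- of_nat j) (B k (j - 1))"
  "act N f_el (B k j) = fscale (- 2 * lam) (B (k + 1) (Suc j))"
  "act N fbar_el (B k j) = fscale (- lam) (B (k + 1) j)"
  "act N ebar_el (B k j) = fscale (1 / (4 * lam)) (fscale (\<beta>\<^sup>2 + a) (B (k - 1) j) + 
     fscale (2 * \<beta> * of_nat j) (B (k - 1) (j - 1)) + 
     fscale (of_nat j * of_nat (j - 1)) (B (k - 1) (j - 2)))"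
  "act N e_el (B k j) = fscale (1 / (2 * lam)) (fscale (- (\<beta>\<^sup>2 + a)) (B (k - 1) (Suc j)) + 
     fscale ((al k - 2 * of_nat (Suc j)) * \<beta> + b) (B (k - 1) j) + 
     fscale (of_nat j * (al k - of_nat (Suc j))) (B (k - 1) (j - 1)))"
  unfolding act_N bas_def prod.case alpha_at_step by (rule Dual_act_point_deriv[OF lam])+

lemma N_pointwise: "pointwise N" and N_lie_module: "lie_module takiff N"
proof -
  have "lie_submodule takiff (Dual lam a b) (fv.span (range (bas \<alpha> \<beta>)))"
  proof (rule span_lie_submodule[OF Dual_pointwise Dual_lie_module[OF lam]])
    show "range (bas \<alpha> \<beta>) \<subseteq> carrier (Dual lam a b)" by (auto simp: bas_def point_deriv_Dual)
    fix z v assume z: "z \<in> takiff_basis" and "v \<in> range (bas \<alpha> \<beta>)"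
    then obtain k j where v: "v = B k j" by auto
    have sp: "B k j \<in> fv.span (range (bas \<alpha> \<beta>))" for k j by (rule fv.span_base) simp
    from z show "act (Dual lam a b) z v \<in> fv.span (range (bas \<alpha> \<beta>))"
      unfolding act_N[symmetric] v
      by (elim insertE emptyE; simp only: act_basis; intro fv.span_add fv.span_scale sp)
  qed
  from lie_module_submodule[OF Dual_pointwise Dual_lie_module[OF lam] this]
  show "pointwise N" "lie_module takiff N" unfolding N_mod_eq by auto
qed

lemma N_subspace: "fv.subspace (carrier N)"
  by (rule pointwiseD(1)[OF N_pointwise])

lemma N_act:
  assumes "x \<in> carrier takiff" "v \<in> carrier N" "w \<in> carrier N"
  shows "act N x v \<in> carrier N" "act N x (v + w) = act N x v + act N x w"
  using N_lie_module assms by (simp_all add: pointwise_lie_module_iff[OF N_pointwise])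

lemma N_act_scale:
  assumes "x \<in> carrier takiff" "v \<in> carrier N"
  shows "act N x (fscale c v) = fscale c (act N x v)"
  using N_lie_module assms by (simp_all add: pointwise_lie_module_iff[OF N_pointwise])

lemma N_act_zero:
  assumes "x \<in> carrier takiff"
  shows "act N x 0 = 0"
proof -
  have "0 \<in> carrier N" by (rule fv.subspace_0[OF N_subspace])
  from N_act_scale[OF assms this, of 0] show ?thesis by simp
qed

lemma co_act:
  assumes "v \<in> carrier N"
  shows "co (act N h_el v) (k, j) = - al k * co v (k, j)" (is ?P1)
    "co (act N hbar_el v) (k, j) = - \<beta> * co v (k, j) - of_nat (Suc j) * co v (k, Suc j)"
proof -
  have add: "co (p + q) = co p + co q" if "p \<in> carrier N" "q \<in> carrier N" for p q
    using that unfolding carrier_N by (rule bas.coord_add)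
  have scale: "co (fscale c p) = fscale c (co p)" if "p \<in> carrier N" for c p
    using that unfolding carrier_N by (rule bas.coord_scale)
  note cl = N_act N_act_scale fv.subspace_add[OF N_subspace] fv.subspace_scale[OF N_subspace]
  have z: "0 \<in> carrier N" by (rule fv.subspace_0[OF N_subspace])
  let ?S1 = "{v \<in> carrier N. co (act N h_el v) (k, j) = - al k * co v (k, j)}"
  let ?S2 = "{v \<in> carrier N. co (act N hbar_el v) (k, j) = - \<beta> * co v (k, j) - of_nat (Suc j) * co v (k, Suc j)}"
  have "fv.subspace ?S1" "fv.subspace ?S2"
    unfolding fv.subspace_def mem_Collect_eq
    by (auto simp: z N_act_zero cl add scale right_diff_distrib distrib_left add_diff_add
        simp del: of_nat_Suc)
  moreover have "B l i \<in> ?S1" for l i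
    by (simp add: act_basis scale delta_def del: fv.scale_minus_left)
  moreover have "B l i \<in> ?S2" for l i
    by (cases i) (simp_all add: act_basis add scale cl delta_def del: fv.scale_minus_left)
  ultimately have "carrier N \<subseteq> ?S1" "carrier N \<subseteq> ?S2"
    unfolding carrier_N by (intro fv.span_minimal; auto simp: carrier_N)+
  then show ?P1
    "co (act N hbar_el v) (k, j) = - \<beta> * co v (k, j) - of_nat (Suc j) * co v (k, Suc j)"
    using assms by auto
qed

lemma co_eq_0_iff: "v \<in> carrier N \<Longrightarrow> co v = 0 \<longleftrightarrow> v = 0"
  unfolding carrier_N by (rule bas.coord_eq_0_iff)

lemma co_finite: "v \<in> carrier N \<Longrightarrow> finite {t. co v t \<noteq> 0}"
  using bas.coord_fin_supp unfolding carrier_N by (auto simp: fin_supp_def)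

lemma B_nonzero: "B k j \<noteq> 0"
proof
  assume "B k j = 0"
  then have "co (B k j) (k, j) = 0" by simp
  then show False by (simp add: delta_def)
qed

lemma single_coord:
  assumes "v \<in> carrier N" "\<And>s. s \<noteq> t \<Longrightarrow> co v s = 0"
  shows "v = fscale (co v t) (bas \<alpha> \<beta> t)"
proof -
  have "lin_ext (bas \<alpha> \<beta>) (co v) = v" using assms(1) unfolding carrier_N by (rule bas.lin_ext_coord)
  moreover have "{s. co v s \<noteq> 0} \<subseteq> {t}" using assms(2) by auto
  ultimately show ?thesis using lin_ext_superset[of "{t}" "co v" "bas \<alpha> \<beta>"] by simp
qed

text \<open>
  Induction on the sum of \<open>j + 1\<close> over the support of \<open>v\<close>. If \<open>(h-bar + \<beta>) v\<close> is nonzero, it has a smaller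
  such sum, as all \<open>j\<close> have dropped by one. Otherwise only \<open>j = 0\<close> occurs; if two different \<open>k\<close> occur, the
  operator \<open>h + (\<alpha> + 2k)\<close> removes one of them and keeps the other.
\<close>

lemma submodule_contains_eta:
  assumes W: "lie_submodule takiff N W" and v: "v \<in> W" "v \<noteq> 0"
  shows "\<exists>k. B k 0 \<in> W"
  using v
proof (induction "\<Sum>t | co v t \<noteq> 0. Suc (snd t)" arbitrary: v rule: less_induct)
  case less
  have W': "W \<subseteq> carrier N" "fv.subspace W" "\<And>x w. x \<in> carrier takiff \<Longrightarrow> w \<in> W \<Longrightarrow> act N x w \<in> W"
    using W by (auto simp: pointwise_lie_submodule_iff[OF N_pointwise])
  have vN: "v \<in> carrier N" using less W' by blast
  let ?S = "{t. co v t \<noteq> 0}"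
  have fin: "finite ?S" by (rule co_finite[OF vN])
  have co_lin: "co (act N x v + fscale c v) t = co (act N x v) t + c * co v t" if "x \<in> carrier takiff" for x c t
    using bas.coord_add[of "act N x v" \<alpha> \<beta> "fscale c v"] bas.coord_scale[of v \<alpha> \<beta> c]
      N_act(1)[OF that vN vN] fv.subspace_scale[OF N_subspace vN] vN unfolding carrier_N by simp
  have nonempty: "?S \<noteq> {}"
    using less.prems(2) co_eq_0_iff[OF vN] by (auto simp: fun_eq_iff)
  show ?case
  proof (cases "act N hbar_el v + fscale \<beta> v = 0")
    case False
    let ?u = "act N hbar_el v + fscale \<beta> v"
    have uW: "?u \<in> W" using less.prems W' by (intro fv.subspace_add[OF W'(2)] fv.subspace_scale[OF W'(2)]) auto
    have cu: "co ?u (k, j) = - of_nat (Suc j) * co v (k, Suc j)" for k j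
      by (simp add: co_lin co_act[OF vN] del: of_nat_Suc)
    have "{t. co ?u t \<noteq> 0} = {(k, j). co v (k, Suc j) \<noteq> 0}" using cu by (auto simp del: of_nat_Suc)
    then have "(\<Sum>t | co ?u t \<noteq> 0. Suc (snd t)) = (\<Sum>t\<in>{(k, j). co v (k, Suc j) \<noteq> 0}. Suc (snd t))"
      by simp
    also have "\<dots> = (\<Sum>t\<in>?S \<inter> {t. snd t \<noteq> 0}. snd t)"
      by (rule sum.reindex_bij_witness[where i = "\<lambda>(k, j). (k, j - 1)" and j = "\<lambda>(k, j). (k, Suc j)"])
        auto
    also have "\<dots> \<le> (\<Sum>t\<in>?S. snd t)" by (rule sum_mono2[OF fin]) auto
    also have "\<dots> < (\<Sum>t\<in>?S. Suc (snd t))" by (rule sum_strict_mono[OF fin nonempty]) simp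
    finally show ?thesis using less.hyps[OF _ uW False] by blast
  next
    case True
    have z: "co v (k, Suc j) = 0" for k j
    proof -
      have "co (act N hbar_el v + fscale \<beta> v) (k, j) = 0" using True by simp
      then show ?thesis by (simp add: co_lin co_act[OF vN] del: of_nat_Suc)
    qed
    obtain k j where kj: "co v (k, j) \<noteq> 0" using nonempty by auto
    then have k: "co v (k, 0) \<noteq> 0" using z[of k "j - 1"] by (cases j) auto
    show ?thesis
    proof (cases "\<exists>l. l \<noteq> k \<and> co v (l, 0) \<noteq> 0")
      case False
      have "co v s = 0" if "s \<noteq> (k, 0)" for s
        using that False z by (cases s; cases "snd s") auto
      from single_coord[OF vN this] have "v = fscale (co v (k, 0)) (B k 0)" by blast
      then have "B k 0 = fscale (1 / co v (k, 0)) v" using k by (simp add: fun_eq_iff)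
      then have "B k 0 \<in> W" using fv.subspace_scale[OF W'(2) less.prems(1)] by simp
      then show ?thesis by blast
    next
      case True
      then obtain l where l: "l \<noteq> k" "co v (l, 0) \<noteq> 0" by blast
      let ?u = "act N h_el v + fscale (al k) v"
      have uW: "?u \<in> W" using less.prems W' by (intro fv.subspace_add[OF W'(2)] fv.subspace_scale[OF W'(2)]) auto
      have cu: "co ?u (i, j) = (al k - al i) * co v (i, j)" for i j
        by (simp add: co_lin co_act[OF vN] left_diff_distrib)
      have "co ?u (l, 0) \<noteq> 0" using l by (simp add: cu alpha_at_inj)
      then have u0: "?u \<noteq> 0" by (metis bas.coord_zero zero_fun_apply)
      have "(\<Sum>t | co ?u t \<noteq> 0. Suc (snd t)) < (\<Sum>t\<in>?S. Suc (snd t))"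
        by (rule sum_strict_mono2[OF fin, of _ "(k, 0)"]) (use cu k in auto)
      then show ?thesis using less.hyps[OF _ uW u0] by blast
    qed
  qed
qed

text \<open>
  From one \<open>B k 0\<close> the whole module is reached: \<open>f\<close>-bar goes up, \<open>e\<close>-bar or \<open>e\<close> goes down, and \<open>f\<close> then
  raises \<open>j\<close>.
\<close>

lemma simple_if:
  assumes "\<beta>\<^sup>2 + a \<noteq> 0 \<or> (\<beta>\<^sup>2 + a = 0 \<and> (\<forall>k. (al k - 2) * \<beta> + b \<noteq> 0))"
  shows "simple_rep takiff N"
  unfolding simple_rep_def
proof (intro conjI allI impI)
  show "lie_module takiff N" by (rule N_lie_module)
  show "carrier N \<noteq> {\<zero>\<^bsub>N\<^esub>}"
    using B_N[of "(0, 0)"] B_nonzero[of 0 0] by (auto simp: pointwiseD[OF N_pointwise] simp del: B_N)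
  fix W assume W: "lie_submodule takiff N W"
  have W': "W \<subseteq> carrier N" "fv.subspace W" "\<And>x w. x \<in> carrier takiff \<Longrightarrow> w \<in> W \<Longrightarrow> act N x w \<in> W"
    using W by (auto simp: pointwise_lie_submodule_iff[OF N_pointwise])
  have sc: "v \<in> W" if "fscale c v \<in> W" "c \<noteq> 0" for c v
    using fv.subspace_scale[OF W'(2) that(1), of "1 / c"] that(2) by simp
  show "W = {\<zero>\<^bsub>N\<^esub>} \<or> W = carrier N"
  proof (cases "\<exists>v\<in>W. v \<noteq> 0")
    case False
    then show ?thesis using fv.subspace_0[OF W'(2)] by (auto simp: pointwiseD[OF N_pointwise])
  next
    case True
    then obtain k where k: "B k 0 \<in> W" using submodule_contains_eta[OF W] by blast
    have up: "B (l + 1) j \<in> W" "B (l + 1) (Suc j) \<in> W" if "B l j \<in> W" for l j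
      using W'(3)[OF basis_takiff(4) that] W'(3)[OF basis_takiff(2) that] lam sc
      unfolding act_basis by (metis neg_equal_0_iff_equal, metis mult_eq_0_iff neg_equal_0_iff_equal zero_neq_numeral)
    have down: "B (l - 1) 0 \<in> W" if l: "B l 0 \<in> W" for l
    proof (cases "\<beta>\<^sup>2 + a = 0")
      case True
      then have "(al l - 2) * \<beta> + b \<noteq> 0" using assms by blast
      moreover have "act N e_el (B l 0) = fscale (1 / (2 * lam) * ((al l - 2) * \<beta> + b)) (B (l - 1) 0)"
        unfolding act_basis using True by simp
      ultimately show ?thesis using W'(3)[OF basis_takiff(1) l] lam sc by simp
    next
      case False
      moreover have "act N ebar_el (B l 0) = fscale (1 / (4 * lam) * (\<beta>\<^sup>2 + a)) (B (l - 1) 0)"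
        unfolding act_basis by simp
      ultimately show ?thesis using W'(3)[OF basis_takiff(3) l] lam sc by simp
    qed
    have "B l 0 \<in> W" for l
      by (induction l rule: int_induct[of _ k]) (use k up down in auto)
    then have "B l j \<in> W" for l j
    proof (induction j arbitrary: l)
      case (Suc j)
      then show ?case using up(2)[of "l - 1" j] by simp
    qed
    then have "range (bas \<alpha> \<beta>) \<subseteq> W" by auto
    then have "carrier N \<subseteq> W" unfolding carrier_N by (rule fv.span_minimal) (rule W'(2))
    then show ?thesis using W'(1) by blast
  qed
qed

end

section \<open>Verma submodules of N and their quotients\<close>

context nmod
begin

text \<open>
  The candidate for the Verma submodule with highest weight vector \<open>B k0 0\<close>: the cone of all indices
  \<open>(k0 + i + j, j)\<close>.
\<close>

definition W where "W k0 = fv.span (bas \<alpha> \<beta> ` {(k, j). k \<ge> k0 + int j})"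

lemma W_iff: "v \<in> W k0 \<longleftrightarrow> v \<in> carrier N \<and> (\<forall>k j. co v (k, j) \<noteq> 0 \<longrightarrow> k \<ge> k0 + int j)"
  using bas.span_image_iff[of v \<alpha> \<beta> "{(k, j). k \<ge> k0 + int j}"]
  unfolding W_def carrier_N by (simp add: split_paired_All)

lemma B_W: "B k j \<in> W k0 \<longleftrightarrow> k \<ge> k0 + int j"
  by (auto simp: W_iff delta_def)

lemma co_W_zero: "v \<in> W k0 \<Longrightarrow> \<not> k \<ge> k0 + int j \<Longrightarrow> co v (k, j) = 0"
  by (auto simp: W_iff)

lemma W_subspace: "fv.subspace (W k0)"
  by (simp add: W_def)

context
  fixes k0 :: int
  assumes sing: "\<beta>\<^sup>2 + a = 0" "(al k0 - 2) * \<beta> + b = 0"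
begin

lemma al_shift: "al (k0 + n) = al k0 + 2 * of_int n"
  by (simp add: alpha_at_def algebra_simps)

text \<open>
  On the boundary \<open>k = k0 + j\<close> of the cone the coefficient of \<open>B (k - 1) j\<close> in \<open>e (B k j)\<close> vanishes. This
  is what keeps \<open>e\<close> inside \<open>W k0\<close>.
\<close>

lemma act_sing:
  "act N ebar_el (B k j) = fscale (1 / (4 * lam)) (fscale (2 * \<beta> * of_nat j) (B (k - 1) (j - 1)) + 
     fscale (of_nat j * of_nat (j - 1)) (B (k - 1) (j - 2)))" (is ?P1)
  "act N e_el (B k j) = fscale (1 / (2 * lam)) (fscale (2 * of_int (k - k0 - int j) * \<beta>) (B (k - 1) j) + 
     fscale (of_nat j * (al k - of_nat (Suc j))) (B (k - 1) (j - 1)))" (is ?P2)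
proof -
  show ?P1
    unfolding act_basis sing by simp
  have "al k = al k0 + 2 * of_int (k - k0)" using al_shift[of "k - k0"] by simp
  then have "(al k - 2 * of_nat (Suc j)) * \<beta> + b = ((al k0 - 2) * \<beta> + b) + 2 * of_int (k - k0 - int j) * \<beta>"
    by (simp only:) (simp add: algebra_simps)
  then have "(al k - 2 * of_nat (Suc j)) * \<beta> + b = 2 * of_int (k - k0 - int j) * \<beta>"
    unfolding sing by simp
  then show ?P2
    unfolding act_basis sing by simp
qed

lemma W_submodule: "lie_submodule takiff N (W k0)"
  unfolding W_def
proof (rule span_lie_submodule[OF N_pointwise N_lie_module])
  show "bas \<alpha> \<beta> ` {(k, j). k0 + int j \<le> k} \<subseteq> carrier N" by auto
  fix z v assume z: "z \<in> takiff_basis" and "v \<in> bas \<alpha> \<beta> ` {(k, j). k0 + int j \<le> k}"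
  then obtain k j where v: "v = B k j" and kj: "k0 + int j \<le> k" by auto
  have sp: "fscale c (B l i) \<in> W k0" if "c \<noteq> 0 \<longrightarrow> k0 + int i \<le> l" for c l i
    using that B_W fv.subspace_scale[OF W_subspace] fv.subspace_0[OF W_subspace] by (cases "c = 0") auto
  have "act N e_el v \<in> W k0" 
    unfolding v act_sing(2) 
  proof (rule fv.subspace_scale[OF W_subspace], rule fv.subspace_add[OF W_subspace]; rule sp)
    show "2 * of_int (k - k0 - int j) * \<beta> \<noteq> 0 \<longrightarrow> k0 + int j \<le> k - 1"
      using kj by (cases "k = k0 + int j") auto
    show "of_nat j * (al k - of_nat (Suc j)) \<noteq> 0 \<longrightarrow> k0 + int (j - 1) \<le> k - 1"
      using kj by (cases j) auto
  qed
  moreover have "act N h_el v \<in> W k0" 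
    unfolding v act_basis by (rule sp) (use kj in auto)
  moreover have "act N f_el v \<in> W k0" 
    unfolding v act_basis by (rule sp) (use kj in auto)
  moreover have "act N ebar_el v \<in> W k0"
    unfolding v act_sing(1)
  proof (rule fv.subspace_scale[OF W_subspace], rule fv.subspace_add[OF W_subspace]; rule sp)
    show "2 * \<beta> * of_nat j \<noteq> 0 \<longrightarrow> k0 + int (j - 1) \<le> k - 1"
      using kj by (cases j) auto
    show "(of_nat j :: complex) * of_nat (j - 1) \<noteq> 0 \<longrightarrow> k0 + int (j - 2) \<le> k - 1"
      using kj by (cases j) auto
  qed
  moreover have "act N hbar_el v \<in> W k0"
    unfolding v act_basis by (rule fv.subspace_add[OF W_subspace]; rule sp) (use kj in auto)
  moreover have "act N fbar_el v \<in> W k0"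
    unfolding v act_basis by (rule sp) (use kj in auto)
  ultimately show "act N z v \<in> fv.span (bas \<alpha> \<beta> ` {(k, j). k0 + int j \<le> k})"
    using z unfolding W_def by blast
qed

lemma not_simple: "\<not> simple_rep takiff N"
proof
  assume "simple_rep takiff N"
  then have "W k0 = {0} \<or> W k0 = carrier N"
    using W_submodule by (simp add: simple_rep_def pointwiseD[OF N_pointwise])
  moreover have "B k0 0 \<in> W k0" by (simp add: B_W)
  moreover have "B (k0 - 1) 0 \<notin> W k0" by (simp add: B_W)
  ultimately show False using B_nonzero[of k0 0] B_N[of "(k0 - 1, 0)"] by (metis singletonD)
qed

lemma fbar_power: "(act N fbar_el ^^ i) (B k j) = fscale ((- lam) ^ i) (B (k + int i) j)"
proof (induction i)
  case (Suc i)
  have "(act N fbar_el ^^ Suc i) (B k j) = act N fbar_el (fscale ((- lam) ^ i) (B (k + int i) j))"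
    by (simp only: funpow.simps o_apply Suc.IH)
  also have "\<dots> = fscale ((- lam) ^ i) (fscale (- lam) (B (k + int i + 1) j))"
    by (simp only: N_act_scale[OF basis_takiff(4) B_N] act_basis)
  also have "\<dots> = fscale ((- lam) ^ Suc i) (B (k + int (Suc i)) j)"
    by (simp only: fv.scale_scale power_Suc2) (simp add: ac_simps)
  finally show ?case .
qed simp

lemma f_power: "(act N f_el ^^ i) (fscale c (B k j)) = fscale (c * (- 2 * lam) ^ i) (B (k + int i) (j + i))"
proof (induction i)
  case (Suc i)
  have "(act N f_el ^^ Suc i) (fscale c (B k j)) = act N f_el (fscale (c * (- 2 * lam) ^ i) (B (k + int i) (j + i)))"
    by (simp only: funpow.simps o_apply Suc.IH)
  also have "\<dots> = fscale (c * (- 2 * lam) ^ i) (fscale (- 2 * lam) (B (k + int i + 1) (Suc (j + i))))"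
    by (simp only: N_act_scale[OF basis_takiff(2) B_N] act_basis)
  also have "\<dots> = fscale (c * (- 2 * lam) ^ Suc i) (B (k + int (Suc i)) (j + Suc i))"
    by (simp only: fv.scale_scale power_Suc2) (simp add: ac_simps)
  finally show ?case .
qed simp

text \<open>
  The monomials \<open>f^j f-bar^i\<close> applied to \<open>B k0 0\<close> run through the basis of \<open>W k0\<close>, up to powers of
  \<open>- lam\<close> and \<open>- 2 lam\<close>.
\<close>

lemma W_verma: "is_verma_with_hwv (N\<lparr>carrier := W k0\<rparr>) (B k0 0)"
proof -
  let ?M = "N\<lparr>carrier := W k0\<rparr>"
  note M = lie_module_submodule[OF N_pointwise N_lie_module W_submodule]
  define w where "w = (\<lambda>(i, j). (act ?M f_el ^^ j) ((act ?M fbar_el ^^ i) (B k0 0)))"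
  define d where "d = (\<lambda>(i :: nat, j). (- lam) ^ i * (- 2 * lam) ^ j)"
  define \<tau> where "\<tau> = (\<lambda>(i, j). (k0 + int i + int j, j))"
  have w: "w t = fscale (d t) (bas \<alpha> \<beta> (\<tau> t))" for t
    by (cases t) (simp add: w_def d_def \<tau>_def fbar_power f_power)
  have d0: "d t \<noteq> 0" for t using lam by (cases t) (simp add: d_def)
  have inj: "\<tau> s = \<tau> t \<longleftrightarrow> s = t" for s t
    by (cases s; cases t) (auto simp: \<tau>_def)
  have "is_verma_with_hwv ?M (B k0 0)"
  proof (rule verma_characterisation[OF M, where m = "- al k0" and mb = "- \<beta>"])
    show "B k0 0 \<in> carrier ?M" by (simp add: B_W)
    show "act ?M e_el (B k0 0) = 0" "act ?M ebar_el (B k0 0) = 0"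
      by (simp_all add: act_sing)
    show "act ?M h_el (B k0 0) = fscale (- al k0) (B k0 0)" 
      "act ?M hbar_el (B k0 0) = fscale (- \<beta>) (B k0 0)"
      by (simp_all add: act_basis)
    have "carrier ?M = fv.span (bas \<alpha> \<beta> ` {(k, j). k \<ge> k0 + int j})" by (simp add: W_def)
    also have "\<dots> \<subseteq> fv.span (range w)"
    proof (intro fv.span_minimal fv.subspace_span subsetI)
      fix v assume "v \<in> bas \<alpha> \<beta> ` {(k, j). k \<ge> k0 + int j}"
      then obtain k j where v: "v = B k j" "k \<ge> k0 + int j" by auto
      then have "(k, j) = \<tau> (nat (k - k0 - int j), j)" by (simp add: \<tau>_def)
      then have "v = fscale (1 / d (nat (k - k0 - int j), j)) (w (nat (k - k0 - int j), j))"
        using d0 by (simp add: v w)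
      then show "v \<in> fv.span (range w)" by (metis fv.span_base fv.span_scale rangeI)
    qed
    finally show "carrier ?M \<subseteq> fv.span (range (\<lambda>(i, j). (act ?M f_el ^^ j) ((act ?M fbar_el ^^ i) (B k0 0))))"
      unfolding w_def .
    fix T c assume T: "finite T" 
      "(\<Sum>t\<in>T. fscale (c t) (case t of (i, j) \<Rightarrow> (act ?M f_el ^^ j) ((act ?M fbar_el ^^ i) (B k0 0)))) = 0"
    then have 0: "(\<Sum>t\<in>T. fscale (c t) (w t)) = 0" by (simp add: w_def)
    define c' where "c' = (\<Sum>t\<in>T. fscale (c t * d t) (delta (\<tau> t)))"
    have c': "c' \<in> fin_supp UNIV \<and> lin_ext (bas \<alpha> \<beta>) c' = (\<Sum>t\<in>T. fscale (c t) (w t))"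
      unfolding c'_def using T(1)
    proof (induction T)
      case (insert t T)
      have 1: "fscale (c t * d t) (delta (\<tau> t)) \<in> fin_supp UNIV"
        by (intro fv.subspace_scale[OF fin_supp_subspace]) simp
      have 2: "(\<Sum>t\<in>T. fscale (c t * d t) (delta (\<tau> t))) \<in> fin_supp UNIV" using insert.IH by (rule conjunct1)
      show ?case
        unfolding sum.insert[OF insert(1,2)] lin_ext_add[OF 1 2] lin_ext_scale lin_ext_delta 
          conjunct2[OF insert.IH] w[of t] fv.scale_scale
        by (intro conjI fv.subspace_add[OF fin_supp_subspace 1 2] refl)
    next
      case empty
      show ?case unfolding sum.empty by (intro conjI fv.subspace_0[OF fin_supp_subspace] lin_ext_zero)
    qed
    then have "c' = 0" using 0 by (intro bas.independent[of c' \<alpha> \<beta>]) auto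
    show "\<forall>t\<in>T. c t = 0"
    proof
      fix s assume s: "s \<in> T"
      have "0 = c' (\<tau> s)" using \<open>c' = 0\<close> by simp
      also have "\<dots> = (\<Sum>t\<in>T. if t = s then c s * d s else 0)"
        unfolding c'_def sum_fun_apply by (rule sum.cong) (auto simp: delta_def inj)
      also have "\<dots> = c s * d s" using T(1) s by simp
      finally show "c s = 0" using d0 by simp
    qed
  qed
  then show ?thesis .
qed

text \<open>
  For \<open>\<beta> \<noteq> 0\<close> the highest weight vector is reached from \<open>B (k0 + n) 0\<close> by \<open>e\<close>: the coefficients met on the
  way are multiples of \<open>n \<beta>\<close>, \<open>(n - 1) \<beta>\<close>, up to \<open>\<beta>\<close>. For \<open>\<beta> = 0\<close> they all vanish, and every \<open>B k 0\<close> generates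
  only its own cone.
\<close>

lemma orbit_eq_W:
  assumes "\<beta> \<noteq> 0 \<or> n = 0"
  shows "env_orbit takiff N (B (k0 + int n) 0) = W k0"
proof
  show "env_orbit takiff N (B (k0 + int n) 0) \<subseteq> W k0"
    by (rule lie_submodule_contains_orbit[OF N_pointwise N_lie_module W_submodule]) (simp add: B_W)
  let ?O = "env_orbit takiff N (B (k0 + int n) 0)"
  note O = orbit_lie_submodule[OF N_pointwise N_lie_module B_N]
  have O': "fv.subspace ?O" "\<And>x w. x \<in> carrier takiff \<Longrightarrow> w \<in> ?O \<Longrightarrow> act N x w \<in> ?O"
    using O(1) by (auto simp: pointwise_lie_submodule_iff[OF N_pointwise])
  have sc: "v \<in> ?O" if "fscale c v \<in> ?O" "c \<noteq> 0" for c v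
    using fv.subspace_scale[OF O'(1) that(1), of "1 / c"] that(2) by simp
  have "B (k0 + int (n - i)) 0 \<in> ?O" if "i \<le> n" for i
    using that
  proof (induction i)
    case (Suc i)
    then have \<beta>: "\<beta> \<noteq> 0" using assms by auto
    have "act N e_el (B (k0 + int (n - i)) 0) \<in> ?O"
      using Suc by (intro O'(2)) auto
    then have "fscale (1 / (2 * lam) * (2 * of_int (int (n - i)) * \<beta>)) (B (k0 + int (n - i) - 1) 0) \<in> ?O"
      unfolding act_sing by simp
    then have "B (k0 + int (n - i) - 1) 0 \<in> ?O"
      using Suc.prems \<beta> lam by (elim sc) auto
    moreover have "k0 + int (n - i) - 1 = k0 + int (n - Suc i)" using Suc.prems by simp
    ultimately show ?case by (simp only:)
  qed (use O(2) in simp)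
  from this[of n] have b: "B k0 0 \<in> ?O" by simp
  have "B (k0 + int i) 0 \<in> ?O" for i
  proof (induction i)
    case (Suc i)
    have "act N fbar_el (B (k0 + int i) 0) \<in> ?O" by (rule O'(2)[OF basis_takiff(4) Suc.IH])
    then have "B (k0 + int i + 1) 0 \<in> ?O" unfolding act_basis by (rule sc) (use lam in simp)
    then show ?case by (simp add: ac_simps)
  qed (use b in simp)
  then have "B (k0 + int i + int j) j \<in> ?O" for i j
  proof (induction j)
    case (Suc j)
    have "act N f_el (B (k0 + int i + int j) j) \<in> ?O" by (rule O'(2)[OF basis_takiff(2) Suc.IH]) (rule Suc.prems)
    then have "B (k0 + int i + int j + 1) (Suc j) \<in> ?O" unfolding act_basis by (rule sc) (use lam in simp)
    then show ?case by (simp add: ac_simps)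
  qed simp
  note all = this
  show "W k0 \<subseteq> ?O"
    unfolding W_def
  proof (rule fv.span_minimal[OF _ O'(1)], rule subsetI)
    fix v assume "v \<in> bas \<alpha> \<beta> ` {(k, j). k \<ge> k0 + int j}"
    then obtain k j where v: "v = B k j" "k \<ge> k0 + int j" by auto
    then show "v \<in> ?O" using all[of "nat (k - k0 - int j)" j] by simp
  qed
qed

text \<open>
  From here on the quotient of \<open>N\<close> by \<open>W k0\<close> is studied through the projection \<open>p\<close>.
\<close>

abbreviation Q where "Q \<equiv> quot_rep N (W k0)"
abbreviation p where "p v \<equiv> W k0 +>\<^bsub>N\<^esub> v"

lemma W_sub: "submodule (W k0) cplx N"
  using W_submodule by (simp add: lie_submodule_def)

lemmas N_mod = pointwise_module[OF N_pointwise]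

lemma Q_carrier: "carrier Q = p ` carrier N"
  by (rule quot_rep_carrier[OF N_mod W_sub])

lemma p_eq_iff: "v \<in> carrier N \<Longrightarrow> w \<in> carrier N \<Longrightarrow> p v = p w \<longleftrightarrow> v - w \<in> W k0"
  using coset_eq_iff[OF N_mod W_sub] pointwise_minus(2)[OF N_pointwise] by simp

lemma Q_zero: "\<zero>\<^bsub>Q\<^esub> = p 0"
  using quot_rep_zero[OF N_mod W_sub] by (simp add: pointwiseD[OF N_pointwise])

lemma N0: "0 \<in> carrier N" by (rule fv.subspace_0[OF N_subspace])

lemma p_eq_zero_iff: "v \<in> carrier N \<Longrightarrow> p v = \<zero>\<^bsub>Q\<^esub> \<longleftrightarrow> v \<in> W k0"
  using p_eq_iff[of v 0] N0 by (simp add: Q_zero)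

lemma Q_add: "v \<in> carrier N \<Longrightarrow> w \<in> carrier N \<Longrightarrow> p v \<oplus>\<^bsub>Q\<^esub> p w = p (v + w)"
  using quot_rep_add[OF N_mod W_sub] by (simp add: pointwiseD[OF N_pointwise])

lemma Q_smult: "v \<in> carrier N \<Longrightarrow> c \<odot>\<^bsub>Q\<^esub> p v = p (fscale c v)"
  using quot_rep_smult[OF N_mod W_sub] by (simp add: pointwiseD[OF N_pointwise])

lemma N_act_diff:
  assumes "x \<in> carrier takiff" "v \<in> carrier N" "w \<in> carrier N"
  shows "act N x (v - w) = act N x v - act N x w"
proof -
  have "v - w \<in> carrier N" by (rule fv.subspace_diff[OF N_subspace assms(2,3)])
  then have "act N x (v - w) + act N x w = act N x v" using N_act(2)[OF assms(1) _ assms(3)] by (metis diff_add_cancel)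
  then show ?thesis by (simp add: algebra_simps)
qed

lemma Q_act:
  assumes "x \<in> carrier takiff" "v \<in> carrier N"
  shows "act Q x (p v) = p (act N x v)"
proof (rule quot_rep_act[OF N_mod W_sub assms(2)])
  fix w assume w: "w \<in> carrier N" "p w = p v"
  then have "act N x (w - v) \<in> W k0"
    using W_submodule assms by (simp add: p_eq_iff lie_submodule_def)
  then show "p (act N x w) = p (act N x v)"
    using w assms N_act by (simp add: p_eq_iff N_act_diff)
qed

lemma Q_lie_module: "lie_module takiff Q"
  and Q_minus: "v \<in> carrier N \<Longrightarrow> w \<in> carrier N \<Longrightarrow> p v \<ominus>\<^bsub>Q\<^esub> p w = p (v - w)"
proof -
  note im = lie_module_image[OF N_lie_module takiff.add_closed takiff.smult_closed takiff.bracket_closed,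
      of Q p]
  have 1: "p v \<oplus>\<^bsub>Q\<^esub> p w = p (v \<oplus>\<^bsub>N\<^esub> w)" if "v \<in> carrier N" "w \<in> carrier N" for v w
    using Q_add[OF that] by (simp add: pointwiseD[OF N_pointwise])
  have 2: "c \<odot>\<^bsub>Q\<^esub> p v = p (c \<odot>\<^bsub>N\<^esub> v)" if "v \<in> carrier N" for v c
    using Q_smult[OF that] by (simp add: pointwiseD[OF N_pointwise])
  have 3: "\<zero>\<^bsub>Q\<^esub> = p \<zero>\<^bsub>N\<^esub>" by (rule quot_rep_zero[OF N_mod W_sub])
  show "lie_module takiff Q"
    by (rule im(1)) (use Q_carrier 1 2 3 Q_act in auto)
  have "p v \<ominus>\<^bsub>Q\<^esub> p w = p (v \<ominus>\<^bsub>N\<^esub> w)" if "v \<in> carrier N" "w \<in> carrier N"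
    by (rule im(2)) (use Q_carrier 1 2 3 Q_act that in auto)
  then show "v \<in> carrier N \<Longrightarrow> w \<in> carrier N \<Longrightarrow> p v \<ominus>\<^bsub>Q\<^esub> p w = p (v - w)"
    by (simp add: pointwise_minus[OF N_pointwise])
qed

text \<open>
  The operators whose iterates define generalized weight spaces, on \<open>N\<close> instead of the quotient.
\<close>

definition shifted where "shifted x c v = act N x v - fscale c v"

lemma shifted_closed: "x \<in> carrier takiff \<Longrightarrow> v \<in> carrier N \<Longrightarrow> shifted x c v \<in> carrier N"
  unfolding shifted_def by (intro fv.subspace_diff[OF N_subspace] N_act(1) fv.subspace_scale[OF N_subspace])

lemma shifted_pow_closed: "x \<in> carrier takiff \<Longrightarrow> v \<in> carrier N \<Longrightarrow> (shifted x c ^^ n) v \<in> carrier N"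
  by (induction n) (auto intro: shifted_closed)

lemma Q_shifted_pow:
  assumes "x \<in> carrier takiff" "v \<in> carrier N"
  shows "((\<lambda>w. act Q x w \<ominus>\<^bsub>Q\<^esub> c \<odot>\<^bsub>Q\<^esub> w) ^^ n) (p v) = p ((shifted x c ^^ n) v)"
proof (induction n)
  case (Suc n)
  have cl: "(shifted x c ^^ n) v \<in> carrier N" by (rule shifted_pow_closed[OF assms])
  have "((\<lambda>w. act Q x w \<ominus>\<^bsub>Q\<^esub> c \<odot>\<^bsub>Q\<^esub> w) ^^ Suc n) (p v) = 
      act Q x (p ((shifted x c ^^ n) v)) \<ominus>\<^bsub>Q\<^esub> c \<odot>\<^bsub>Q\<^esub> p ((shifted x c ^^ n) v)"
    using Suc.IH by simp
  also have "\<dots> = p (shifted x c ((shifted x c ^^ n) v))"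
    using cl assms N_act fv.subspace_scale[OF N_subspace cl]
    by (simp add: Q_act Q_smult Q_minus shifted_def)
  finally show ?case by simp
qed simp

lemma in_gen_weight_space_iff:
  assumes "v \<in> carrier N"
  shows "p v \<in> gen_weight_space Q m mb \<longleftrightarrow> 
    (\<exists>n\<ge>1. (shifted h_el m ^^ n) v \<in> W k0) \<and> (\<exists>n\<ge>1. (shifted hbar_el mb ^^ n) v \<in> W k0)"
  using assms shifted_pow_closed[OF basis_takiff(5) assms] shifted_pow_closed[OF basis_takiff(6) assms]
  by (auto simp: gen_weight_space_def Q_carrier Q_shifted_pow p_eq_zero_iff)

lemma co_lin:
  assumes "v \<in> carrier N" "w \<in> carrier N"
  shows "co (v - w) t = co v t - co w t" "co (fscale c v) t = c * co v t"
  using assms bas.coord_diff bas.coord_scale unfolding carrier_N by simp_all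

lemma co_shifted:
  assumes "v \<in> carrier N"
  shows "co (shifted h_el c v) (k, j) = (- al k - c) * co v (k, j)"
    "co (shifted hbar_el c v) (k, j) = (- \<beta> - c) * co v (k, j) - of_nat (Suc j) * co v (k, Suc j)"
  unfolding shifted_def using assms N_act(1)[OF _ assms assms] fv.subspace_scale[OF N_subspace assms]
  by (simp_all add: co_lin co_act left_diff_distrib del: of_nat_Suc)

lemma co_shifted_pow_h:
  assumes "v \<in> carrier N"
  shows "co ((shifted h_el c ^^ n) v) (k, j) = (- al k - c) ^ n * co v (k, j)"
proof (induction n)
  case (Suc n)
  then show ?case using co_shifted(1)[OF shifted_pow_closed[OF basis_takiff(5) assms]] by simp
qed simp

text \<open>
  On the last nonzero coordinate in a row, \<open>h\<close>-bar acts by its eigenvalue, because the correction comes from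
  the next coordinate.
\<close>

lemma co_shifted_pow_hbar:
  assumes "v \<in> carrier N" "\<And>i. i > j \<Longrightarrow> co v (k, i) = 0"
  shows "co ((shifted hbar_el c ^^ n) v) (k, j) = (- \<beta> - c) ^ n * co v (k, j)" (is ?P1)
proof -
  have *: "co ((shifted hbar_el c ^^ n) v) (k, i) = 0" if "i > j" for i n
    using that
  proof (induction n arbitrary: i)
    case (Suc n)
    then show ?case using co_shifted(2)[OF shifted_pow_closed[OF basis_takiff(6) assms(1)]] by simp
  qed (simp add: assms)
  show ?P1
  proof (induction n)
    case (Suc n)
    then show ?case using co_shifted(2)[OF shifted_pow_closed[OF basis_takiff(6) assms(1)]] *[of "Suc j" n] by simp
  qed simp
qed

lemma co_shifted_nilpotent:
  assumes "v \<in> carrier N" "\<And>l i. i > j \<Longrightarrow> co v (l, i) = 0"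
  shows "(shifted hbar_el (- \<beta>) ^^ Suc j) v = 0"
proof -
  have "co ((shifted hbar_el (- \<beta>) ^^ n) v) (l, i) = 0" if "i + n > j" for l i n
    using that
  proof (induction n arbitrary: i)
    case (Suc n)
    then show ?case using co_shifted(2)[OF shifted_pow_closed[OF basis_takiff(6) assms(1)]] by simp
  qed (simp add: assms)
  then have "co ((shifted hbar_el (- \<beta>) ^^ Suc j) v) t = 0" for t
    by (cases t) (simp del: funpow.simps)
  then have "co ((shifted hbar_el (- \<beta>) ^^ Suc j) v) = 0" by (intro ext) (simp only: zero_fun_apply)
  then show ?thesis using co_eq_0_iff[OF shifted_pow_closed[OF basis_takiff(6) assms(1)]] by blast
qed

lemma B_in_gen_weight_space: "p (B k j) \<in> gen_weight_space Q (- al k) (- \<beta>)"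
proof -
  have 0: "0 \<in> W k0" by (rule fv.subspace_0[OF W_subspace])
  have "(shifted h_el (- al k) ^^ 1) (B k j) = 0" by (simp add: shifted_def act_basis)
  moreover have "(shifted hbar_el (- \<beta>) ^^ Suc j) (B k j) = 0"
    by (rule co_shifted_nilpotent) (auto simp: delta_def)
  ultimately show ?thesis unfolding in_gen_weight_space_iff[OF B_N] using 0 by (metis le_add1 order_refl plus_1_eq_Suc)
qed

lemma Q_gen_weight: "gen_weight_module Q"
  unfolding gen_weight_module_def
proof
  show "lie_module takiff Q" by (rule Q_lie_module)
  interpret Q: module cplx Q using Q_lie_module by (simp add: lie_module_def)
  let ?G = "\<Union>m mb. gen_weight_space Q m mb"
  show "lin_span Q ?G = carrier Q"
  proof
    have "?G \<subseteq> carrier Q" by (auto simp: gen_weight_space_def)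
    then show "lin_span Q ?G \<subseteq> carrier Q"
      unfolding lin_span_def using Q.carrier_is_submodule by blast
    show "carrier Q \<subseteq> lin_span Q ?G"
      unfolding lin_span_def
    proof (rule Inter_greatest, clarify)
      fix Y C assume Y: "submodule Y cplx Q" "?G \<subseteq> Y" and C: "C \<in> carrier Q"
      note YE = Q.submoduleE[OF Y(1)]
      let ?Z = "{v \<in> carrier N. p v \<in> Y}"
      have "fv.subspace ?Z"
        unfolding fv.subspace_def mem_Collect_eq
      proof (intro conjI ballI allI)
        show "0 \<in> carrier N" by (rule N0)
        have "\<zero>\<^bsub>Q\<^esub> \<in> Y" using subgroup.one_closed[OF submodule.axioms(1)[OF Y(1)]] by simp
        then show "p 0 \<in> Y" by (simp add: Q_zero)
        fix x y assume xy: "x \<in> ?Z" "y \<in> ?Z"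
        then show "x + y \<in> carrier N" by (auto intro: fv.subspace_add[OF N_subspace])
        show "p (x + y) \<in> Y" using xy YE(5)[of "p x" "p y"] by (simp add: Q_add)
      next
        fix c x assume x: "x \<in> ?Z"
        then show "fscale c x \<in> carrier N" by (auto intro: fv.subspace_scale[OF N_subspace])
        show "p (fscale c x) \<in> Y" using x YE(4)[of c "p x"] by (simp add: Q_smult)
      qed
      moreover have "range (bas \<alpha> \<beta>) \<subseteq> ?Z"
      proof -
        have "p (B k j) \<in> Y" for k j using B_in_gen_weight_space[of k j] Y(2) by blast
        then show ?thesis by auto
      qed
      ultimately have "carrier N \<subseteq> ?Z"
        unfolding carrier_N by (intro fv.span_minimal)
      then show "C \<in> Y" using C by (auto simp: Q_carrier)
    qed
  qed
qed

text \<open>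
  A vector outside \<open>W k0\<close> with coordinates at \<open>(k, j)\<close> beyond the cone, \<open>j\<close> maximal, forces the weight to be
  that of \<open>B k j\<close>. All \<open>B k i\<close> have this weight. Finitely many classes involve only finitely many \<open>i\<close>, so
  that for large \<open>i\<close> the class of \<open>B k i\<close> is not in their span.
\<close>

lemma Q_infinite: "infinite_dim_weight_spaces Q"
  unfolding infinite_dim_weight_spaces_def
proof (intro conjI allI impI)
  interpret Q: module cplx Q using Q_lie_module by (simp add: lie_module_def)
  have "p (B (k0 - 1) 0) \<noteq> \<zero>\<^bsub>Q\<^esub>" by (simp add: p_eq_zero_iff B_W)
  then have "gen_weight_space Q (- al (k0 - 1)) (- \<beta>) \<noteq> {\<zero>\<^bsub>Q\<^esub>}" using B_in_gen_weight_space[of "k0 - 1" 0] by auto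
  then show "\<exists>m mb. gen_weight_space Q m mb \<noteq> {\<zero>\<^bsub>Q\<^esub>}" by blast
  fix m mb assume ne: "gen_weight_space Q m mb \<noteq> {\<zero>\<^bsub>Q\<^esub>}"
  have W0: "0 \<in> W k0" by (rule fv.subspace_0[OF W_subspace])
  have "(shifted x c ^^ 1) 0 = 0" if "x \<in> carrier takiff" for x c by (simp add: shifted_def N_act_zero[OF that])
  then have "p 0 \<in> gen_weight_space Q m mb"
    unfolding in_gen_weight_space_iff[OF N0] using W0 by (metis basis_takiff(5,6) order_refl)
  then obtain C where C: "C \<in> gen_weight_space Q m mb" "C \<noteq> \<zero>\<^bsub>Q\<^esub>" using ne by (auto simp: Q_zero)
  then have "C \<in> carrier Q" by (simp add: gen_weight_space_def)
  then obtain v where v: "v \<in> carrier N" "C = p v" by (auto simp: Q_carrier)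
  then have "v \<notin> W k0" using C(2) p_eq_zero_iff by blast
  then obtain k j0 where k: "co v (k, j0) \<noteq> 0" "\<not> k \<ge> k0 + int j0" using v W_iff by blast
  define j where "j = Max {j. co v (k, j) \<noteq> 0}"
  have fin: "finite {j. co v (k, j) \<noteq> 0}"
    using finite_subset[of "Pair k ` {j. co v (k, j) \<noteq> 0}" "{t. co v t \<noteq> 0}"] co_finite[OF v(1)]
    by (auto simp: finite_image_iff inj_on_def)
  have j: "co v (k, j) \<noteq> 0" using Max_in[OF fin] k(1) unfolding j_def by auto
  have jmax: "co v (k, i) = 0" if "i > j" for i using that Max_ge[OF fin, of i] by (auto simp: j_def[symmetric])
  have "j0 \<le> j" using Max_ge[OF fin, of j0] k(1) by (simp add: j_def)
  then have out: "\<not> k \<ge> k0 + int j" using k(2) by simp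
  obtain n n' where n: "(shifted h_el m ^^ n) v \<in> W k0" "(shifted hbar_el mb ^^ n') v \<in> W k0"
    using C(1) v in_gen_weight_space_iff by blast
  have "(- al k - m) ^ n * co v (k, j) = 0" using co_W_zero[OF n(1) out] co_shifted_pow_h[OF v(1)] by simp
  then have m: "m = - al k" using j by (auto simp: algebra_simps)
  have "(- \<beta> - mb) ^ n' * co v (k, j) = 0" 
    using co_W_zero[OF n(2) out] co_shifted_pow_hbar[OF v(1) jmax] by simp
  then have mb: "mb = - \<beta>" using j by (auto simp: algebra_simps)
  show "infinite_dim Q (gen_weight_space Q m mb)"
    unfolding infinite_dim_def
  proof (rule notI, elim exE conjE)
    fix S assume S: "finite S" "S \<subseteq> gen_weight_space Q m mb" "gen_weight_space Q m mb \<subseteq> lin_span Q S"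
    have "\<forall>s\<in>S. \<exists>v. v \<in> carrier N \<and> s = p v"
      using S(2) by (auto simp: gen_weight_space_def Q_carrier)
    then obtain r where r: "\<And>s. s \<in> S \<Longrightarrow> r s \<in> carrier N \<and> s = p (r s)" by metis
    have "finite (\<Union>s\<in>S. snd ` {t. co (r s) t \<noteq> 0})"
      using S(1) r co_finite by (intro finite_UN_I finite_imageI) auto
    then obtain M where M: "\<forall>i\<in>(\<Union>s\<in>S. snd ` {t. co (r s) t \<noteq> 0}). i < M"
      by (metis finite_nat_set_iff_bounded)
    \<comment> \<open>Beyond the supports of all representatives, and far enough for \<open>(k, i)\<close> to lie outside the cone.\<close>
    define i where "i = max M (nat (k - k0 + 1))"
    have iout: "\<not> k \<ge> k0 + int i" by (auto simp: i_def)
    have ri: "co (r s) (k, i) = 0" if "s \<in> S" for s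
    proof (rule ccontr)
      assume "co (r s) (k, i) \<noteq> 0"
      then have "i \<in> snd ` {t. co (r s) t \<noteq> 0}" by (metis (mono_tags, lifting) image_eqI mem_Collect_eq snd_conv)
      then have "i < M" using M that by blast
      then show False by (simp add: i_def)
    qed
    \<comment> \<open>The condition does not depend on the representative, as elements of \<open>W k0\<close> have no coordinate at \<open>(k, i)\<close>.\<close>
    let ?Y = "p ` {v \<in> carrier N. co v (k, i) = 0}"
    have "submodule ?Y cplx Q"
    proof (rule Q.submoduleI)
      show "?Y \<subseteq> carrier Q" by (auto simp: Q_carrier)
      have "0 \<in> {v \<in> carrier N. co v (k, i) = 0}" using N0 by simp
      then show "\<zero>\<^bsub>Q\<^esub> \<in> ?Y" unfolding Q_zero by (rule imageI)
      show "x \<oplus>\<^bsub>Q\<^esub> y \<in> ?Y" if xy: "x \<in> ?Y" "y \<in> ?Y" for x y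
      proof -
        obtain v w where vw: "v \<in> carrier N" "co v (k, i) = 0" "x = p v" "w \<in> carrier N" "co w (k, i) = 0" "y = p w"
          using xy by blast
        have "co (v + w) (k, i) = 0" using bas.coord_add vw unfolding carrier_N by simp
        then show ?thesis using vw fv.subspace_add[OF N_subspace vw(1,4)] by (simp add: Q_add)
      qed
      show sm: "c \<odot>\<^bsub>Q\<^esub> x \<in> ?Y" if xy: "x \<in> ?Y" for x c
      proof -
        obtain v where vw: "v \<in> carrier N" "co v (k, i) = 0" "x = p v" using xy by blast
        then show ?thesis using fv.subspace_scale[OF N_subspace vw(1)] by (simp add: Q_smult co_lin)
      qed
      show "\<ominus>\<^bsub>Q\<^esub> x \<in> ?Y" if xy: "x \<in> ?Y" for x
      proof -
        obtain v where vw: "v \<in> carrier N" "x = p v" using xy by blast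
        have "\<ominus>\<^bsub>Q\<^esub> x = (-1) \<odot>\<^bsub>Q\<^esub> x"
        proof (rule Q.M.minus_equality)
          show "(-1) \<odot>\<^bsub>Q\<^esub> x \<oplus>\<^bsub>Q\<^esub> x = \<zero>\<^bsub>Q\<^esub>"
            unfolding vw(2) Q_smult[OF vw(1)] Q_add[OF fv.subspace_scale[OF N_subspace vw(1)] vw(1)] Q_zero by simp
        qed (use vw Q_carrier Q.smult_closed in auto)
        then show ?thesis using sm[OF xy] by simp
      qed
    qed
    moreover have "S \<subseteq> ?Y" using r ri by blast
    ultimately have "lin_span Q S \<subseteq> ?Y" unfolding lin_span_def by blast
    then have "p (B k i) \<in> ?Y" using S(3) B_in_gen_weight_space[of k i] m mb by blast
    then obtain v where vw: "v \<in> carrier N" "co v (k, i) = 0" "p (B k i) = p v" by blast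
    then have "B k i - v \<in> W k0" by (simp add: p_eq_iff)
    then have "co (B k i - v) (k, i) = 0" using iout by (rule co_W_zero)
    then show False using vw by (simp add: co_lin delta_def)
  qed
qed

end

end

section \<open>Isomorphisms between the modules N\<close>

context nmod
begin

text \<open>
  The diagonal map \<open>B k j \<mapsto> r^k B k j\<close>. Raising \<open>k\<close> is proportional to \<open>lam\<close> and lowering \<open>k\<close> to
  \<open>1 / lam\<close>, so it changes the parameter \<open>lam\<close> into \<open>r lam\<close>.
\<close>

definition rescale :: "complex \<Rightarrow> (poly_hh \<Rightarrow> complex) \<Rightarrow> poly_hh \<Rightarrow> complex" where
  "rescale r v = lin_ext (bas \<alpha> \<beta>) (\<lambda>t. r powi fst t * co v t)"

lemma rescaled_coord_fin_supp:
  assumes "v \<in> carrier N"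
  shows "(\<lambda>t. r powi fst t * co v t) \<in> fin_supp UNIV"
  using finite_subset[OF _ co_finite[OF assms], of "{t. r powi fst t * co v t \<noteq> 0}"]
  by (auto simp: fin_supp_def)

lemma rescale_closed:
  assumes "v \<in> carrier N"
  shows "rescale r v \<in> carrier N"
  unfolding rescale_def
  by (rule lin_ext_in_subspace[OF N_subspace rescaled_coord_fin_supp[OF assms]]) simp

lemma co_rescale:
  assumes "v \<in> carrier N"
  shows "co (rescale r v) = (\<lambda>t. r powi fst t * co v t)"
  unfolding rescale_def by (rule bas.coord_lin_ext[OF rescaled_coord_fin_supp[OF assms]])

lemma rescale_add:
  assumes "v \<in> carrier N" "w \<in> carrier N"
  shows "rescale r (v + w) = rescale r v + rescale r w"
proof -
  have "co (v + w) = co v + co w" using assms unfolding carrier_N by (rule bas.coord_add)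
  then have "(\<lambda>t. r powi fst t * co (v + w) t) = (\<lambda>t. r powi fst t * co v t) + (\<lambda>t. r powi fst t * co w t)"
    by (simp add: fun_eq_iff distrib_left)
  then show ?thesis
    unfolding rescale_def using lin_ext_add[OF rescaled_coord_fin_supp[OF assms(1)] rescaled_coord_fin_supp[OF assms(2)]]
    by simp
qed

lemma rescale_scale:
  assumes "v \<in> carrier N"
  shows "rescale r (fscale c v) = fscale c (rescale r v)"
proof -
  have "co (fscale c v) = fscale c (co v)" using assms unfolding carrier_N by (rule bas.coord_scale)
  then have "(\<lambda>t. r powi fst t * co (fscale c v) t) = fscale c (\<lambda>t. r powi fst t * co v t)"
    by (simp add: fun_eq_iff)
  then show ?thesis unfolding rescale_def lin_ext_scale[symmetric] by simp
qed

lemma rescale_basis: "rescale r (B k j) = fscale (r powi k) (B k j)"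
proof -
  have "(\<lambda>t. r powi fst t * co (B k j) t) = fscale (r powi k) (delta (k, j))"
    by (auto simp: fun_eq_iff delta_def)
  then show ?thesis unfolding rescale_def by (simp only: lin_ext_scale lin_ext_delta)
qed

lemma co_inject:
  assumes "v \<in> carrier N" "w \<in> carrier N" "co v = co w"
  shows "v = w"
  using assms bas.lin_ext_coord unfolding carrier_N by metis

lemma rescale_inverse:
  assumes "v \<in> carrier N" "r * s = 1"
  shows "rescale r (rescale s v) = v"
proof (rule co_inject)
  have "r powi k * s powi k = 1" for k
    using assms(2) by (metis power_int_1_left power_int_mult_distrib)
  then show "co (rescale r (rescale s v)) = co v"
    unfolding co_rescale[OF rescale_closed[OF assms(1)]] co_rescale[OF assms(1)]
    by (simp add: fun_eq_iff mult.assoc[symmetric])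
qed (use assms rescale_closed in auto)

lemma isomorphic_lam:
  assumes "lam' \<noteq> 0"
  shows "isomorphic_rep takiff N (N_mod lam' a b \<alpha> \<beta>)"
proof -
  interpret N': nmod lam' a b \<alpha> \<beta> by unfold_locales (rule assms)
  define r where "r = lam' / lam"
  have r: "r \<noteq> 0" using assms lam by (simp add: r_def)
  have car: "carrier N'.N = carrier N" by (simp add: carrier_N N'.carrier_N)
  have pw: "r powi (k + 1) = r powi k * (lam' / lam)" "r powi (k - 1) = r powi k * (lam / lam')" for k
    using r by (simp_all add: power_int_add power_int_diff r_def)
  have "rescale r (act N x v) = act N'.N x (rescale r v)" 
    if x: "x \<in> carrier takiff" and v: "v \<in> carrier N" for x v
  proof -
    note cl = fv.subspace_add[OF N_subspace] fv.subspace_scale[OF N_subspace]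
    have basis: "rescale r (act N z (B k j)) = act N'.N z (rescale r (B k j))" 
      if "z \<in> takiff_basis" for z k j
    proof -
      have z: "z \<in> carrier takiff" using that by auto
      have "act N'.N z (rescale r (B k j)) = fscale (r powi k) (act N'.N z (B k j))"
        unfolding rescale_basis by (rule N'.N_act_scale[OF z N'.B_N])
      moreover have "rescale r (act N z (B k j)) = fscale (r powi k) (act N'.N z (B k j))"
        using that lam assms
        by (auto simp: act_basis N'.act_basis rescale_add rescale_scale rescale_basis cl pw fun_eq_iff 
            simp del: fv.scale_minus_left) (simp_all add: field_simps)
      ultimately show ?thesis by simp
    qed
    obtain C D where CD: "x = (C, D)" by fastforce
    have x_basis: "rescale r (act N x (B k j)) = act N'.N x (rescale r (B k j))" for k j
    proof -
      have B': "rescale r (B k j) \<in> carrier N'.N" unfolding car by (rule rescale_closed[OF B_N])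
      have ac: "act N z (B k j) \<in> carrier N" if "z \<in> carrier takiff" for z
        by (rule N_act(1)[OF that B_N B_N])
      show ?thesis
        unfolding CD act_decomp[OF N_pointwise N_lie_module x[unfolded CD] B_N]
          act_decomp[OF N'.N_pointwise N'.N_lie_module x[unfolded CD] B']
        by (simp only: rescale_add rescale_scale cl ac basis_takiff basis insert_iff simp_thms)
    qed
    let ?E = "{v \<in> carrier N. rescale r (act N x v) = act N'.N x (rescale r v)}"
    have "fv.subspace ?E"
      unfolding fv.subspace_def mem_Collect_eq
    proof (intro conjI ballI allI)
      show z: "0 \<in> carrier N" by (rule fv.subspace_0[OF N_subspace])
      have "rescale r 0 = 0" using rescale_scale[OF z, of r 0] by simp
      then show "rescale r (act N x 0) = act N'.N x (rescale r 0)"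
        by (simp add: N_act_zero[OF x] N'.N_act_zero[OF x])
      fix v w assume vw: "v \<in> ?E"
        "w \<in> ?E"
      then show "v + w \<in> carrier N" using cl by auto
      have c: "v \<in> carrier N" "w \<in> carrier N" "rescale r v \<in> carrier N'.N" "rescale r w \<in> carrier N'.N"
        using vw rescale_closed car by auto
      show "rescale r (act N x (v + w)) = act N'.N x (rescale r (v + w))"
        unfolding N_act(2)[OF x c(1,2)] rescale_add[OF c(1,2)] N'.N_act(2)[OF x c(3,4)]
          rescale_add[OF N_act(1)[OF x c(1,1)] N_act(1)[OF x c(2,2)]] using vw by simp
    next
      fix c v assume v: "v \<in> ?E"
      then show "fscale c v \<in> carrier N" using cl by auto
      have v': "v \<in> carrier N" "rescale r v \<in> carrier N'.N" using v rescale_closed car by auto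
      show "rescale r (act N x (fscale c v)) = act N'.N x (rescale r (fscale c v))"
        unfolding N_act_scale[OF x v'(1)] rescale_scale[OF v'(1)] N'.N_act_scale[OF x v'(2)]
          rescale_scale[OF N_act(1)[OF x v'(1,1)]] using v by simp
    qed
    moreover have "range (bas \<alpha> \<beta>) \<subseteq> ?E"
      using x_basis by auto
    ultimately have "carrier N \<subseteq> ?E"
      unfolding carrier_N by (intro fv.span_minimal)
    then show ?thesis using v by blast
  qed
  moreover have "bij_betw (rescale r) (carrier N) (carrier N'.N)"
    unfolding car
    by (rule bij_betw_byWitness[of _ "rescale (1 / r)"]) 
      (use r rescale_closed in \<open>auto simp: rescale_inverse\<close>)
  ultimately have "rep_iso takiff N N'.N (rescale r)"
    by (simp add: rep_iso_def pointwiseD[OF N_pointwise] pointwiseD[OF N'.N_pointwise] rescale_add rescale_scale)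
  then show ?thesis unfolding isomorphic_rep_def by blast
qed

text \<open>
  The element \<open>e\<close>-bar \<open>f\<close>-bar sees \<open>\<beta>\<^sup>2 + a\<close>, and in \<open>e f\<close>-bar \<open>+ e\<close>-bar \<open>f\<close> the terms with \<open>B k 1\<close> cancel and
  leave \<open>(\<alpha> + 2k + 2) \<beta> + b\<close>.
\<close>

lemma casimir:
  "act N ebar_el (act N fbar_el (B k 0)) = fscale (- (\<beta>\<^sup>2 + a) / 4) (B k 0)" (is ?P1)
  "act N e_el (act N fbar_el (B k 0)) + act N ebar_el (act N f_el (B k 0)) = 
     fscale (- ((al k + 2) * \<beta> + b) / 2) (B k 0)" (is ?P2)
proof -
  show ?P1
    unfolding act_basis N_act_scale[OF basis_takiff(3) B_N]
    using lam by (simp add: fun_eq_iff field_simps)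
  show ?P2
    unfolding act_basis N_act_scale[OF basis_takiff(3) B_N] N_act_scale[OF basis_takiff(1) B_N] alpha_at_step
    using lam by (simp add: fun_eq_iff field_simps)
qed

end

lemma N_mod_shift:
  assumes "\<alpha> - \<alpha>' = 2 * of_int n"
  shows "N_mod lam a b \<alpha> \<beta> = N_mod lam a b \<alpha>' \<beta>"
proof -
  have "alpha_at \<alpha> k = alpha_at \<alpha>' (k + n)" for k
    using assms by (simp add: alpha_at_def algebra_simps)
  then have "bas \<alpha> \<beta> (k, j) = bas \<alpha>' \<beta> (k + n, j)" for k j by (simp add: bas_def)
  then have "bas \<alpha> \<beta> = bas \<alpha>' \<beta> \<circ> (\<lambda>(k, j). (k + n, j))" by (auto simp: fun_eq_iff)
  moreover have "range (\<lambda>(k :: int, j :: nat). (k + n, j)) = UNIV"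
    by (rule surjI[of _ "\<lambda>(k, j). (k - n, j)"]) auto
  ultimately have "range (bas \<alpha> \<beta>) = range (bas \<alpha>' \<beta>)" by (metis image_comp)
  then show ?thesis by (simp add: N_mod_eq)
qed

text \<open>
  The image \<open>v\<close> of \<open>B 0 0\<close> is a common eigenvector of \<open>h\<close> and \<open>h\<close>-bar. In coordinates: the eigenvalue of \<open>h\<close>
  confines \<open>v\<close> to one \<open>k\<close>, and since \<open>h\<close>-bar differs from a scalar by a lowering of \<open>j\<close>, only \<open>j = 0\<close> is left.
  On \<open>B k 0\<close> the eigenvalues of \<open>casimir\<close> determine the remaining parameters.
\<close>

lemma isomorphic_imp_parameters:
  assumes lam: "lam \<noteq> 0" "lam' \<noteq> 0"
    and iso: "isomorphic_rep takiff (N_mod lam a b \<alpha> \<beta>) (N_mod lam' a' b' \<alpha>' \<beta>')"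
  shows "(\<exists>n::int. \<alpha> - \<alpha>' = 2 * of_int n) \<and> \<beta> = \<beta>' \<and> a = a' \<and> b = b'"
proof -
  interpret M: nmod lam a b \<alpha> \<beta> by unfold_locales (rule lam)
  interpret M': nmod lam' a' b' \<alpha>' \<beta>' by unfold_locales (rule lam)
  obtain f where f: "rep_iso takiff M.N M'.N f" using iso by (auto simp: isomorphic_rep_def)
  have bij: "bij_betw f (carrier M.N) (carrier M'.N)"
    and fadd: "f (v + w) = f v + f w" and fsc: "f (fscale c v) = fscale c (f v)"
    and fact: "f (act M.N x v) = act M'.N x (f v)"
    if "v \<in> carrier M.N" "w \<in> carrier M.N" "x \<in> carrier takiff" for v w x c
    using f that by (auto simp: rep_iso_def pointwiseD[OF M.N_pointwise] pointwiseD[OF M'.N_pointwise])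
  have fcl: "f v \<in> carrier M'.N" if "v \<in> carrier M.N" for v
    using f that by (auto simp: rep_iso_def bij_betw_def)
  note bt = basis_takiff(1)
  let ?B = "M.B 0 0"
  define v where "v = f ?B"
  have vN: "v \<in> carrier M'.N" unfolding v_def by (rule fcl[OF M.B_N])
  have zN: "0 \<in> carrier M.N" by (rule fv.subspace_0[OF M.N_subspace])
  have f0: "f 0 = 0" using fsc[OF zN zN bt, of 0] by simp
  have v0: "v \<noteq> 0"
  proof
    assume "v = 0"
    then have "f ?B = f 0" by (simp add: v_def f0)
    moreover have "inj_on f (carrier M.N)" using f by (simp add: rep_iso_def bij_betw_def)
    ultimately have "?B = 0" using M.B_N zN by (meson inj_onD)
    then show False using M.B_nonzero by blast
  qed
  have h: "act M'.N h_el v = fscale (- \<alpha>) v"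
  proof -
    have "act M'.N h_el v = f (act M.N h_el ?B)" unfolding v_def using fact[OF M.B_N M.B_N] by simp
    also have "act M.N h_el ?B = fscale (- \<alpha>) ?B" unfolding M.act_basis by (simp add: alpha_at_def)
    finally show ?thesis unfolding v_def using fsc[OF M.B_N M.B_N bt] by (simp only:)
  qed
  have hb: "act M'.N hbar_el v = fscale (- \<beta>) v"
  proof -
    have "act M'.N hbar_el v = f (act M.N hbar_el ?B)" unfolding v_def using fact[OF M.B_N M.B_N] by simp
    also have "act M.N hbar_el ?B = fscale (- \<beta>) ?B" unfolding M.act_basis by simp
    finally show ?thesis unfolding v_def using fsc[OF M.B_N M.B_N bt] by (simp only:)
  qed
  have cs: "M'.co (fscale c v) t = c * M'.co v t" for c t
    using bas.coord_scale vN unfolding M'.carrier_N by simp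
  have ch: "M'.al k = \<alpha>" if "M'.co v (k, j) \<noteq> 0" for k j
  proof -
    have "- M'.al k * M'.co v (k, j) = - \<alpha> * M'.co v (k, j)"
      using M'.co_act(1)[OF vN, of k j] h by (simp only: cs)
    then show ?thesis using that by simp
  qed
  have chb: "- \<beta>' * M'.co v (k, j) - of_nat (Suc j) * M'.co v (k, Suc j) = - \<beta> * M'.co v (k, j)" for k j
    using M'.co_act(2)[OF vN, of k j] hb by (simp only: cs)
  obtain k j0 where k: "M'.co v (k, j0) \<noteq> 0"
    using v0 M'.co_eq_0_iff[OF vN] by (auto simp: fun_eq_iff)
  define j where "j = Max {j. M'.co v (k, j) \<noteq> 0}"
  have fin: "finite {j. M'.co v (k, j) \<noteq> 0}"
    using finite_subset[of "Pair k ` {j. M'.co v (k, j) \<noteq> 0}" "{t. M'.co v t \<noteq> 0}"] M'.co_finite[OF vN]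
    by (auto simp: finite_image_iff inj_on_def)
  have j: "M'.co v (k, j) \<noteq> 0" using Max_in[OF fin] k unfolding j_def by auto
  have "M'.co v (k, Suc j) = 0" using Max_ge[OF fin, of "Suc j"] by (auto simp: j_def[symmetric])
  then have \<beta>: "\<beta> = \<beta>'" using chb[of k j] j by simp
  have "M'.co v (l, Suc i) = 0" for l i using chb[of l i] \<beta> by (simp del: of_nat_Suc)
  moreover have "M'.co v (l, 0) = 0" if "l \<noteq> k" for l
    using ch[OF k] ch[of l 0] that alpha_at_inj by metis
  ultimately have "M'.co v s = 0" if "s \<noteq> (k, 0)" for s
    using that by (cases s; cases "snd s") auto
  from M'.single_coord[OF vN this] obtain c where v: "v = fscale c (M'.B k 0)" by blast
  have \<alpha>: "\<alpha> - \<alpha>' = 2 * of_int k" using ch[OF k] by (simp add: alpha_at_def algebra_simps)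
  have acl: "act M.N x w \<in> carrier M.N" if "x \<in> carrier takiff" "w \<in> carrier M.N" for x w
    by (rule M.N_act(1)[OF that that(2)])
  have acl': "act M'.N x w \<in> carrier M'.N" if "x \<in> carrier takiff" "w \<in> carrier M'.N" for x w
    by (rule M'.N_act(1)[OF that that(2)])
  have f2: "f (act M.N x (act M.N y ?B)) = act M'.N x (act M'.N y v)" 
    if "x \<in> carrier takiff" "y \<in> carrier takiff" for x y
    unfolding v_def
    using fact[OF acl[OF that(2) M.B_N] M.B_N that(1)] fact[OF M.B_N M.B_N that(2)] by simp
  have v2: "act M'.N x (act M'.N y v) = fscale c (act M'.N x (act M'.N y (M'.B k 0)))"
    if "x \<in> carrier takiff" "y \<in> carrier takiff" for x y
    unfolding v M'.N_act_scale[OF that(2) M'.B_N] M'.N_act_scale[OF that(1) acl'[OF that(2) M'.B_N]] ..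
  have eq: "x = y" if "fscale x v = fscale y v" for x y
    using that v0 fv.scale_right_imp_eq by blast
  have "fscale (- (\<beta>\<^sup>2 + a) / 4) v = fscale (- (\<beta>'\<^sup>2 + a') / 4) v"
  proof -
    have "fscale (- (\<beta>\<^sup>2 + a) / 4) v = f (act M.N ebar_el (act M.N fbar_el ?B))"
      unfolding M.casimir v_def using fsc[OF M.B_N M.B_N bt] by simp
    also have "\<dots> = fscale c (act M'.N ebar_el (act M'.N fbar_el (M'.B k 0)))"
      by (simp only: f2 v2 basis_takiff)
    also have "\<dots> = fscale (- (\<beta>'\<^sup>2 + a') / 4) v" unfolding M'.casimir v by (simp add: mult.commute)
    finally show ?thesis .
  qed
  then have a: "a = a'" using eq \<beta> by fastforce
  have "fscale (- ((\<alpha> + 2) * \<beta> + b) / 2) v = fscale (- ((M'.al k + 2) * \<beta>' + b') / 2) v"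
  proof -
    have "fscale (- ((\<alpha> + 2) * \<beta> + b) / 2) v = fscale (- ((M.al 0 + 2) * \<beta> + b) / 2) v"
      by (simp add: alpha_at_def)
    also have "\<dots> = f (act M.N e_el (act M.N fbar_el ?B) + act M.N ebar_el (act M.N f_el ?B))"
      unfolding M.casimir v_def using fsc[OF M.B_N M.B_N bt] by simp
    also have "\<dots> = f (act M.N e_el (act M.N fbar_el ?B)) + f (act M.N ebar_el (act M.N f_el ?B))"
      by (rule fadd[OF _ _ bt]) (intro acl basis_takiff M.B_N)+
    also have "\<dots> = fscale c (act M'.N e_el (act M'.N fbar_el (M'.B k 0)) + act M'.N ebar_el (act M'.N f_el (M'.B k 0)))"
      by (simp only: f2 v2 basis_takiff fv.scale_right_distrib)
    also have "\<dots> = fscale (- ((M'.al k + 2) * \<beta>' + b') / 2) v" unfolding M'.casimir v by (simp add: mult.commute)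
    finally show ?thesis .
  qed
  then have "b = b'" using eq[of "- ((\<alpha> + 2) * \<beta> + b) / 2" "- ((M'.al k + 2) * \<beta>' + b') / 2"] \<beta> ch[OF k] by simp
  with \<alpha> \<beta> a show ?thesis by blast
qed

lemma isomorphic_iff_parameters:
  assumes nz: "lam \<noteq> 0" "lam' \<noteq> 0"
  shows "isomorphic_rep takiff (N_mod lam a b \<alpha> \<beta>) (N_mod lam' a' b' \<alpha>' \<beta>') \<longleftrightarrow>
    (\<exists>n::int. \<alpha> - \<alpha>' = 2 * of_int n) \<and> \<beta> = \<beta>' \<and> a = a' \<and> b = b'"
proof
  assume R: "(\<exists>n::int. \<alpha> - \<alpha>' = 2 * of_int n) \<and> \<beta> = \<beta>' \<and> a = a' \<and> b = b'"
  interpret nmod lam a b \<alpha> \<beta> by unfold_locales (rule nz)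
  have "N_mod lam' a' b' \<alpha>' \<beta>' = N_mod lam' a b \<alpha> \<beta>" using R N_mod_shift by metis
  then show "isomorphic_rep takiff (N_mod lam a b \<alpha> \<beta>) (N_mod lam' a' b' \<alpha>' \<beta>')"
    using isomorphic_lam[OF nz(2)] by simp
qed (rule isomorphic_imp_parameters[OF nz])

lemma isomorphic_rep_refl: "isomorphic_rep L M M"
  unfolding isomorphic_rep_def rep_iso_def by (rule exI[of _ "\<lambda>v. v"]) (simp add: bij_betw_def)

theorem theorem4p5:
  fixes lam \<alpha> \<beta> a b :: complex
  assumes "lam \<noteq> 0"
  shows
    "(simple_rep takiff (N_mod lam a b \<alpha> \<beta>) \<longleftrightarrow>
        \<beta>\<^sup>2 + a \<noteq> 0 \<or>
        (\<beta>\<^sup>2 + a = 0 \<and>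
         (\<forall>k::int. \<forall>s::nat. s \<ge> 1 \<longrightarrow> (alpha_at \<alpha> k - 2 * of_nat s) * \<beta> + b \<noteq> 0)))
     \<and>
     (\<not> simple_rep takiff (N_mod lam a b \<alpha> \<beta>) \<longrightarrow>
        (let N = N_mod lam a b \<alpha> \<beta>;
             \<eta> = (\<lambda>k. eta (alpha_at \<alpha> k) \<beta> 1);
             N' = (\<lambda>k. env_orbit takiff N (\<eta> k))
         in
          (\<exists>(k::int) (s::nat). s \<ge> 1 \<and> (alpha_at \<alpha> k - 2 * of_nat s) * \<beta> + b = 0 \<and>
             is_verma_with_hwv (N\<lparr>carrier := N' k\<rparr>) (\<eta> k)) \<and>
          (\<forall>(k::int) (s::nat). s \<ge> 1 \<and> (alpha_at \<alpha> k - 2 * of_nat s) * \<beta> + b = 0 \<longrightarrow>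
             (s = 1 \<or> \<beta> = 0 \<longrightarrow> is_verma_with_hwv (N\<lparr>carrier := N' k\<rparr>) (\<eta> k)) \<and>
             (\<beta> \<noteq> 0 \<longrightarrow> is_verma_with_hwv (N\<lparr>carrier := N' k\<rparr>) (\<eta> (k - int s + 1))) \<and>
             lie_submodule takiff N (N' k) \<and>
             (\<exists>V' :: (takiff, (poly_hh \<Rightarrow> complex) set) rep.
                isomorphic_rep takiff (quot_rep N (N' k)) V' \<and>
                gen_weight_module V' \<and> infinite_dim_weight_spaces V'))))
     \<and>
     (\<forall>\<alpha> \<beta> a b lam lam' :: complex. lam \<noteq> 0 \<and> lam' \<noteq> 0 \<longrightarrow>
        isomorphic_rep takiff (N_mod lam a b \<alpha> \<beta>) (N_mod lam' a b \<alpha> \<beta>))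
     \<and>
     (\<forall>\<alpha> \<beta> \<alpha>' \<beta>' a b a' b' lam lam' :: complex. lam \<noteq> 0 \<and> lam' \<noteq> 0 \<longrightarrow>
        (isomorphic_rep takiff (N_mod lam a b \<alpha> \<beta>) (N_mod lam' a' b' \<alpha>' \<beta>') \<longleftrightarrow>
           (\<exists>n::int. \<alpha> - \<alpha>' = 2 * of_int n) \<and> \<beta> = \<beta>' \<and> a = a' \<and> b = b'))"
proof -
  interpret nmod lam a b \<alpha> \<beta> by unfold_locales (rule assms)
  let ?cond = "\<beta>\<^sup>2 + a \<noteq> 0 \<or> (\<beta>\<^sup>2 + a = 0 \<and>
         (\<forall>k::int. \<forall>s::nat. s \<ge> 1 \<longrightarrow> (alpha_at \<alpha> k - 2 * of_nat s) * \<beta> + b \<noteq> 0))"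
  have shift: "(al k - 2 * of_nat s) * \<beta> + b = (al (k - int s + 1) - 2) * \<beta> + b" for k s
    by (simp add: alpha_at_def algebra_simps)
  have simple: "simple_rep takiff N \<longleftrightarrow> ?cond"
  proof
    assume s: "simple_rep takiff N"
    have "(al k - 2 * of_nat s) * \<beta> + b \<noteq> 0" if "\<beta>\<^sup>2 + a = 0" for k s
      using not_simple[OF that, of "k - int s + 1"] s shift[of k s] by metis
    then show ?cond by blast
  next
    assume c: ?cond
    have "(al k - 2) * \<beta> + b \<noteq> 0" if "\<beta>\<^sup>2 + a = 0" for k
      using c that by (metis mult.right_neutral of_nat_1 order_refl)
    then show "simple_rep takiff N" by (intro simple_if) blast
  qed
  let ?M = "\<lambda>k. N\<lparr>carrier := env_orbit takiff N (B k 0)\<rparr>"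
  let ?root = "\<lambda>(k :: int) (s :: nat). s \<ge> 1 \<and> (al k - 2 * of_nat s) * \<beta> + b = 0"
  let ?prop = "\<lambda>k s. (s = 1 \<or> \<beta> = 0 \<longrightarrow> is_verma_with_hwv (?M k) (B k 0)) \<and>
             (\<beta> \<noteq> 0 \<longrightarrow> is_verma_with_hwv (?M k) (B (k - int s + 1) 0)) \<and>
             lie_submodule takiff N (env_orbit takiff N (B k 0)) \<and>
             (\<exists>V' :: (takiff, (poly_hh \<Rightarrow> complex) set) rep.
                isomorphic_rep takiff (quot_rep N (env_orbit takiff N (B k 0))) V' \<and>
                gen_weight_module V' \<and> infinite_dim_weight_spaces V')"
  have second: "(\<exists>k s. s \<ge> 1 \<and> (al k - 2 * of_nat s) * \<beta> + b = 0 \<and> is_verma_with_hwv (?M k) (B k 0)) \<and>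
      (\<forall>k s. ?root k s \<longrightarrow> ?prop k s)"
    if not_simple_N: "\<not> simple_rep takiff N"
  proof -
    obtain k1 s1 where ks: "\<beta>\<^sup>2 + a = 0" "?root k1 s1"
      using not_simple_N simple by blast
    have props: "?prop k s" if ks': "?root k s" for k s
    proof -
      \<comment> \<open>The orbit depends only on its lowest eta: for \<open>\<beta> \<noteq> 0\<close> the element \<open>e\<close> leads from \<open>k\<close> down to
        the unique index that satisfies the equation with \<open>s = 1\<close>, while for \<open>\<beta> = 0\<close> it kills
        every eta of index \<open>1\<close>.\<close>
      define k0 where "k0 = (if \<beta> = 0 then k else k - int s + 1)"
      have z: "(al k0 - 2) * \<beta> + b = 0" using ks' shift[of k s] by (auto simp: k0_def)
      have "env_orbit takiff N (B (k0 + int (nat (k - k0))) 0) = W k0"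
        by (rule orbit_eq_W[OF ks(1) z]) (auto simp: k0_def)
      moreover have "k0 + int (nat (k - k0)) = k" using ks' by (auto simp: k0_def)
      ultimately have orb: "env_orbit takiff N (B k 0) = W k0" by simp
      have verma: "is_verma_with_hwv (N\<lparr>carrier := W k0\<rparr>) (B k0 0)" by (rule W_verma[OF ks(1) z])
      have "s = 1 \<or> \<beta> = 0 \<Longrightarrow> k0 = k" "\<beta> \<noteq> 0 \<Longrightarrow> k0 = k - int s + 1" by (auto simp: k0_def)
      then have "(s = 1 \<or> \<beta> = 0 \<longrightarrow> is_verma_with_hwv (N\<lparr>carrier := W k0\<rparr>) (B k 0)) \<and>
          (\<beta> \<noteq> 0 \<longrightarrow> is_verma_with_hwv (N\<lparr>carrier := W k0\<rparr>) (B (k - int s + 1) 0))"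
        using verma by metis
      moreover have "\<exists>V' :: (takiff, (poly_hh \<Rightarrow> complex) set) rep.
                isomorphic_rep takiff (quot_rep N (W k0)) V' \<and>
                gen_weight_module V' \<and> infinite_dim_weight_spaces V'"
        using isomorphic_rep_refl Q_gen_weight[OF ks(1) z] Q_infinite[OF ks(1) z] by blast
      ultimately show ?thesis
        unfolding orb using W_submodule[OF ks(1) z] by blast
    qed
    have "?root (k1 - int s1 + 1) 1" using ks(2) shift[of k1 s1] by simp
    with props[OF this] have "\<exists>k s. s \<ge> 1 \<and> (al k - 2 * of_nat s) * \<beta> + b = 0 \<and> is_verma_with_hwv (?M k) (B k 0)"
      by blast
    then show ?thesis using props by blast
  qed
  have fourth: "\<forall>\<alpha> \<beta> \<alpha>' \<beta>' a b a' b' lam lam' :: complex. lam \<noteq> 0 \<and> lam' \<noteq> 0 \<longrightarrow>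
        (isomorphic_rep takiff (N_mod lam a b \<alpha> \<beta>) (N_mod lam' a' b' \<alpha>' \<beta>') \<longleftrightarrow>
           (\<exists>n::int. \<alpha> - \<alpha>' = 2 * of_int n) \<and> \<beta> = \<beta>' \<and> a = a' \<and> b = b')"
    using isomorphic_iff_parameters by blast
  have third: "\<forall>\<alpha> \<beta> a b lam lam' :: complex. lam \<noteq> 0 \<and> lam' \<noteq> 0 \<longrightarrow>
        isomorphic_rep takiff (N_mod lam a b \<alpha> \<beta>) (N_mod lam' a b \<alpha> \<beta>)"
    using nmod.isomorphic_lam nmod.intro by blast
  show ?thesis
    unfolding Let_def eta_bas by (rule conjI[OF simple conjI[OF impI[OF second] conjI[OF third fourth]]])
qed

end
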